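(* Let $0<\alpha<1$. There is $\delta>0$ such that the following holds. Let $f:\mathbb{S}^1\to\mathbb{S}^1$ be a $C^{2+\alpha}$ $\delta$-perturbation of the doubling map $f_0(x)=2x$, i.e. $\|f-f_0\|_{C^{2+\alpha}}<\delta$, and let $\psi:(\mathbb{S}^1,f_0)\to(\mathbb{S}^1,f)$ be the Hölder conjugacy between $f_0$ and $f$. Then there exist $C>0$ and $\rho>0$ such that $$\forall \xi\in\mathbb{R}\setminus\{0\},\qquad \left|\int_0^1 e^{i\xi\psi(x)}\,dx\right|\le C|\xi|^{-\rho}.$$
   Context: $\mathbb{S}^1=\mathbb{R}/\mathbb{Z}$, and $f_0:\mathbb{S}^1\to\mathbb{S}^1$ is the doubling map $f_0(x)=2x$. Known fact: for every $0<\alpha<1$ there is $\delta>0$ such that, for every $f:\mathbb{S}^1\to\mathbb{S}^1$ with $\|f-f_0\|_{C^{1+\alpha}}<\delta$, there is a Hölder conjugacy $\psi$ from $f_0$ to $f$: a homeomorphism $\psi:\mathbb{S}^1\to\mathbb{S}^1$, Hölder with Hölder inverse, such that $\psi\circ f_0=f\circ\psi$ (the Hölder exponent may be smaller than $\alpha$). The number $\delta$ is a small enough number depending on $\alpha$, for which in particular this fact holds. In the integral, $\psi$ is viewed as a real-valued function on $[0,1]$, namely a continuous lift $[0,1]\to\mathbb{R}$ of $\psi$ (the choice of lift changes the integral only by a factor of modulus one). *)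

theory Defs
  imports "HOL-Analysis.Analysis"
begin

section \<open>The circle \<open>\<real>/\<int>\<close>\<close>

quotient_type circle = real / "\<lambda>x y :: real. x - y \<in> \<int>"
  morphisms rep_circle to_circle
proof (rule equivpI)
  show "reflp (\<lambda>x y :: real. x - y \<in> \<int>)"
    by (simp add: reflp_def)
  show "symp (\<lambda>x y :: real. x - y \<in> \<int>)"
    by (metis (mono_tags, lifting) Ints_minus minus_diff_eq sympI)
  show "transp (\<lambda>x y :: real. x - y \<in> \<int>)"
  proof (rule transpI)
    fix x y z :: real
    assume "x - y \<in> \<int>" "y - z \<in> \<int>"
    then have "(x - y) + (y - z) \<in> \<int>" by (rule Ints_add)
    then show "x - z \<in> \<int>" by simp
  qed
qed

instantiation circle :: ab_group_add
begin

lift_definition zero_circle :: circle is 0 .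

lift_definition uminus_circle :: "circle \<Rightarrow> circle" is uminus
  by (metis Ints_minus minus_diff_minus)

lift_definition plus_circle :: "circle \<Rightarrow> circle \<Rightarrow> circle" is "(+)"
  by (metis Ints_add add_diff_add)

lift_definition minus_circle :: "circle \<Rightarrow> circle \<Rightarrow> circle" is "(-)"
proof -
  fix a b c d :: real
  assume "a - b \<in> \<int>" "c - d \<in> \<int>"
  then have "(a - b) - (c - d) \<in> \<int>" by (rule Ints_diff)
  then show "(a - c) - (b - d) \<in> \<int>" by (simp add: algebra_simps)
qed

instance
  by standard (transfer; simp add: algebra_simps)+

end

lemma infdist_Ints_attained:
  fixes t :: real
  obtains n where "n \<in> \<int>" "infdist t \<int> = \<bar>t - n\<bar>"
proof -
  have "closed (\<int> :: real set)" "(\<int> :: real set) \<noteq> {}"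
    using closed_Ints Ints_0 by blast+
  from infdist_attains_inf[OF this, of t] show ?thesis
    using that by (auto simp: dist_real_def)
qed

lemma infdist_Ints_le:
  fixes t :: real
  assumes "n \<in> \<int>"
  shows "infdist t \<int> \<le> \<bar>t - n\<bar>"
  using infdist_le[OF assms, of t] by (simp add: dist_real_def)

lemma infdist_Ints_minus:
  fixes t :: real
  shows "infdist (- t) \<int> = infdist t \<int>"
proof -
  have le: "infdist (- s) \<int> \<le> infdist s \<int>" for s :: real
  proof -
    obtain n where n: "n \<in> \<int>" "infdist s \<int> = \<bar>s - n\<bar>"
      by (rule infdist_Ints_attained)
    have "infdist (- s) \<int> \<le> \<bar>- s - (- n)\<bar>"
      by (rule infdist_Ints_le) (use n(1) in simp)
    then show ?thesis using n(2) by simp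
  qed
  show ?thesis using le[of t] le[of "- t"] by simp
qed

lemma infdist_Ints_triangle:
  fixes s t :: real
  shows "infdist (s + t) \<int> \<le> infdist s \<int> + infdist t \<int>"
proof -
  obtain n where n: "n \<in> \<int>" "infdist s \<int> = \<bar>s - n\<bar>"
    by (rule infdist_Ints_attained)
  obtain m where m: "m \<in> \<int>" "infdist t \<int> = \<bar>t - m\<bar>"
    by (rule infdist_Ints_attained)
  have "infdist (s + t) \<int> \<le> \<bar>s + t - (n + m)\<bar>"
    by (rule infdist_Ints_le) (use n m in simp)
  then show ?thesis using n m by linarith
qed

lemma infdist_Ints_eq_0_iff:
  fixes t :: real
  shows "infdist t \<int> = 0 \<longleftrightarrow> t \<in> \<int>"
proof
  assume "infdist t \<int> = 0"
  moreover obtain n where "n \<in> \<int>" "infdist t \<int> = \<bar>t - n\<bar>"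
    by (rule infdist_Ints_attained)
  ultimately show "t \<in> \<int>" by simp
qed simp

lemma infdist_Ints_cong:
  fixes s t :: real
  assumes "s - t \<in> \<int>"
  shows "infdist s \<int> = infdist t \<int>"
proof -
  have "infdist (s - t) \<int> = 0" "infdist (t - s) \<int> = 0"
    using assms infdist_Ints_minus[of "s - t"] by (simp_all add: infdist_Ints_eq_0_iff)
  then show ?thesis
    using infdist_Ints_triangle[of "s - t" t] infdist_Ints_triangle[of "t - s" s] by simp
qed

instantiation circle :: metric_space
begin

lift_definition dist_circle :: "circle \<Rightarrow> circle \<Rightarrow> real"
  is "\<lambda>x y. infdist (x - y) \<int>"
proof -
  fix a b c d :: real
  assume "a - b \<in> \<int>" "c - d \<in> \<int>"
  then have "(a - b) - (c - d) \<in> \<int>" by (rule Ints_diff)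
  then show "infdist (a - c) \<int> = infdist (b - d) \<int>"
    by (intro infdist_Ints_cong) (simp add: algebra_simps)
qed

definition uniformity_circle :: "(circle \<times> circle) filter" where
  "uniformity_circle = (INF e\<in>{0<..}. principal {(x, y). dist x y < e})"

definition open_circle :: "circle set \<Rightarrow> bool" where
  "open_circle U = (\<forall>x\<in>U. eventually (\<lambda>(x', y). x' = x \<longrightarrow> y \<in> U) uniformity)"

instance
proof
  show "dist x y = 0 \<longleftrightarrow> x = y" for x y :: circle
    by transfer (rule infdist_Ints_eq_0_iff)
  show "dist x y \<le> dist x z + dist y z" for x y z :: circle
  proof transfer
    fix x y z :: real
    show "infdist (x - y) \<int> \<le> infdist (x - z) \<int> + infdist (y - z) \<int>"
      using infdist_Ints_triangle[of "x - z" "z - y"] infdist_Ints_minus[of "y - z"] by simp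
  qed
qed (simp_all add: uniformity_circle_def open_circle_def)

end

definition doubling :: "circle \<Rightarrow> circle" where
  "doubling x = x + x"


section \<open>\<open>C\<^sup>k\<^sup>+\<^sup>\<alpha>\<close> perturbations of the doubling map\<close>

text \<open>
  A function \<open>g\<close> on the circle is differentiated as the 1-periodic function
  \<open>\<lambda>t. g (to_circle t)\<close> on the line.  For 1-periodic functions the suprema below, over
  the line, are the same as over the circle: two distinct points of the circle have
  representatives whose distance on the line is their distance on the circle.
  The suprema are extended reals, so that the norm is infinite when one of them is.
\<close>

definition sup_norm :: "(real \<Rightarrow> real) \<Rightarrow> ereal" where
  "sup_norm h = (SUP t. ereal \<bar>h t\<bar>)"

definition hoelder_seminorm :: "real \<Rightarrow> (real \<Rightarrow> real) \<Rightarrow> ereal" where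
  "hoelder_seminorm \<alpha> h =
     (SUP (s, t)\<in>{(s, t). s \<noteq> t}. ereal (\<bar>h s - h t\<bar> / \<bar>s - t\<bar> powr \<alpha>))"

definition circle_deriv :: "nat \<Rightarrow> (circle \<Rightarrow> real) \<Rightarrow> real \<Rightarrow> real" where
  "circle_deriv j g = (deriv ^^ j) (\<lambda>t. g (to_circle t))"

definition C_norm :: "nat \<Rightarrow> real \<Rightarrow> (circle \<Rightarrow> real) \<Rightarrow> ereal" where
  "C_norm k \<alpha> g =
     (\<Sum>j\<le>k. sup_norm (circle_deriv j g)) + hoelder_seminorm \<alpha> (circle_deriv k g)"

definition C_class :: "nat \<Rightarrow> real \<Rightarrow> (circle \<Rightarrow> real) \<Rightarrow> bool" where
  "C_class k \<alpha> g \<longleftrightarrow>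
     (\<forall>j<k. \<forall>t. circle_deriv j g differentiable at t) \<and>
     continuous_on UNIV (circle_deriv k g) \<and> C_norm k \<alpha> g < \<infinity>"

text \<open>
  \<open>f - doubling\<close> takes values in the circle.  Its norm is that of a real-valued lift \<open>g\<close>:
  if \<open>f\<close> is uniformly close to \<open>doubling\<close>, there is exactly one small continuous lift.
\<close>

definition doubling_perturbation :: "nat \<Rightarrow> real \<Rightarrow> real \<Rightarrow> (circle \<Rightarrow> circle) \<Rightarrow> bool" where
  "doubling_perturbation k \<alpha> \<delta> f \<longleftrightarrow>
     (\<exists>g. (\<forall>x. to_circle (g x) = f x - doubling x) \<and>
          C_class k \<alpha> g \<and> C_norm k \<alpha> g < ereal \<delta>)"


section \<open>Hoelder conjugacies and their lifts\<close>

definition hoelder_map :: "(circle \<Rightarrow> circle) \<Rightarrow> bool" where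
  "hoelder_map \<phi> \<longleftrightarrow>
     (\<exists>\<beta> K. 0 < \<beta> \<and> \<beta> \<le> 1 \<and> (\<forall>x y. dist (\<phi> x) (\<phi> y) \<le> K * dist x y powr \<beta>))"

definition hoelder_conjugacy :: "(circle \<Rightarrow> circle) \<Rightarrow> (circle \<Rightarrow> circle) \<Rightarrow> (circle \<Rightarrow> circle) \<Rightarrow> bool"
where
  "hoelder_conjugacy f\<^sub>0 f \<psi> \<longleftrightarrow>
     (\<exists>\<phi>. homeomorphism UNIV UNIV \<psi> \<phi> \<and> hoelder_map \<psi> \<and> hoelder_map \<phi>) \<and>
     \<psi> \<circ> f\<^sub>0 = f \<circ> \<psi>"

definition is_lift :: "(circle \<Rightarrow> circle) \<Rightarrow> (real \<Rightarrow> real) \<Rightarrow> bool" where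
  "is_lift \<psi> \<Psi> \<longleftrightarrow>
     continuous_on {0..1} \<Psi> \<and> (\<forall>t\<in>{0..1}. to_circle (\<Psi> t) = \<psi> (to_circle t))"

end

(*
Lift f to F x = 2 x + G x.  The conjugacy lifts to Psi = lim F^-n (2^n s), and every other conjugacy
is obtained from it by orientation and integer translation, so the Fourier integral is that of the
measure mu = Psi_* Leb, which is invariant under the inverse branches with equal weights.

If the derivatives of log (F^-n)' at points differing by integers have the same limit, then F is
smoothly conjugate to the doubling map, Psi is C^2, and integration by parts gives decay 1/|xi|.
Otherwise these derivatives are uniformly separated, and the transfer operator twisted by
((F^-n)')^(it) contracts in L^2(mu), uniformly in large |t|: the energy lost in one step is the
variance of the summands over the inverse branches, and on intervals of length about 1/|t| two
summands whose relative phase moves cannot stay equal.  Local Lipschitz constants of the iterates are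
controlled in L^2(mu) along with the iterates; mu is doubling in the coordinate s, where it is
Lebesgue measure.

Hence at each point the values log (F^-n)' over the 2^n branches have bounded density down to
exponentially small scales.  Writing mu as an average over the branches and linearizing them at small
scale turns mu^(xi) into an average of Fourier transforms of pieces of mu at the frequencies
xi (F^-n)'; by large deviations these have comparable size, and by bounded density the average is
controlled by a mean square of the transforms over an interval of frequencies, which is small
because Psi^-1 is Hoelder.
*)
theory Submission
  imports Defs
begin

text \<open>Three numerical gaps carry the estimates. Inverse branches contract by factors between
  10/21 and 5/9. Since 2 * (5/9)^2 = 50/81 < 1, the squared Lipschitz errors of the twisted iterates
  beat the factor \<open>2^k\<close> that is lost because each branch is known to be out of phase
  with only one of its \<open>2^k\<close> partners; so the contraction can be run with one fixed
  large \<open>k\<close>. Since (5/9)^2 < 10/21, there is a depth \<open>m\<close> at which the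
  quadratic error of linearizing a branch on a piece of depth \<open>m\<close> is already negligible
  while the piece is still long enough to oscillate. Finally 1/4 <= 10/21 and (5/9)^2 <= 1/2 give
  the Hoelder exponent 1/2 for the conjugacy and for its inverse.

  Energy is measured in mean square and not pointwise because at a single point all branches may be
  in phase; only two suitably spaced points together are known to lose energy. The pointwise bound
  that the density estimate needs is recovered afterwards by averaging over further
  branches.\<close>

section \<open>Lifts of expanding circle maps\<close>

text \<open>The bounds hold when \<open>F1\<close> is within 1/10 of 2, with slack in the lower one.
  They make \<open>Finv\<close> contract by factors between 10/21 and 5/9. \<open>F_near\<close>
  gives surjectivity and controls the first step of the approximation of the conjugacy.\<close>

locale doubling_lift =
  fixes F F1 :: "real \<Rightarrow> real"
  assumes F_deriv: "(F has_real_derivative F1 x) (at x)"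
    and F1_lower: "9/5 \<le> F1 x"
    and F1_upper: "F1 x \<le> 21/10"
    and F_add_1: "F (x + 1) = F x + 2"
    and F_near: "\<bar>F x - 2 * x\<bar> \<le> 1"
begin

lemma F_cont: "continuous_on A F"
  using F_deriv by (meson DERIV_continuous continuous_at_imp_continuous_on)

lemma F_incr:
  assumes "x \<le> y"
  shows "9/5 * (y - x) \<le> F y - F x" "F y - F x \<le> 21/10 * (y - x)"
proof -
  have "9/5 * (y - x) \<le> F y - F x \<and> F y - F x \<le> 21/10 * (y - x)"
  proof (cases "x = y")
    case False
    then have "x < y" using assms by simp
    from MVT2[OF this F_deriv] obtain z where "F y - F x = (y - x) * F1 z"
      by blast
    moreover have "(y - x) * (9/5) \<le> (y - x) * F1 z" "(y - x) * F1 z \<le> (y - x) * (21/10)"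
      using assms F1_lower F1_upper by (intro mult_left_mono; simp)+
    ultimately show ?thesis by (simp add: mult.commute)
  qed simp
  then show "9/5 * (y - x) \<le> F y - F x" "F y - F x \<le> 21/10 * (y - x)" by auto
qed

lemma F_strict_mono: "x < y \<Longrightarrow> F x < F y"
  using F_incr(1)[of x y] by simp

lemma F_bij: "bij F"
proof (rule bijI)
  show "inj F"
    by (rule linorder_injI) (use F_strict_mono in force)
  show "surj F"
    unfolding surj_def
  proof
    fix y
    have "F ((y - 1) / 2) \<le> y" "y \<le> F ((y + 1) / 2)"
      using F_near[of "(y - 1)/2"] F_near[of "(y + 1)/2"] by (simp_all add: abs_le_iff diff_divide_distrib add_divide_distrib)
    then have "\<exists>x. (y - 1) / 2 \<le> x \<and> x \<le> (y + 1) / 2 \<and> F x = y"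
      by (intro IVT' F_cont) auto
    then show "\<exists>x. y = F x" by auto
  qed
qed

definition Finv :: "real \<Rightarrow> real" where "Finv = inv F"

lemma F_Finv [simp]: "F (Finv x) = x"
  unfolding Finv_def using F_bij by (simp add: bij_is_surj surj_f_inv_f)

lemma Finv_F [simp]: "Finv (F x) = x"
  unfolding Finv_def using F_bij by (simp add: bij_is_inj)

lemma Finv_mono: "x \<le> y \<Longrightarrow> Finv x \<le> Finv y"
  using F_strict_mono[of "Finv y" "Finv x"] by force

lemma Finv_incr:
  assumes "x \<le> y"
  shows "10/21 * (y - x) \<le> Finv y - Finv x" "Finv y - Finv x \<le> 5/9 * (y - x)"
  using F_incr[OF Finv_mono[OF assms]] by auto

lemma Finv_dist: "\<bar>Finv y - Finv x\<bar> \<le> 5/9 * \<bar>y - x\<bar>"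
  using Finv_incr[of x y] Finv_incr[of y x] by (cases "x \<le> y") auto

lemma Finv_cont: "isCont Finv x"
proof -
  from Finv_dist have "(5/9)-lipschitz_on UNIV Finv"
    by (intro lipschitz_onI) (auto simp: dist_real_def)
  then show ?thesis
    using lipschitz_on_continuous_on continuous_on_eq_continuous_at by blast
qed

lemma F1_pos: "F1 x > 0"
  using F1_lower[of x] by simp

lemma Finv_deriv: "(Finv has_real_derivative inverse (F1 (Finv x))) (at x)"
proof (rule DERIV_inverse_function[where f = F and a = "x - 1" and b = "x + 1"])
  show "(F has_real_derivative F1 (Finv x)) (at (Finv x))" by (rule F_deriv)
  show "F1 (Finv x) \<noteq> 0" using F1_pos[of "Finv x"] by simp
  show "isCont Finv x" by (rule Finv_cont)
qed auto

lemma F_add_nat: "F (x + real n) = F x + 2 * real n"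
proof (induction n)
  case (Suc n)
  have "F (x + real (Suc n)) = F ((x + real n) + 1)" by (simp add: algebra_simps)
  then show ?case using Suc F_add_1 by simp
qed simp

lemma F_add_int: "F (x + of_int z) = F x + 2 * of_int z"
proof (cases "z \<ge> 0")
  case True
  then show ?thesis using F_add_nat[of x "nat z"] by simp
next
  case False
  then show ?thesis using F_add_nat[of "x + of_int z" "nat (- z)"] by simp
qed

lemma Finv_add_int: "Finv (x + 2 * of_int z) = Finv x + of_int z"
  by (metis F_Finv F_add_int Finv_F)

text \<open>
  The inverse branches of the \<open>n\<close>-th iterate of the circle map are \<open>\<lambda>x. br n (x + j)\<close> with
  \<open>0 \<le> j < 2^n\<close>.
\<close>

definition br :: "nat \<Rightarrow> real \<Rightarrow> real" where "br n = Finv ^^ n"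

lemma br_0 [simp]: "br 0 x = x"
  by (simp add: br_def)

lemma br_Suc: "br (Suc n) x = Finv (br n x)"
  by (simp add: br_def)

lemma br_add: "br (m + n) x = br m (br n x)"
  by (simp add: br_def funpow_add)

lemma br_incr:
  assumes "x \<le> y"
  shows "br n x \<le> br n y" "(10/21)^n * (y - x) \<le> br n y - br n x"
    "br n y - br n x \<le> (5/9)^n * (y - x)"
proof -
  have "br n x \<le> br n y \<and> (10/21)^n * (y - x) \<le> br n y - br n x
     \<and> br n y - br n x \<le> (5/9)^n * (y - x)"
  proof (induction n)
    case (Suc n)
    then show ?case
      using Finv_incr[of "br n x" "br n y"] Finv_mono[of "br n x" "br n y"] by (simp add: br_Suc)
  qed (use assms in simp)
  then show "br n x \<le> br n y" "(10/21)^n * (y - x) \<le> br n y - br n x"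
    "br n y - br n x \<le> (5/9)^n * (y - x)" by auto
qed

lemma br_dist:
  shows "(10/21)^n * \<bar>y - x\<bar> \<le> \<bar>br n y - br n x\<bar>" "\<bar>br n y - br n x\<bar> \<le> (5/9)^n * \<bar>y - x\<bar>"
  using br_incr[of x y n] br_incr[of y x n] by (cases "x \<le> y"; simp)+

lemma br_dist_le: "\<bar>br n y - br n x\<bar> \<le> \<bar>y - x\<bar>"
proof -
  have "(5/9::real)^n * \<bar>y - x\<bar> \<le> 1 * \<bar>y - x\<bar>"
    by (intro mult_right_mono power_le_one) auto
  then show ?thesis using br_dist(2)[of n y x] by simp
qed

lemma br_add_int: "br n (x + 2^n * of_int z) = br n x + of_int z"
proof (induction n arbitrary: z)
  case (Suc n)
  have "br (Suc n) (x + 2 ^ Suc n * of_int z) = Finv (br n (x + 2^n * of_int (2 * z)))"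
    by (simp add: br_Suc mult.assoc mult.left_commute)
  also have "\<dots> = br (Suc n) x + of_int z"
    unfolding Suc br_Suc using Finv_add_int[of "br n x" z] Suc[of "2 * z"] by simp
  finally show ?case .
qed simp

lemma br_cont: "continuous_on A (br n)"
proof -
  have "1-lipschitz_on A (br n)"
    by (intro lipschitz_onI) (use br_dist_le in \<open>auto simp: dist_real_def\<close>)
  then show ?thesis by (rule lipschitz_on_continuous_on)
qed

subsection \<open>The conjugacy\<close>

definition Psi :: "real \<Rightarrow> real" where "Psi s = lim (\<lambda>n. br n (2^n * s))"

abbreviation fourier :: "real \<Rightarrow> complex" where
  "fourier \<xi> \<equiv> integral {0..1} (\<lambda>s. cis (\<xi> * Psi s))"

lemma Finv_double: "\<bar>Finv (2 * y) - y\<bar> \<le> 1"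
  using Finv_dist[of "2 * y" "F y"] F_near[of y] unfolding Finv_F
  by (simp add: abs_minus_commute)

text \<open>Both terms are values of \<open>br n\<close>, at \<open>Finv (2 * y)\<close> and at
  \<open>y = 2^n * s\<close>, and \<open>F_near\<close> keeps these two arguments within distance
  1.\<close>

lemma br_step: "\<bar>br (Suc n) (2^Suc n * s) - br n (2^n * s)\<bar> \<le> (5/9)^n"
proof -
  let ?y = "2^n * s"
  have "br (Suc n) (2^Suc n * s) = br n (Finv (2 * ?y))"
    using br_add[of n 1 "2 * ?y"] br_Suc[of 0] by (simp add: mult.assoc)
  also have "\<bar>\<dots> - br n ?y\<bar> \<le> (5/9)^n * \<bar>Finv (2 * ?y) - ?y\<bar>"
    by (rule br_dist)
  also have "\<dots> \<le> (5/9)^n * 1"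
    by (intro mult_left_mono Finv_double) auto
  finally show ?thesis by simp
qed

lemma Psi_uniform: "uniform_limit UNIV (\<lambda>n s. br n (2^n * s)) Psi sequentially"
proof -
  have "uniform_limit UNIV (\<lambda>n s. \<Sum>k<n. br (Suc k) (2^Suc k * s) - br k (2^k * s))
      (\<lambda>s. suminf (\<lambda>k. br (Suc k) (2^Suc k * s) - br k (2^k * s))) sequentially"
    by (rule Weierstrass_m_test[where M = "\<lambda>n. (5/9)^n"])
      (use br_step in \<open>auto intro: summable_geometric\<close>)
  then have *: "uniform_limit UNIV (\<lambda>n s. br n (2^n * s) - s)
      (\<lambda>s. suminf (\<lambda>k. br (Suc k) (2^Suc k * s) - br k (2^k * s))) sequentially" (is "uniform_limit _ _ ?g _")
    by (subst (asm) sum_lessThan_telescope) simp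
  have "uniform_limit UNIV (\<lambda>n s. (br n (2^n * s) - s) + s) (\<lambda>s. ?g s + s) sequentially"
    by (intro uniform_limit_add * uniform_limit_const)
  then have **: "uniform_limit UNIV (\<lambda>n s. br n (2^n * s)) (\<lambda>s. ?g s + s) sequentially"
    by simp
  have "Psi s = ?g s + s" for s
    unfolding Psi_def by (rule limI) (use tendsto_uniform_limitI[OF **] in simp)
  then show ?thesis using ** by presburger
qed

lemma Psi_lim: "(\<lambda>n. br n (2^n * s)) \<longlonglongrightarrow> Psi s"
  using tendsto_uniform_limitI[OF Psi_uniform] by simp

lemma Psi_cont: "continuous_on A Psi"
proof -
  have "continuous_on UNIV (\<lambda>s. br n (2^n * s))" for n
    by (intro continuous_on_compose2[OF br_cont[of UNIV n]] continuous_intros) auto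
  then have "continuous_on UNIV Psi"
    by (intro uniform_limit_theorem[OF _ Psi_uniform]) auto
  then show ?thesis using continuous_on_subset by blast
qed

lemma Psi_add_int: "Psi (s + of_int z) = Psi s + of_int z"
proof -
  have "(\<lambda>n. br n (2^n * (s + of_int z))) \<longlonglongrightarrow> Psi s + of_int z"
    using tendsto_add[OF Psi_lim[of s] tendsto_const[of "of_int z"]]
    by (simp add: br_add_int distrib_left)
  then show ?thesis using Psi_lim LIMSEQ_unique by blast
qed

lemma Psi_add_nat: "Psi (s + real n) = Psi s + real n"
  using Psi_add_int[of s "int n"] by simp

lemma Psi_add_1: "Psi (s + 1) = Psi s + 1"
  using Psi_add_int[of s 1] by simp

lemma F_Psi: "F (Psi s) = Psi (2 * s)"
proof -
  have "(\<lambda>n. F (br (Suc n) (2^Suc n * s))) \<longlonglongrightarrow> F (Psi s)"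
    using F_cont[of UNIV] LIMSEQ_Suc[OF Psi_lim[of s]]
    by (intro continuous_on_tendsto_compose[of UNIV F]) auto
  moreover have "F (br (Suc n) (2^Suc n * s)) = br n (2^n * (2 * s))" for n
    by (simp add: br_Suc ac_simps)
  ultimately show ?thesis
    using Psi_lim[of "2 * s"] LIMSEQ_unique by auto
qed

lemma br_Psi: "br n (Psi (2^n * s)) = Psi s"
proof (induction n)
  case (Suc n)
  have "br (Suc n) (Psi (2^Suc n * s)) = br n (Finv (Psi (2 * (2^n * s))))"
    using br_add[of n 1] br_Suc[of 0] by (simp add: mult.assoc)
  then show ?case using Suc by (simp flip: F_Psi)
qed simp

lemma br_Psi_add: "br n (Psi s + real j) = Psi ((s + real j) / 2^n)"
  using br_Psi[of n "(s + real j) / 2^n"] by (simp add: Psi_add_nat)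

lemma Psi_mono: "s \<le> t \<Longrightarrow> Psi s \<le> Psi t"
  by (rule LIMSEQ_le[OF Psi_lim Psi_lim]) (auto intro!: exI[of _ 0] br_incr(1))

text \<open>Since \<open>br n\<close> undoes \<open>n\<close> doublings, an increment of
  \<open>Psi\<close> is the increment over the \<open>2^n\<close>-fold dilated interval, contracted
  \<open>n\<close> times. This reduces small scales to unit scale.\<close>

lemma Psi_scaled:
  assumes "s \<le> t"
  shows "(10/21)^n * (Psi (2^n * t) - Psi (2^n * s)) \<le> Psi t - Psi s"
    "Psi t - Psi s \<le> (5/9)^n * (Psi (2^n * t) - Psi (2^n * s))"
  using br_incr(2,3)[of "Psi (2^n * s)" "Psi (2^n * t)" n] Psi_mono[of "2^n * s" "2^n * t"] assms
  by (auto simp: br_Psi)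

lemma dyadic_scale:
  fixes d :: real
  assumes "0 < d" "d \<le> 1"
  obtains n where "1 \<le> 2^n * d" "2^n * d \<le> 2"
proof -
  have "\<exists>n. 1 \<le> 2^n * d"
    using assms real_arch_pow[of 2 "1 / d"] by (auto simp: field_simps intro: less_imp_le)
  then obtain n where n: "1 \<le> 2^n * d" "\<And>k. k < n \<Longrightarrow> \<not> 1 \<le> 2^k * d"
    using exists_least_iff[of "\<lambda>n. 1 \<le> 2^n * d"] by blast
  have "2^n * d \<le> 2"
    using n(2)[of "n - 1"] assms by (cases n) auto
  then show ?thesis using n that by blast
qed

text \<open>Dilated to a length between 1 and 2, the interval has increment at least 1. Contracting
  back costs at most \<open>(10/21)^n\<close>, which is at least \<open>(1/4)^n\<close>, the square
  of \<open>1/2^n\<close>; hence the exponent 2.\<close>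

lemma Psi_lower:
  assumes "s \<le> t" "t \<le> s + 1"
  shows "(t - s)^2 / 4 \<le> Psi t - Psi s"
proof (cases "s = t")
  case False
  then obtain n where n: "1 \<le> 2^n * (t - s)" "2^n * (t - s) \<le> 2"
    using assms dyadic_scale[of "t - s"] by auto
  have "Psi (2^n * s) + 1 \<le> Psi (2^n * t)"
    using Psi_mono[of "2^n * s + 1" "2^n * t"] n Psi_add_1[of "2^n * s"] by (simp add: right_diff_distrib)
  then have "(10/21::real)^n * 1 \<le> (10/21)^n * (Psi (2^n * t) - Psi (2^n * s))"
    by (intro mult_left_mono) auto
  then have "(10/21)^n \<le> Psi t - Psi s"
    using Psi_scaled(1)[OF assms(1), of n] by linarith
  moreover have "((t - s) / 2)^2 \<le> (1/2^n)^2"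
    using n assms by (intro power_mono) (auto simp: field_simps)
  moreover have "(1/2^n)^2 = (1/4::real)^n"
    unfolding power2_eq_square power_one_over[symmetric] power_mult_distrib[symmetric] by simp
  moreover have "(1/4::real)^n \<le> (10/21)^n"
    by (intro power_mono) auto
  ultimately show ?thesis by (simp add: power_divide)
qed simp

text \<open>At dilated length at most 2 the increment is at most 2; contracting back gains
  \<open>(5/9)^n\<close>, whose square is at most \<open>(1/2)^n\<close>, hence at most the original
  length.\<close>

lemma Psi_upper:
  assumes "s \<le> t" "t \<le> s + 1"
  shows "Psi t - Psi s \<le> 2 * (t - s) powr (1/2)"
proof (cases "s = t")
  case False
  then obtain n where n: "1 \<le> 2^n * (t - s)" "2^n * (t - s) \<le> 2"
    using assms dyadic_scale[of "t - s"] by auto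
  have "Psi (2^n * t) \<le> Psi (2^n * s) + 2"
    using Psi_mono[of "2^n * t" "2^n * s + 2"] n Psi_add_int[of "2^n * s" 2] by (simp add: algebra_simps)
  then have "(5/9)^n * (Psi (2^n * t) - Psi (2^n * s)) \<le> (5/9::real)^n * 2"
    by (intro mult_left_mono) auto
  then have "Psi t - Psi s \<le> 2 * (5/9)^n"
    using Psi_scaled(2)[OF assms(1), of n] by linarith
  moreover have "(5/9)^n \<le> (t - s) powr (1/2)"
  proof -
    have "((5/9::real)^n)^2 = (25/81)^n"
      unfolding power2_eq_square power_mult_distrib[symmetric] by simp
    also have "\<dots> \<le> (1/2)^n"
      by (intro power_mono) auto
    also have "\<dots> \<le> t - s"
      using n(1) by (simp add: field_simps)
    finally have "(5/9::real)^n \<le> sqrt (t - s)"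
      by (rule real_le_rsqrt)
    then show ?thesis using assms by (simp add: powr_half_sqrt)
  qed
  ultimately show ?thesis by linarith
qed simp

lemma Psi_strict: "s < t \<Longrightarrow> Psi s < Psi t"
proof -
  assume st: "s < t"
  define m where "m = min t (s + 1)"
  have "0 < (m - s)^2 / 4" using st by (simp add: m_def)
  also have "\<dots> \<le> Psi m - Psi s"
    by (rule Psi_lower) (use st in \<open>auto simp: m_def\<close>)
  also have "\<dots> \<le> Psi t - Psi s"
    using Psi_mono[of m t] by (simp add: m_def)
  finally show ?thesis by simp
qed

lemma Psi_bij: "bij Psi"
proof (rule bijI)
  show "inj Psi" by (rule linorder_injI) (use Psi_strict in force)
  show "surj Psi"
    unfolding surj_def
  proof
    fix y
    define z where "z = \<lfloor>y - Psi 0\<rfloor>"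
    have "Psi (of_int z) \<le> y" "y \<le> Psi (of_int z + 1)"
      using Psi_add_int[of 0 z] Psi_add_1[of "of_int z"] of_int_floor_le[of "y - Psi 0"]
        real_of_int_floor_add_one_ge[of "y - Psi 0", folded z_def, simplified] unfolding z_def by simp_all linarith+
    then have "\<exists>x. of_int z \<le> x \<and> x \<le> of_int z + 1 \<and> Psi x = y"
      by (intro IVT' Psi_cont) auto
    then show "\<exists>x. y = Psi x" by auto
  qed
qed

end

subsection \<open>Distortion\<close>

locale doubling_lift_C2 = doubling_lift +
  fixes F2 :: "real \<Rightarrow> real"
  assumes F1_deriv: "(F1 has_real_derivative F2 x) (at x)"
    and F2_cont: "continuous_on UNIV F2"
    and F2_bound: "\<bar>F2 x\<bar> \<le> 1"
begin

lemma F1_add_int: "F1 (x + of_int z) = F1 x"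
proof (rule DERIV_unique)
  show "((\<lambda>x. F (x + of_int z)) has_real_derivative F1 (x + of_int z)) (at x)"
    using F_deriv[of "x + of_int z"] DERIV_shift by blast
  show "((\<lambda>x. F (x + of_int z)) has_real_derivative F1 x) (at x)"
    unfolding F_add_int by (auto intro!: derivative_eq_intros F_deriv)
qed

lemma F2_add_int: "F2 (x + of_int z) = F2 x"
proof (rule DERIV_unique)
  show "((\<lambda>x. F1 (x + of_int z)) has_real_derivative F2 (x + of_int z)) (at x)"
    using F1_deriv[of "x + of_int z"] DERIV_shift by blast
  show "((\<lambda>x. F1 (x + of_int z)) has_real_derivative F2 x) (at x)"
    unfolding F1_add_int by (rule F1_deriv)
qed

text \<open>\<open>sig\<close> is the logarithm of the derivative of \<open>Finv\<close>, and
  \<open>tau\<close> is the derivative of \<open>sig\<close>. Summed along a backward orbit they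
  yield \<open>S n\<close>, the logarithm of the derivative of \<open>br n\<close>, and its
  derivative \<open>H n\<close>.\<close>

definition sig :: "real \<Rightarrow> real" where "sig x = - ln (F1 (Finv x))"
definition tau :: "real \<Rightarrow> real" where "tau x = - F2 (Finv x) / (F1 (Finv x))\<^sup>2"
definition S :: "nat \<Rightarrow> real \<Rightarrow> real" where "S n x = (\<Sum>k<n. sig (br k x))"
definition H :: "nat \<Rightarrow> real \<Rightarrow> real" where "H n x = (\<Sum>k<n. tau (br k x) * exp (S k x))"

lemma S_0 [simp]: "S 0 x = 0" by (simp add: S_def)
lemma H_0 [simp]: "H 0 x = 0" by (simp add: H_def)
lemma S_Suc: "S (Suc n) x = S n x + sig (br n x)" by (simp add: S_def)
lemma H_Suc: "H (Suc n) x = H n x + tau (br n x) * exp (S n x)" by (simp add: H_def)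

lemma exp_sig: "exp (sig x) = inverse (F1 (Finv x))"
  using F1_pos by (simp add: sig_def exp_minus)

lemma sig_deriv: "(sig has_real_derivative tau x) (at x)"
proof -
  have "((\<lambda>x. F1 (Finv x)) has_real_derivative F2 (Finv x) * inverse (F1 (Finv x))) (at x)"
    by (rule DERIV_chain2[OF F1_deriv Finv_deriv])
  then have "((\<lambda>x. - ln (F1 (Finv x))) has_real_derivative tau x) (at x)"
    using F1_pos[of "Finv x"]
    by (auto intro!: derivative_eq_intros simp: tau_def power2_eq_square field_simps)
  then show ?thesis by (simp add: sig_def[abs_def])
qed

lemma br_deriv: "(br n has_real_derivative exp (S n x)) (at x)"
proof (induction n)
  case 0
  then show ?case by (simp add: br_def id_def)
next
  case (Suc n)
  have "((\<lambda>x. Finv (br n x)) has_real_derivative inverse (F1 (Finv (br n x))) * exp (S n x)) (at x)"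
    by (rule DERIV_chain2[OF Finv_deriv Suc])
  moreover have "br (Suc n) = (\<lambda>x. Finv (br n x))"
    by (rule ext) (rule br_Suc)
  ultimately show ?case by (simp add: S_Suc exp_add exp_sig mult.commute)
qed

lemma S_deriv: "(S n has_real_derivative H n x) (at x)"
proof -
  have "((\<lambda>x. sig (br k x)) has_real_derivative tau (br k x) * exp (S k x)) (at x)" for k
    by (rule DERIV_chain2[OF sig_deriv br_deriv])
  then have "((\<lambda>x. \<Sum>k<n. sig (br k x)) has_real_derivative (\<Sum>k<n. tau (br k x) * exp (S k x))) (at x)"
    by (intro DERIV_sum)
  then show ?thesis by (simp add: S_def[abs_def] H_def)
qed

lemma sig_bounds: "10/21 \<le> exp (sig x)" "exp (sig x) \<le> 5/9"
  using F1_lower[of "Finv x"] F1_upper[of "Finv x"] by (auto simp: exp_sig field_simps)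

lemma exp_S_bounds: "(10/21)^n \<le> exp (S n x)" "exp (S n x) \<le> (5/9)^n"
proof -
  have "(10/21)^n \<le> exp (S n x) \<and> exp (S n x) \<le> (5/9)^n"
  proof (induction n)
    case (Suc n)
    then show ?case
      unfolding S_Suc exp_add power_Suc2
      using sig_bounds[of "br n x"] by (intro conjI mult_mono) auto
  qed simp
  then show "(10/21)^n \<le> exp (S n x)" "exp (S n x) \<le> (5/9)^n" by auto
qed

lemma tau_bound: "\<bar>tau x\<bar> \<le> 4/9"
proof -
  have "(9/5)^2 \<le> (F1 (Finv x))\<^sup>2"
    using F1_lower[of "Finv x"] by (intro power_mono) auto
  then have "\<bar>F2 (Finv x)\<bar> \<le> 4/9 * (F1 (Finv x))\<^sup>2"
    using F2_bound[of "Finv x"] by (simp add: power2_eq_square)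
  then show ?thesis
    using F1_pos[of "Finv x"] by (simp add: tau_def abs_divide divide_le_eq)
qed

text \<open>The terms of \<open>H\<close> are at most \<open>4/9 * (5/9)^k\<close>, and 4/9 = 1 -
  5/9 makes their geometric sum take exactly this form. The bound 1 alone would not pass through the
  induction.\<close>

lemma H_bound_strong: "\<bar>H n x\<bar> \<le> 1 - (5/9)^n"
proof (induction n)
  case (Suc n)
  have "\<bar>tau (br n x) * exp (S n x)\<bar> \<le> 4/9 * (5/9)^n"
    unfolding abs_mult using tau_bound exp_S_bounds by (intro mult_mono) auto
  then show ?case using Suc unfolding H_Suc by simp
qed simp

lemma H_bound: "\<bar>H n x\<bar> \<le> 1"
  using H_bound_strong[of n x] zero_le_power[of "5/9::real" n] by linarith

lemma S_lipschitz: "\<bar>S n x - S n y\<bar> \<le> \<bar>x - y\<bar>"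
proof -
  have "norm (S n x - S n y) \<le> 1 * norm (x - y)"
    by (rule field_differentiable_bound[of UNIV]) (use S_deriv H_bound in auto)
  then show ?thesis by simp
qed

lemma br_mvt:
  assumes "x < y"
  obtains z where "x < z" "z < y" "br n y - br n x = (y - x) * exp (S n z)"
  using MVT2[OF assms br_deriv] by blast

lemma S_mvt2:
  assumes "x < y"
  obtains z where "x < z" "z < y"
    "(S n (y + a) - S n (y + b)) - (S n (x + a) - S n (x + b)) = (y - x) * (H n (z + a) - H n (z + b))"
proof -
  have "((\<lambda>x. S n (x + a) - S n (x + b)) has_real_derivative H n (x + a) - H n (x + b)) (at x)" for x
    by (intro DERIV_diff) (use S_deriv DERIV_shift in blast)+
  from MVT2[OF assms this] that show ?thesis by blast
qed

text \<open>The Lipschitz bound on \<open>S n\<close> is uniform in \<open>n\<close>, so the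
  second-order error is relative to the derivative \<open>exp (S n x)\<close>, however small that
  is. The factor 2 comes from |exp u - 1| <= 2 |u| for |u| <= 1.\<close>

lemma br_linear:
  assumes "\<bar>d\<bar> \<le> 1"
  shows "\<bar>br n (x + d) - br n x - exp (S n x) * d\<bar> \<le> 2 * exp (S n x) * d\<^sup>2"
proof -
  have "\<exists>z. \<bar>z - x\<bar> \<le> \<bar>d\<bar> \<and> br n (x + d) - br n x = d * exp (S n z)"
  proof (cases d "0::real" rule: linorder_cases)
    case less
    from br_mvt[of "x + d" x n] less obtain z where
      "x + d < z" "z < x" "br n x - br n (x + d) = (x - (x + d)) * exp (S n z)" by auto
    then show ?thesis using less by (intro exI[of _ z]) auto
  next
    case greater
    from br_mvt[of x "x + d" n] greater obtain z where
      "x < z" "z < x + d" "br n (x + d) - br n x = (x + d - x) * exp (S n z)" by auto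
    then show ?thesis using greater by (intro exI[of _ z]) auto
  qed auto
  then obtain z where z: "\<bar>z - x\<bar> \<le> \<bar>d\<bar>" "br n (x + d) - br n x = d * exp (S n z)" by blast
  define u where "u = S n z - S n x"
  have u: "\<bar>u\<bar> \<le> \<bar>d\<bar>" using S_lipschitz[of n z x] z by (simp add: u_def)
  have "\<bar>exp u - 1\<bar> \<le> 2 * \<bar>u\<bar>"
  proof (cases "u \<ge> 0")
    case True
    then have "exp u \<le> 1 + u + u\<^sup>2"
      using u assms by (intro exp_bound) auto
    moreover have "u * u \<le> u * 1"
      using True u assms by (intro mult_left_mono) auto
    ultimately show ?thesis using True by (simp add: power2_eq_square)
  next
    case False
    then have "exp u \<le> 1" by simp
    with exp_ge_add_one_self[of u] show ?thesis using False by linarith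
  qed
  then have e: "\<bar>exp u - 1\<bar> \<le> 2 * \<bar>d\<bar>" using u by simp
  have "br n (x + d) - br n x - exp (S n x) * d = exp (S n x) * (d * (exp u - 1))"
    using z(2) by (simp add: u_def exp_diff right_diff_distrib)
  then have "\<bar>br n (x + d) - br n x - exp (S n x) * d\<bar> = exp (S n x) * (\<bar>d\<bar> * \<bar>exp u - 1\<bar>)"
    by (simp add: abs_mult)
  also have "\<dots> \<le> exp (S n x) * (\<bar>d\<bar> * (2 * \<bar>d\<bar>))"
    using e by (intro mult_left_mono) auto
  also have "\<dots> = 2 * exp (S n x) * d\<^sup>2"
    by (simp add: power2_eq_square)
  finally show ?thesis .
qed

lemma sig_add_int: "sig (x + 2 * of_int z) = sig x"
  by (simp add: sig_def Finv_add_int F1_add_int)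

lemma tau_add_int: "tau (x + 2 * of_int z) = tau x"
  by (simp add: tau_def Finv_add_int F1_add_int F2_add_int)

lemma br_add_int_le:
  assumes "k \<le> n"
  shows "br k (x + 2^n * of_int z) = br k x + 2^(n - k) * of_int z"
proof -
  have "(2::real)^n = 2^k * 2^(n - k)"
    using assms by (simp flip: power_add)
  then show ?thesis using br_add_int[of k x "2^(n - k) * z"] by (simp add: mult.assoc)
qed

text \<open>One factor 2 is kept apart because \<open>Finv\<close> turns translation by 2 into
  translation by 1, so that \<open>sig\<close> and \<open>tau\<close> have period 2. Consequently
  \<open>S n\<close> and \<open>H n\<close> have period \<open>2^n\<close>, and only their sums over
  all branches have period 1.\<close>

lemma br_add_int_less:
  assumes "k < n"
  shows "br k (x + 2^n * of_int z) = br k x + 2 * of_int (2^(n - Suc k) * z)"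
  using br_add_int_le[of k n x z] assms
  by (simp add: Suc_diff_Suc flip: power_Suc)

lemma S_add_int: "m \<le> n \<Longrightarrow> S m (x + 2^n * of_int z) = S m x"
  unfolding S_def by (intro sum.cong refl) (simp only: lessThan_iff br_add_int_less sig_add_int)

lemma H_add_int: "m \<le> n \<Longrightarrow> H m (x + 2^n * of_int z) = H m x"
  unfolding H_def
  by (intro sum.cong refl) (simp only: lessThan_iff br_add_int_less tau_add_int S_add_int order.strict_trans1 less_imp_le)

lemma S_add: "S (m + n) x = S m (br n x) + S n x"
  by (induction m) (simp_all add: S_Suc br_add)

lemma H_add: "H (m + n) x = H n x + H m (br n x) * exp (S n x)"
  by (induction m) (simp_all add: H_Suc br_add S_add exp_add algebra_simps)

lemma H_tail: "\<bar>H (m + n) x - H n x\<bar> \<le> (5/9)^n"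
proof -
  have "\<bar>H m (br n x) * exp (S n x)\<bar> \<le> 1 * (5/9)^n"
    unfolding abs_mult using H_bound exp_S_bounds(2) by (intro mult_mono) auto
  then show ?thesis by (simp add: H_add)
qed

definition Hlim :: "real \<Rightarrow> real" where "Hlim x = lim (\<lambda>n. H n x)"

lemma Hlim: "(\<lambda>n. H n x) \<longlonglongrightarrow> Hlim x"
proof -
  have "summable (\<lambda>k. tau (br k x) * exp (S k x))"
  proof (rule summable_comparison_test')
    show "summable (\<lambda>k. (5/9::real)^k)" by (rule summable_geometric) simp
    show "norm (tau (br k x) * exp (S k x)) \<le> (5/9)^k" if "k \<ge> 0" for k
    proof -
      have "\<bar>tau (br k x)\<bar> * exp (S k x) \<le> 1 * (5/9)^k"
        using tau_bound[of "br k x"] exp_S_bounds by (intro mult_mono) auto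
      then show ?thesis by (simp add: abs_mult)
    qed
  qed
  then have "convergent (\<lambda>n. H n x)"
    unfolding H_def summable_iff_convergent .
  then show ?thesis unfolding Hlim_def convergent_LIMSEQ_iff .
qed

lemma Hlim_dist: "\<bar>Hlim x - H n x\<bar> \<le> (5/9)^n"
proof (rule LIMSEQ_le_const2)
  show "(\<lambda>m. \<bar>H (m + n) x - H n x\<bar>) \<longlonglongrightarrow> \<bar>Hlim x - H n x\<bar>"
    using LIMSEQ_ignore_initial_segment[OF Hlim[of x], of n] by (intro tendsto_intros)
qed (use H_tail in blast)

text \<open>This is \<open>H_add\<close> with the number of outer steps sent to infinity. For
  \<open>n = 1\<close> it is the differentiated cohomological equation that is integrated in the
  periodic case.\<close>

lemma Hlim_add: "Hlim x = H n x + Hlim (br n x) * exp (S n x)"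
proof (rule LIMSEQ_unique)
  show "(\<lambda>m. H (m + n) x) \<longlonglongrightarrow> Hlim x"
    using LIMSEQ_ignore_initial_segment[OF Hlim[of x], of n] .
  show "(\<lambda>m. H (m + n) x) \<longlonglongrightarrow> H n x + Hlim (br n x) * exp (S n x)"
    unfolding H_add by (intro tendsto_intros Hlim)
qed

lemma tau_cont: "continuous_on A tau"
proof -
  have F: "continuous_on A Finv"
    using Finv_cont continuous_at_imp_continuous_on by blast
  have "continuous_on UNIV F1"
    by (rule DERIV_continuous_on) (rule F1_deriv)
  then show ?thesis
    unfolding tau_def using F1_pos F F2_cont
    by (intro continuous_intros continuous_on_compose2[OF _ F, of UNIV]) (auto simp: less_imp_neq[symmetric])
qed

lemma S_cont: "continuous_on A (S n)"
  by (rule DERIV_continuous_on) (rule has_field_derivative_at_within[OF S_deriv])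

lemma H_cont: "continuous_on A (H n)"
  unfolding H_def
  by (intro continuous_intros S_cont continuous_on_compose2[OF tau_cont[of UNIV] br_cont]) auto

lemma Hlim_cont: "continuous_on A Hlim"
proof -
  have "uniform_limit UNIV H Hlim sequentially"
  proof (rule uniform_limitI)
    fix e :: real assume "e > 0"
    then obtain N where N: "(5/9)^N < e"
      using real_arch_pow_inv[of e "5/9"] by auto
    show "\<forall>\<^sub>F n in sequentially. \<forall>x\<in>UNIV. dist (H n x) (Hlim x) < e"
    proof (intro eventually_sequentiallyI[of N] ballI)
      fix n x assume "N \<le> n"
      then have "(5/9::real)^n \<le> (5/9)^N" by (intro power_decreasing) auto
      then show "dist (H n x) (Hlim x) < e"
        using N Hlim_dist[of x n] unfolding dist_real_def by linarith
    qed
  qed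
  then have "continuous_on UNIV Hlim"
    by (rule uniform_limit_theorem[rotated]) (auto intro: H_cont always_eventually)
  then show ?thesis using continuous_on_subset by blast
qed

lemma H_mod: "H k (x + of_int z) = H k (x + real (nat (z mod 2^k)))"
proof -
  have "real_of_int z = of_int (z mod 2^k + 2^k * (z div 2^k))" by simp
  then have "x + of_int z = (x + real (nat (z mod 2^k))) + 2^k * of_int (z div 2^k)"
    unfolding of_int_add of_int_mult by simp
  then show ?thesis by (simp only: H_add_int[OF order_refl])
qed

subsection \<open>Uniform non-integrability\<close>

text \<open>The constant \<open>c\<close> must not depend on \<open>k\<close>, since the block
  length \<open>k\<close> is later chosen large in terms of \<open>c\<close>. The pair of branches,
  in contrast, may vary with the point.\<close>

definition UNI :: bool where
  "UNI \<longleftrightarrow> (\<exists>c>0. \<exists>k0. \<forall>k\<ge>k0. \<forall>x. \<exists>i<2^k. \<exists>i'<2^k.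
     c \<le> \<bar>H k (x + real i) - H k (x + real i')\<bar>)"

text \<open>A failure of periodicity at one point \<open>x0\<close> persists near \<open>x0\<close>
  by continuity. For a fixed \<open>m\<close>, every \<open>x\<close> has an integer translate that
  \<open>br m\<close> sends near \<open>x0\<close>, and \<open>Hlim_add\<close> carries the gap back
  to that translate with a factor at least \<open>(10/21)^m\<close>.\<close>

lemma UNI_or_periodic: "UNI \<or> (\<forall>x. Hlim (x + 1) = Hlim x)"
proof (rule disjCI)
  assume "\<not> (\<forall>x. Hlim (x + 1) = Hlim x)"
  then obtain x0 where x0: "Hlim (x0 + 1) \<noteq> Hlim x0" by blast
  define D where "D = (\<lambda>x. \<bar>Hlim (x + 1) - Hlim x\<bar>)"
  have "continuous_on UNIV D"
    unfolding D_def
    by (intro continuous_intros continuous_on_compose2[OF Hlim_cont[of UNIV]]) auto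
  then have "isCont D x0" by (simp add: continuous_on_eq_continuous_at)
  moreover have "D x0 > 0" using x0 by (simp add: D_def)
  ultimately obtain d where d: "d > 0" "\<And>y. dist y x0 < d \<Longrightarrow> dist (D y) (D x0) < D x0 / 2"
    unfolding continuous_at_eps_delta by (meson half_gt_zero)
  have D: "D x0 / 2 \<le> D y" if "\<bar>y - x0\<bar> < d" for y
    using d(2)[of y] that by (auto simp: dist_real_def abs_less_iff abs_if split: if_splits)
  obtain m where m: "(5/9)^m < d"
    using real_arch_pow_inv[of d "5/9"] d by auto
  \<comment> \<open>A third of the transported gap: replacing \<open>Hlim\<close> by
    \<open>H k\<close> at two points may cost \<open>c\<close> each, and \<open>c\<close> must
    remain.\<close>
  define c where "c = D x0 / 2 * (10/21)^m / 3"
  have "c > 0" using \<open>D x0 > 0\<close> by (simp add: c_def)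
  then obtain k0 where k0: "(5/9)^k0 < c"
    using real_arch_pow_inv[of c "5/9"] by auto
  obtain s where s: "x0 = Psi s" using Psi_bij bij_is_surj surjD by metis
  define X where "X = Psi (2^m * s)"
  have X: "br m X = x0" by (simp add: X_def br_Psi s)
  have "\<exists>i<2^k. \<exists>i'<2^k. c \<le> \<bar>H k (x + real i) - H k (x + real i')\<bar>" if "k \<ge> k0" for k x
  proof -
    define i where "i = \<lfloor>X - x\<rfloor>"
    define y where "y = br m (x + of_int i)"
    have "\<bar>y - x0\<bar> \<le> (5/9)^m * \<bar>x + of_int i - X\<bar>"
      using br_dist(2)[of m "x + of_int i" X] by (simp add: y_def X)
    also have "\<dots> \<le> (5/9)^m * 1"
      unfolding i_def by (intro mult_left_mono) (auto simp: abs_le_iff; linarith)+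
    finally have "D x0 / 2 \<le> D y" using D m by simp
    \<comment> \<open>Adding \<open>2^m\<close> leaves \<open>H m\<close> and \<open>S m\<close>
      unchanged and shifts \<open>br m\<close> by exactly 1, so the difference of
      \<open>Hlim\<close> reduces to the gap at \<open>y\<close>.\<close>
    have e: "x + of_int (i + 2^m) = (x + of_int i) + 2^m * of_int 1" by simp
    then have *: "Hlim (x + of_int (i + 2^m)) = H m (x + of_int i) + Hlim (y + 1) * exp (S m (x + of_int i))"
      using Hlim_add[of "x + of_int i + 2^m * of_int 1" m]
      unfolding H_add_int[OF order_refl] S_add_int[OF order_refl] br_add_int e y_def by simp
    have "\<bar>Hlim (x + of_int (i + 2^m)) - Hlim (x + of_int i)\<bar> = D y * exp (S m (x + of_int i))"
      unfolding * Hlim_add[of "x + of_int i" m]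
      by (simp add: D_def y_def abs_mult flip: left_diff_distrib)
    also have "\<dots> \<ge> D x0 / 2 * (10/21)^m"
      using \<open>D x0 / 2 \<le> D y\<close> \<open>D x0 > 0\<close> exp_S_bounds(1) by (intro mult_mono) auto
    finally have "3 * c \<le> \<bar>Hlim (x + of_int (i + 2^m)) - Hlim (x + of_int i)\<bar>"
      by (simp add: c_def)
    moreover have "(5/9::real)^k \<le> (5/9)^k0" using that by (intro power_decreasing) auto
    then have "\<bar>Hlim z - H k z\<bar> \<le> c" for z using Hlim_dist[of z k] k0 by linarith
    note this[of "x + of_int (i + 2^m)"] this[of "x + of_int i"]
    ultimately have "c \<le> \<bar>H k (x + of_int (i + 2^m)) - H k (x + of_int i)\<bar>"
      by linarith
    then have "c \<le> \<bar>H k (x + real (nat ((i + 2^m) mod 2^k))) - H k (x + real (nat (i mod 2^k)))\<bar>"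
      by (simp only: H_mod)
    moreover have "nat (j mod 2^k) < 2^k" for j :: int
      by (simp add: nat_less_iff)
    ultimately show ?thesis by blast
  qed
  then show UNI unfolding UNI_def using \<open>c > 0\<close> by blast
qed

subsection \<open>Doubling property of the conjugacy\<close>

definition c1 :: real where "c1 = 10/21 * exp (- 3)"

lemma c1_pos: "c1 > 0" by (simp add: c1_def)

lemma c1_le_1: "c1 \<le> 1"
  using exp_le_one_iff[of "-3::real"] unfolding c1_def by linarith

text \<open>Dilation by \<open>2^N\<close> makes the two intervals of length 1/2 and 1, with
  \<open>Psi\<close>-increments at least 10/21 and exactly 1. By the mean value theorem
  \<open>br N\<close> scales each increment by its derivative at some point; the two points are at
  most 3 apart, so the derivatives differ by a factor at most exp 3. These are the two factors of
  \<open>c1\<close>.\<close>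

lemma Psi_doubling:
  assumes "\<bar>s - s'\<bar> \<le> 1 / 2^N"
  shows "c1 * (Psi (s' + 1 / 2^N) - Psi s') \<le> Psi (s + 1 / 2^N / 2) - Psi s"
proof -
  define a a' where "a = 2^N * s" and "a' = 2^N * s'"
  have "a - a' = 2^N * (s - s')"
    by (simp add: a_def a'_def right_diff_distrib)
  then have "\<bar>a - a'\<bar> = 2^N * \<bar>s - s'\<bar>"
    by (simp add: abs_mult)
  also have "\<dots> \<le> 2^N * (1 / 2^N)"
    using assms by (intro mult_left_mono) auto
  finally have a: "\<bar>a - a'\<bar> \<le> 1" by simp
  have e: "2^N * (s + 1 / 2^N / 2) = a + 1/2" "2^N * (s' + 1/2^N) = a' + 1"
    by (simp_all add: a_def a'_def distrib_left)
  have "10/21 * (Psi (2 * (a + 1/2)) - Psi (2 * a)) \<le> Psi (a + 1/2) - Psi a"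
    using Psi_scaled(1)[of a "a + 1/2" 1] unfolding power_one_right by simp
  then have half: "10/21 \<le> Psi (a + 1/2) - Psi a"
    using Psi_add_1[of "2 * a"] unfolding distrib_left by simp
  obtain z1 where z1: "Psi a < z1" "z1 < Psi (a + 1/2)"
    "br N (Psi (a + 1/2)) - br N (Psi a) = (Psi (a + 1/2) - Psi a) * exp (S N z1)"
    using br_mvt[of "Psi a" "Psi (a + 1/2)" N] Psi_strict by auto
  obtain z2 where z2: "Psi a' < z2" "z2 < Psi (a' + 1)"
    "br N (Psi (a' + 1)) - br N (Psi a') = (Psi (a' + 1) - Psi a') * exp (S N z2)"
    using br_mvt[of "Psi a'" "Psi (a' + 1)" N] Psi_strict by auto
  have "Psi a \<le> Psi a' + 1" "Psi a' \<le> Psi a + 1" "Psi (a + 1/2) \<le> Psi a + 1"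
    using Psi_mono[of a "a' + 1"] Psi_mono[of a' "a + 1"] Psi_mono[of "a + 1/2" "a + 1"] a
    unfolding Psi_add_1 abs_le_iff by linarith+
  then have "\<bar>z2 - z1\<bar> \<le> 3" using z1 z2 Psi_add_1[of a'] by linarith
  then have "exp (S N z2) * exp (- 3) \<le> exp (S N z1)"
    using S_lipschitz[of N z2 z1] by (simp flip: exp_add)
  then have "c1 * exp (S N z2) \<le> 10/21 * exp (S N z1)"
    by (simp add: c1_def mult.commute)
  also have "\<dots> \<le> (Psi (a + 1/2) - Psi a) * exp (S N z1)"
    using half by (intro mult_right_mono) auto
  finally show ?thesis
    using z1(3) z2(3) Psi_add_1[of a'] br_Psi[of N s] br_Psi[of N s'] br_Psi[of N "s + 1 / 2^N / 2"]
      br_Psi[of N "s' + 1 / 2^N"] unfolding e a_def[symmetric] a'_def[symmetric] by simp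
qed

end

section \<open>The smoothly linearizable case\<close>

lemma cis_has_vector_derivative:
  assumes "(\<theta> has_real_derivative d) (at s within A)"
  shows "((\<lambda>s. cis (\<theta> s)) has_vector_derivative (\<i> * of_real d * cis (\<theta> s))) (at s within A)"
proof -
  have "((\<lambda>s. \<i> * of_real (\<theta> s)) has_vector_derivative (\<i> * of_real d)) (at s within A)"
    using assms by (auto intro!: derivative_eq_intros simp: has_real_derivative_iff_has_vector_derivative)
  from field_vector_diff_chain_within[OF this, of exp "exp (\<i> * of_real (\<theta> s))"]
  have "((exp \<circ> (\<lambda>s. \<i> * of_real (\<theta> s))) has_vector_derivative
      (\<i> * of_real d * exp (\<i> * of_real (\<theta> s)))) (at s within A)"
    by (auto intro: DERIV_subset[OF DERIV_exp])
  then show ?thesis by (simp add: cis_conv_exp comp_def)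
qed

text \<open>Integration by parts with \<open>w\<close> the reciprocal of the phase derivative:
  \<open>w * cis \<theta>\<close> has derivative \<open>(w' + \<i>) * cis \<theta>\<close>, so the
  integral is a boundary term minus a term with amplitude \<open>w'\<close>. Only \<open>w\<close>
  has to be differentiated.\<close>

lemma oscillatory_bound:
  fixes \<theta> \<theta>' w w' :: "real \<Rightarrow> real"
  assumes "a \<le> b"
    and \<theta>: "\<And>x. x \<in> {a..b} \<Longrightarrow> (\<theta> has_real_derivative \<theta>' x) (at x)"
    and w: "\<And>x. x \<in> {a..b} \<Longrightarrow> (w has_real_derivative w' x) (at x)"
    and w\<theta>: "\<And>x. x \<in> {a..b} \<Longrightarrow> w x * \<theta>' x = 1"
    and M: "\<And>x. x \<in> {a..b} \<Longrightarrow> \<bar>w' x\<bar> \<le> M"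
  shows "cmod (integral {a..b} (\<lambda>x. cis (\<theta> x))) \<le> \<bar>w a\<bar> + \<bar>w b\<bar> + M * (b - a)"
proof -
  let ?G = "\<lambda>x. of_real (w x) * cis (\<theta> x)"
  let ?I = "integral {a..b} (\<lambda>x. cis (\<theta> x))"
  have "(?G has_vector_derivative (of_real (w' x) + \<i>) * cis (\<theta> x)) (at x within {a..b})"
    if "x \<in> {a..b}" for x
  proof -
    have "((\<lambda>x. complex_of_real (w x)) has_vector_derivative of_real (w' x)) (at x within {a..b})"
      using w[OF that] by (auto intro!: derivative_eq_intros
          simp: has_real_derivative_iff_has_vector_derivative has_vector_derivative_at_within)
    from has_vector_derivative_mult[OF this cis_has_vector_derivative[OF has_field_derivative_at_within[OF \<theta>[OF that]]]]
    have "(?G has_vector_derivative of_real (w x) * (\<i> * of_real (\<theta>' x) * cis (\<theta> x)) + of_real (w' x) * cis (\<theta> x))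
        (at x within {a..b})" .
    moreover have "of_real (w x) * (\<i> * of_real (\<theta>' x) * cis (\<theta> x)) = of_real (w x * \<theta>' x) * (\<i> * cis (\<theta> x))"
      by simp
    ultimately show ?thesis
      unfolding w\<theta>[OF that] by (simp add: algebra_simps)
  qed
  then have G: "((\<lambda>x. (of_real (w' x) + \<i>) * cis (\<theta> x)) has_integral (?G b - ?G a)) {a..b}"
    by (intro fundamental_theorem_of_calculus assms) auto
  have "continuous_on {a..b} \<theta>"
    by (rule DERIV_continuous_on) (use \<theta> has_field_derivative_at_within in blast)
  then have "((\<lambda>x. cis (\<theta> x)) has_integral ?I) {a..b}"
    by (intro integrable_integral integrable_continuous_real continuous_intros)
  from has_integral_diff[OF G has_integral_mult_right[OF this, of \<i>]]
  have W: "((\<lambda>x. of_real (w' x) * cis (\<theta> x)) has_integral (?G b - ?G a - \<i> * ?I)) {a..b}"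
    by (simp add: algebra_simps)
  have "0 \<le> M" using M[of a] \<open>a \<le> b\<close> by auto
  from has_integral_bound_real[OF this finite.emptyI W]
  have "cmod (?G b - ?G a - \<i> * ?I) \<le> M * (b - a)"
    using M \<open>a \<le> b\<close> by (simp add: norm_mult)
  moreover have "cmod ?I = cmod ((?G b - ?G a) - (?G b - ?G a - \<i> * ?I))"
    by (simp add: norm_mult)
  moreover have "\<dots> \<le> cmod (?G b - ?G a) + cmod (?G b - ?G a - \<i> * ?I)"
    by (rule norm_triangle_ineq4)
  moreover have "cmod (?G b - ?G a) \<le> cmod (?G b) + cmod (?G a)"
    by (rule norm_triangle_ineq4)
  ultimately have "cmod ?I \<le> (cmod (?G b) + cmod (?G a)) + M * (b - a)"
    by linarith
  then show ?thesis by (simp add: norm_mult)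
qed

lemma antiderivative_real:
  fixes f :: "real \<Rightarrow> real"
  assumes "continuous_on UNIV f"
  obtains g where "\<And>x. (g has_real_derivative f x) (at x)"
proof -
  have "\<exists>g. \<forall>x::real. -\<infinity> < ereal x \<longrightarrow> ereal x < \<infinity> \<longrightarrow> (g has_vector_derivative f x) (at x)"
    by (rule einterval_antiderivative) (use assms in \<open>auto simp: continuous_on_eq_continuous_at\<close>)
  then show ?thesis
    using that by (auto simp: has_real_derivative_iff_has_vector_derivative)
qed

text \<open>\<open>e + c\<close> is bounded and doubles along the doubling map, so it vanishes.\<close>

lemma bounded_doubling_const:
  fixes e :: "real \<Rightarrow> real"
  assumes per: "\<And>s. e (s + 1) = e s" and dbl: "\<And>s. e (2 * s) = 2 * e s + c"
    and cont: "continuous_on {0..1} e"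
  shows "e s = - c"
proof -
  have "e (s + real n) = e s" for s n
  proof (induction n)
    case (Suc n)
    then show ?case using per[of "s + real n"] by (simp add: algebra_simps)
  qed simp
  then have per': "e (s + of_int z) = e s" for s z
    by (cases z rule: int_cases2) (simp, metis diff_add_cancel of_int_minus of_int_of_nat_eq uminus_add_conv_diff add.commute)
  have "bounded (e ` {0..1})"
    by (intro compact_imp_bounded compact_continuous_image cont compact_Icc)
  then obtain B where "\<forall>x\<in>e ` {0..1}. norm x \<le> B"
    unfolding bounded_iff by blast
  then have B: "\<And>s. s \<in> {0..1} \<Longrightarrow> \<bar>e s\<bar> \<le> B" by simp
  have bd: "\<bar>e s + c\<bar> \<le> B + \<bar>c\<bar>" for s
  proof -
    have "e s = e (frac s)" using per'[of "frac s" "\<lfloor>s\<rfloor>"] by (simp add: frac_def)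
    moreover have "frac s \<in> {0..1}" using frac_lt_1[of s] by (simp add: less_imp_le)
    ultimately show ?thesis using B[of "frac s"] by linarith
  qed
  have pow: "e (2^n * s) + c = 2^n * (e s + c)" for n
  proof (induction n)
    case (Suc n)
    then show ?case using dbl[of "2^n * s"] by (simp add: mult.assoc algebra_simps)
  qed simp
  have "\<bar>e s + c\<bar> \<le> 0"
  proof (rule ccontr)
    assume "\<not> \<bar>e s + c\<bar> \<le> 0"
    then obtain n where "(B + \<bar>c\<bar>) / \<bar>e s + c\<bar> < 2^n"
      using real_arch_pow[of 2] by auto
    then have "B + \<bar>c\<bar> < 2^n * \<bar>e s + c\<bar>"
      using \<open>\<not> \<bar>e s + c\<bar> \<le> 0\<close> by (simp add: pos_divide_less_eq)
    also have "\<dots> = \<bar>e (2^n * s) + c\<bar>"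
      by (simp add: pow abs_mult)
    finally have "B + \<bar>c\<bar> < \<bar>e (2^n * s) + c\<bar>" .
    then show False using bd[of "2^n * s"] by simp
  qed
  then show ?thesis by simp
qed

context doubling_lift_C2
begin

text \<open>
  When \<open>Hlim\<close> is 1-periodic, \<open>exp P\<close> with \<open>P' = Hlim\<close> is the derivative of a smooth
  conjugacy of \<open>F\<close> to the doubling map.
\<close>

lemma periodic_decay:
  assumes per: "\<And>x. Hlim (x + 1) = Hlim x"
  obtains C where "\<And>\<xi>::real. \<xi> \<noteq> 0 \<Longrightarrow> cmod (fourier \<xi>) \<le> C / \<bar>\<xi>\<bar>"
proof -
  obtain P where P: "\<And>x. (P has_real_derivative Hlim x) (at x)"
    using antiderivative_real[OF Hlim_cont[of UNIV]] by blast
  have const: "g x = g y" if "\<And>x. (g has_real_derivative 0) (at x)" for g :: "real \<Rightarrow> real" and x y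
    using DERIV_isconst_all that by blast
  have br1: "br 1 x = Finv x" "S 1 x = sig x" "H 1 x = tau x" for x
    using br_Suc[of 0] S_Suc[of 0] H_Suc[of 0] by simp_all
  \<comment> \<open>Integrated cohomological equation: up to a constant, \<open>sig\<close> is the
    coboundary of \<open>P\<close>.\<close>
  have "((\<lambda>x. P x - P (Finv x) - sig x) has_real_derivative 0) (at x)" for x
  proof -
    have "((\<lambda>x. P x - P (Finv x) - sig x) has_real_derivative
        Hlim x - Hlim (Finv x) * exp (sig x) - tau x) (at x)"
      unfolding exp_sig
      by (intro DERIV_diff P sig_deriv DERIV_chain2[OF P Finv_deriv])
    moreover have "Hlim x - Hlim (Finv x) * exp (sig x) - tau x = 0"
      using Hlim_add[of x 1] unfolding br1 by linarith
    ultimately show ?thesis by simp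
  qed
  from const[OF this] obtain k where "\<And>x. P x - P (Finv x) - sig x = k" by blast
  from this[of "F _"] have "P (F x) - P x + ln (F1 x) = k" for x
    by (simp add: sig_def)
  then have lnF1: "ln (F1 x) = P x - P (F x) + k" for x
    by (simp add: algebra_simps)
  have "((\<lambda>x. P (x + 1) - P x) has_real_derivative 0) (at x)" for x
  proof -
    have "((\<lambda>x. P (x + 1) - P x) has_real_derivative Hlim (x + 1) - Hlim x) (at x)"
      by (intro DERIV_diff P) (use P DERIV_shift in blast)
    then show ?thesis using per by simp
  qed
  from const[OF this] obtain c where c: "\<And>x. P (x + 1) - P x = c" by blast
  \<comment> \<open>Over one period \<open>P\<close> gains \<open>c\<close> while \<open>P\<close>
    composed with \<open>F\<close> gains \<open>2 * c\<close>; as \<open>ln F1\<close> gains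
    nothing, \<open>c = 0\<close>.\<close>
  have "F1 1 = F1 0" using F1_add_int[of 0 1] by simp
  moreover have "P (F 1) = P (F 0) + 2 * c"
    using F_add_1[of 0] c[of "F 0"] c[of "F 0 + 1"] by (simp add: algebra_simps)
  ultimately have "c = 0" using lnF1[of 1] lnF1[of 0] c[of 0] by simp
  then have Pper: "P (x + 1) = P x" for x using c[of x] by simp
  have Pcont: "continuous_on A P" for A
    by (rule DERIV_continuous_on) (rule has_field_derivative_at_within[OF P])
  obtain h where h: "\<And>x. (h has_real_derivative exp (P x)) (at x)"
    using antiderivative_real[of "\<lambda>x. exp (P x)"] Pcont by (metis continuous_on_exp)
  have "((\<lambda>x. h (F x) - exp k * h x) has_real_derivative 0) (at x)" for x
  proof -
    have "((\<lambda>x. h (F x) - exp k * h x) has_real_derivative exp (P (F x)) * F1 x - exp k * exp (P x)) (at x)"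
      by (intro DERIV_diff DERIV_chain2[OF h F_deriv] DERIV_cmult h)
    moreover have "F1 x = exp (P x - P (F x) + k)"
      using lnF1[of x] F1_pos[of x] by (metis exp_ln)
    then have "exp (P (F x)) * F1 x = exp k * exp (P x)"
      by (simp flip: exp_add)
    ultimately show ?thesis by simp
  qed
  from const[OF this] obtain b where b: "\<And>x. h (F x) - exp k * h x = b" by blast
  have "((\<lambda>x. h (x + 1) - h x) has_real_derivative 0) (at x)" for x
  proof -
    have "((\<lambda>x. h (x + 1) - h x) has_real_derivative exp (P (x + 1)) - exp (P x)) (at x)"
      by (intro DERIV_diff h) (use h DERIV_shift in blast)
    then show ?thesis using Pper by simp
  qed
  from const[OF this] obtain Z where Z: "\<And>x. h (x + 1) - h x = Z" by blast
  have "Z > 0"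
    using MVT2[of 0 1 h "\<lambda>x. exp (P x)"] h Z[of 0] by auto
  \<comment> \<open>Comparing increments over one period identifies the multiplier: \<open>h\<close>
    composed with \<open>F\<close> gains twice the increment \<open>Z\<close> of \<open>h\<close>,
    so \<open>exp k = 2\<close>.\<close>
  have "h (F 1) = h (F 0) + 2 * Z"
    using F_add_1[of 0] Z[of "F 0"] Z[of "F 0 + 1"] by (simp add: algebra_simps)
  moreover have "h 1 = h 0 + Z" using Z[of 0] by simp
  ultimately have "exp k * Z = 2 * Z"
    using b[of 0] b[of 1] by (simp add: algebra_simps)
  then have k2: "exp k = 2" using \<open>Z > 0\<close> by simp
  \<comment> \<open>\<open>h\<close> conjugates \<open>F\<close> to an affine doubling, so
    \<open>e\<close> is periodic and doubles up to a constant. Its constancy makes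
    \<open>Psi\<close> the inverse of an affine image of \<open>h\<close>, whose derivative
    \<open>exp P\<close> is continuously differentiable.\<close>
  define e where "e = (\<lambda>s. h (Psi s) - Z * s)"
  have hcont: "continuous_on UNIV h"
    by (rule DERIV_continuous_on) (rule has_field_derivative_at_within[OF h])
  have "e s = - b" for s
  proof (rule bounded_doubling_const[of e b])
    show "e (s + 1) = e s" for s
      using Z[of "Psi s"] unfolding e_def Psi_add_1 distrib_left by simp
    show "e (2 * s) = 2 * e s + b" for s
      using b[of "Psi s"] by (simp add: e_def k2 F_Psi algebra_simps)
    show "continuous_on {0..1} e"
      unfolding e_def by (intro continuous_intros continuous_on_compose2[OF hcont Psi_cont]) auto
  qed
  then have hPsi: "(h (Psi s) + b) / Z = s" for s
    using \<open>Z > 0\<close> by (simp add: e_def field_simps)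
  \<comment> \<open>The reciprocal of the derivative of \<open>Psi\<close>. In its own derivative
    the exponential and \<open>Z\<close> cancel, leaving \<open>Hlim (Psi s)\<close>, which is
    bounded by 1.\<close>
  define w where "w = (\<lambda>s. exp (P (Psi s)) / Z)"
  have Psi_deriv: "(Psi has_real_derivative inverse (w s)) (at s)" for s
  proof (rule DERIV_inverse_function[where f = "\<lambda>x. (h x + b) / Z" and a = "s - 1" and b = "s + 1"])
    show "((\<lambda>x. (h x + b) / Z) has_real_derivative w s) (at (Psi s))"
      unfolding w_def using \<open>Z > 0\<close> by (auto intro!: derivative_eq_intros h)
    show "w s \<noteq> 0" using \<open>Z > 0\<close> by (simp add: w_def)
    show "isCont Psi s" using Psi_cont[of UNIV] by (simp add: continuous_on_eq_continuous_at)
  qed (use hPsi in auto)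
  have w_deriv: "(w has_real_derivative Hlim (Psi s)) (at s)" for s
  proof -
    have "((\<lambda>s. exp (P (Psi s)) / Z) has_real_derivative
        exp (P (Psi s)) * (Hlim (Psi s) * inverse (w s)) / Z) (at s)"
      by (intro DERIV_cdivide DERIV_fun_exp DERIV_chain2[OF P Psi_deriv])
    moreover have "exp (P (Psi s)) * (Hlim (Psi s) * inverse (w s)) / Z = Hlim (Psi s)"
      using \<open>Z > 0\<close> by (simp add: w_def field_simps)
    ultimately show ?thesis by (simp add: w_def)
  qed
  have Hb: "\<bar>Hlim x\<bar> \<le> 1" for x
    using Hlim_dist[of x 0] by simp
  show ?thesis
  proof (rule that[of "\<bar>w 0\<bar> + \<bar>w 1\<bar> + 1"])
    fix \<xi> :: real assume "\<xi> \<noteq> 0"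
    have "cmod (fourier \<xi>) \<le> \<bar>w 0 / \<xi>\<bar> + \<bar>w 1 / \<xi>\<bar> + 1 / \<bar>\<xi>\<bar> * (1 - 0)"
    proof (rule oscillatory_bound)
      show "((\<lambda>s. \<xi> * Psi s) has_real_derivative \<xi> * inverse (w s)) (at s)" for s
        by (intro DERIV_cmult Psi_deriv)
      show "((\<lambda>s. w s / \<xi>) has_real_derivative Hlim (Psi s) / \<xi>) (at s)" for s
        by (intro DERIV_cdivide w_deriv)
      show "w s / \<xi> * (\<xi> * inverse (w s)) = 1" for s
        using \<open>\<xi> \<noteq> 0\<close> \<open>Z > 0\<close> by (simp add: w_def)
      show "\<bar>Hlim (Psi s) / \<xi>\<bar> \<le> 1 / \<bar>\<xi>\<bar>" for s
        using Hb by (simp add: abs_divide divide_right_mono)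
    qed simp
    then show "cmod (fourier \<xi>) \<le> (\<bar>w 0\<bar> + \<bar>w 1\<bar> + 1) / \<bar>\<xi>\<bar>"
      by (simp add: abs_divide add_divide_distrib)
  qed
qed

end

section \<open>Contraction of the twisted transfer operator\<close>

lemma cmod_cis_diff: "cmod (cis a - cis b) = 2 * \<bar>sin ((a - b) / 2)\<bar>"
proof -
  have "cis a - cis b = cis b * (exp (\<i> * of_real (a - b)) - 1)"
    unfolding cis_conv_exp[symmetric] by (simp add: right_diff_distrib cis_mult)
  then have "cmod (cis a - cis b) = cmod (exp (\<i> * of_real (a - b)) - 1)"
    by (simp only: norm_mult norm_cis mult_1)
  then show ?thesis by (simp only: dist_exp_i_1)
qed

lemma cmod_cis_diff_le: "cmod (cis a - cis b) \<le> \<bar>a - b\<bar>"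
  using abs_sin_x_le_abs_x[of "(a - b) / 2"] by (simp add: cmod_cis_diff)

lemma cmod_cis_diff_ge:
  assumes "\<bar>a - b\<bar> \<le> 1"
  shows "\<bar>a - b\<bar> / 2 \<le> cmod (cis a - cis b)"
proof -
  define y where "y = (a - b) / 2"
  have y: "\<bar>y\<bar> \<le> 1" using assms by (simp add: y_def)
  have "\<bar>sin y - (\<Sum>m<3. sin_coeff m * y ^ m)\<bar> \<le> inverse (fact 3) * \<bar>y\<bar> ^ 3"
    by (rule Maclaurin_sin_bound)
  moreover have "(\<Sum>m<3. sin_coeff m * y ^ m) = y"
    by (simp add: eval_nat_numeral sin_coeff_def)
  moreover have "\<bar>y\<bar>^3 \<le> \<bar>y\<bar>"
    using power_decreasing[of 1 3 "\<bar>y\<bar>"] y by simp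
  ultimately have "\<bar>sin y - y\<bar> \<le> \<bar>y\<bar> / 6"
    by (simp add: fact_numeral)
  then have "\<bar>y\<bar> / 2 \<le> \<bar>sin y\<bar>" by linarith
  then show ?thesis by (simp add: cmod_cis_diff y_def)
qed

text \<open>The index is written as \<open>l = j + 2^k * i\<close>. Since \<open>br k\<close> turns
  the shift \<open>2^k * i\<close> into \<open>i\<close>, this splits a word of length
  \<open>n + k\<close> into \<open>j\<close>, used by \<open>br k\<close>, and \<open>i\<close>,
  used afterwards by \<open>br n\<close>.\<close>

lemma sum_split_blocks:
  fixes f :: "real \<Rightarrow> 'a::comm_monoid_add"
  shows "(\<Sum>l<2^(n + k). f (x + real l)) = (\<Sum>j<2^k. \<Sum>i<2^n. f (x + real j + 2^k * real i))"
proof -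
  have "(\<Sum>l<2^n * 2^k. f (x + real l)) = (\<Sum>i<2^n. \<Sum>l\<in>{i * 2^k..<i * 2^k + 2^k}. f (x + real l))"
    by (rule sum.nat_group[symmetric])
  also have "\<dots> = (\<Sum>i<2^n. \<Sum>j<2^k. f (x + real j + 2^k * real i))"
  proof (rule sum.cong[OF refl])
    fix i :: nat
    have "(\<Sum>l\<in>{i * 2^k..<i * 2^k + 2^k}. f (x + real l))
        = (\<Sum>l\<in>{0..<2^k}. f (x + real (l + i * 2^k)))"
      using sum.shift_bounds_nat_ivl[of "\<lambda>l. f (x + real l)" 0 "i * 2^k" "2^k"]
      by (simp add: add.commute)
    then show "(\<Sum>l\<in>{i * 2^k..<i * 2^k + 2^k}. f (x + real l))
        = (\<Sum>j<2^k. f (x + real j + 2^k * real i))"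
      by (simp add: atLeast0LessThan algebra_simps)
  qed
  also have "\<dots> = (\<Sum>j<2^k. \<Sum>i<2^n. f (x + real j + 2^k * real i))"
    by (rule sum.swap)
  finally show ?thesis by (simp add: power_add)
qed

text \<open>Invariance of Lebesgue measure under the equally weighted inverse branches of
  multiplication by \<open>N\<close>.\<close>

lemma integral_average:
  fixes q :: "real \<Rightarrow> 'a::euclidean_space"
  assumes "continuous_on UNIV q" "N > 0"
  shows "integral {0..1} (\<lambda>s. (\<Sum>j<N. q ((s + real j) / real N)) /\<^sub>R real N) = integral {0..1} q"
proof -
  have cont: "continuous_on A q" for A using assms(1) continuous_on_subset by blast
  have int: "q integrable_on {a..b}" for a b
    by (intro integrable_continuous_real cont)
  have piece: "((\<lambda>s. q ((s + real j) / real N)) has_integral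
      real N *\<^sub>R integral {real j / N..(real j + 1) / N} q) {0..1}" for j
  proof -
    have "(q has_integral integral {real j / N..(real j + 1) / N} q) (cbox (real j / N) ((real j + 1) / N))"
      using int by auto
    from has_integral_affinity[OF this, of "1 / real N" "real j / real N"]
    have "((\<lambda>s. q (1 / real N * s + real j / real N)) has_integral
       real N *\<^sub>R integral {real j / N..(real j + 1) / N} q) ((\<lambda>x. (1 / (1 / real N)) *\<^sub>R x + - (1 / (1 / real N)) *\<^sub>R (real j / real N)) ` cbox (real j / N) ((real j + 1) / N))"
      using \<open>N > 0\<close> by simp
    moreover have "(\<lambda>x. (1 / (1 / real N)) *\<^sub>R x + - (1 / (1 / real N)) *\<^sub>R (real j / real N)) ` cbox (real j / N) ((real j + 1) / N) = {0..1}"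
    proof -
      have "(\<lambda>x. real N * x + (- real j)) ` {real j / N..(real j + 1) / N} = {0..1}"
        using \<open>N > 0\<close> by (subst image_affinity_atLeastAtMost) (auto simp: field_simps)
      then show ?thesis using \<open>N > 0\<close> by simp
    qed
    ultimately show ?thesis by (simp add: add_divide_distrib)
  qed
  have "((\<lambda>s. (\<Sum>j<N. q ((s + real j) / real N)) /\<^sub>R real N) has_integral
     (\<Sum>j<N. real N *\<^sub>R integral {real j / N..(real j + 1) / N} q) /\<^sub>R real N) {0..1}"
    by (intro has_integral_cmul has_integral_sum piece) auto
  moreover have "(\<Sum>j<n. integral {real j / N..(real j + 1) / N} q) = integral {0..real n / N} q" for n
  proof (induction n)
    case (Suc n)
    have "integral {0..real n / N} q + integral {real n / N..(real n + 1) / N} q = integral {0..(real n + 1) / N} q"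
      by (intro Henstock_Kurzweil_Integration.integral_combine int) (auto simp: divide_right_mono)
    then show ?case using Suc by (simp add: add.commute)
  qed simp
  ultimately have "((\<lambda>s. (\<Sum>j<N. q ((s + real j) / real N)) /\<^sub>R real N) has_integral integral {0..1} q) {0..1}"
    using \<open>N > 0\<close> by (simp flip: scaleR_sum_right)
  then show ?thesis by (rule integral_unique)
qed

text \<open>The defect in the Cauchy-Schwarz inequality for the sum is the total of the pairwise
  squared differences; this turns phase mismatch into lost energy.\<close>

lemma sum_sum_cmod_diff:
  fixes z :: "nat \<Rightarrow> complex"
  shows "(\<Sum>j<N. \<Sum>i<N. (cmod (z j - z i))\<^sup>2) = 2 * real N * (\<Sum>j<N. (cmod (z j))\<^sup>2) - 2 * (cmod (\<Sum>j<N. z j))\<^sup>2"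
proof -
  have d: "(cmod (a - b))\<^sup>2 = (cmod a)\<^sup>2 + (cmod b)\<^sup>2 - 2 * Re (a * cnj b)" for a b :: complex
    unfolding cmod_power2 by (simp add: power2_eq_square algebra_simps)
  have "(\<Sum>j<N. \<Sum>i<N. Re (z j * cnj (z i))) = Re ((\<Sum>j<N. z j) * cnj (\<Sum>i<N. z i))"
    by (simp add: sum_product cnj_sum)
  also have "\<dots> = (cmod (\<Sum>j<N. z j))\<^sup>2"
    unfolding complex_norm_square[symmetric] Re_complex_of_real ..
  finally have r: "(\<Sum>j<N. \<Sum>i<N. Re (z j * cnj (z i))) = (cmod (\<Sum>j<N. z j))\<^sup>2" .
  show ?thesis
    unfolding d sum.distrib sum_subtractf sum_distrib_left[symmetric] r by (simp add: sum_distrib_left mult.assoc)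
qed

lemma sum4_square_le: "((a::real) + b + c + d)\<^sup>2 \<le> 4 * (a\<^sup>2 + b\<^sup>2 + c\<^sup>2 + d\<^sup>2)"
proof -
  have "4 * (a\<^sup>2 + b\<^sup>2 + c\<^sup>2 + d\<^sup>2) - (a + b + c + d)\<^sup>2
     = (a - b)\<^sup>2 + (a - c)\<^sup>2 + (a - d)\<^sup>2 + (b - c)\<^sup>2 + (b - d)\<^sup>2 + (c - d)\<^sup>2"
    by (simp add: power2_eq_square algebra_simps)
  then show ?thesis
    by (metis add_nonneg_nonneg diff_ge_0_iff_ge zero_le_power2)
qed

text \<open>
  The two exponentials cannot both compensate the difference of the phases, so that one of the
  two sums \<open>e\<close>, \<open>e'\<close> is not small.
\<close>

lemma pair_bound:
  fixes p p' q q' :: complex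
  assumes ph: "\<omega> \<le> \<bar>(a' - b') - (a - b)\<bar>" "\<bar>(a' - b') - (a - b)\<bar> \<le> 1" and "0 \<le> \<omega>"
    and e: "e = cmod (cis a * p - cis b * q)" and e': "e' = cmod (cis a' * p' - cis b' * q')"
    and P: "cmod (p - p') \<le> P" and Q: "cmod (q - q') \<le> Q"
  shows "\<omega>\<^sup>2 / 4 * ((cmod p)\<^sup>2 + (cmod p')\<^sup>2) \<le> 8 * (e\<^sup>2 + e'\<^sup>2 + P\<^sup>2 + Q\<^sup>2)"
proof -
  define A A' where "A = a - b" and "A' = a' - b'"
  define D where "D = cmod (cis A' - cis A)"
  have D: "\<omega> / 2 \<le> D"
    using cmod_cis_diff_ge[of A' A] ph by (simp add: A_def A'_def D_def)
  have rot: "cmod (cis a * p - cis b * q) = cmod (cis (a - b) * p - q)" for a b p q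
  proof -
    have "cis a * p - cis b * q = cis b * (cis (a - b) * p - q)"
      by (simp add: right_diff_distrib cis_mult flip: mult.assoc)
    then show ?thesis by (simp add: norm_mult)
  qed
  have e: "e = cmod (cis A * p - q)" and e': "e' = cmod (cis A' * p' - q')"
    using e e' rot by (simp_all add: A_def A'_def)
  have norm4: "cmod (x1 + x2 + x3 + x4) \<le> cmod x1 + cmod x2 + cmod x3 + cmod x4" for x1 x2 x3 x4
    by (intro norm_triangle_le add_mono order_refl)
  \<comment> \<open>Subtracting the two sums eliminates \<open>q\<close>, and what remains is the
    difference of the two relative phases applied to \<open>p\<close>, up to the variations
    \<open>P\<close> and \<open>Q\<close>.\<close>
  have "D * cmod p = cmod ((cis A' * p' - q') + (- (cis A * p - q)) + cis A' * (p - p') + (- (q - q')))"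
    by (simp add: D_def algebra_simps flip: norm_mult)
  also have "\<dots> \<le> e' + e + P + Q"
    using norm4[of "cis A' * p' - q'" "- (cis A * p - q)" "cis A' * (p - p')" "- (q - q')"] P Q
    unfolding norm_minus_cancel norm_mult norm_cis e e' by simp
  finally have 1: "D * cmod p \<le> e' + e + P + Q" .
  have "D * cmod p' = cmod ((cis A' * p' - q') + (- (cis A * p - q)) + cis A * (p - p') + (- (q - q')))"
    by (simp add: D_def algebra_simps flip: norm_mult)
  also have "\<dots> \<le> e' + e + P + Q"
    using norm4[of "cis A' * p' - q'" "- (cis A * p - q)" "cis A * (p - p')" "- (q - q')"] P Q
    unfolding norm_minus_cancel norm_mult norm_cis e e' by simp
  finally have 2: "D * cmod p' \<le> e' + e + P + Q" .
  have sq: "\<omega>\<^sup>2 / 4 * c\<^sup>2 \<le> 4 * (e'\<^sup>2 + e\<^sup>2 + P\<^sup>2 + Q\<^sup>2)" if c: "0 \<le> c" "D * c \<le> e' + e + P + Q" for c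
  proof -
    have "\<omega> / 2 * c \<le> e' + e + P + Q"
      using mult_right_mono[OF D c(1)] c(2) by linarith
    then have "(\<omega> / 2 * c)\<^sup>2 \<le> (e' + e + P + Q)\<^sup>2"
      using \<open>0 \<le> \<omega>\<close> c(1) by (intro power_mono) auto
    also have "\<dots> \<le> 4 * (e'\<^sup>2 + e\<^sup>2 + P\<^sup>2 + Q\<^sup>2)" by (rule sum4_square_le)
    finally show ?thesis by (simp add: power_mult_distrib power_divide)
  qed
  from sq[OF norm_ge_zero 1] sq[OF norm_ge_zero 2] show ?thesis
    by (simp add: distrib_left)
qed

section \<open>The twisted operator, its averages, and invariance of the measure\<close>

context doubling_lift_C2
begin

text \<open>
  \<open>W t n\<close> is the \<open>n\<close>-th iterate of the transfer operator twisted by the power \<open>\<i> t\<close> of the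
  derivatives of the inverse branches, applied to the constant 1.
\<close>

definition W :: "real \<Rightarrow> nat \<Rightarrow> real \<Rightarrow> complex" where
  "W t n x = (\<Sum>j<2^n. cis (t * S n (x + real j))) / 2^n"

definition avg :: "nat \<Rightarrow> (real \<Rightarrow> real) \<Rightarrow> real \<Rightarrow> real" where
  "avg k h x = (\<Sum>j<2^k. h (br k (x + real j))) / 2^k"

lemma br_add_nat: "br k (x + 2^k * real i) = br k x + real i"
  using br_add_int[of k x "int i"] by simp

lemma S_add_nat: "S k (x + 2^k * real i) = S k x"
  using S_add_int[of k k x "int i"] by simp

lemma W_add: "W t (n + k) x = (\<Sum>j<2^k. cis (t * S k (x + real j)) * W t n (br k (x + real j))) / 2^k"
proof -
  have "cis (t * S (n + k) (x + real j + 2^k * real i)) =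
     cis (t * S k (x + real j)) * cis (t * S n (br k (x + real j) + real i))" for i j
    unfolding cis_mult add.commute[of n k] by (simp add: S_add[of n k, unfolded add.commute[of n k]] br_add_nat S_add_nat distrib_left)
      (simp add: add.commute)
  then have "(\<Sum>l<2^(n + k). cis (t * S (n + k) (x + real l)))
      = (\<Sum>j<2^k. cis (t * S k (x + real j)) * (\<Sum>i<2^n. cis (t * S n (br k (x + real j) + real i))))"
    by (simp add: sum_split_blocks[where f = "\<lambda>x. cis (t * S (n + k) x)"] sum_distrib_left)
  also have "\<dots> = (\<Sum>j<2^k. cis (t * S k (x + real j)) * (W t n (br k (x + real j)) * 2^n))"
    by (simp add: W_def)
  also have "\<dots> = (\<Sum>j<2^k. cis (t * S k (x + real j)) * W t n (br k (x + real j))) * 2^n"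
    unfolding sum_distrib_right mult.assoc ..
  finally have "(\<Sum>l<2^(n + k). cis (t * S (n + k) (x + real l))) / 2^(n + k)
      = (\<Sum>j<2^k. cis (t * S k (x + real j)) * W t n (br k (x + real j))) * 2^n / (2^n * 2^k)"
    by (simp only: power_add)
  then show ?thesis
    unfolding W_def[of t "n + k"] by (simp only: mult_divide_mult_cancel_right mult.commute[of "2^n"] power_not_zero zero_neq_numeral[symmetric] not_False_eq_True)
qed

lemma W_0 [simp]: "W t 0 x = 1"
  by (simp add: W_def)

lemma W_cont: "continuous_on A (W t n)"
  unfolding W_def by (intro continuous_intros continuous_on_compose2[OF S_cont[of UNIV]]) auto

text \<open>Uniform in \<open>n\<close> by the distortion bound, but of size |t| even when
  \<open>W\<close> itself is small. It serves only for passing from mean square to pointwise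
  bounds.\<close>

lemma W_lipschitz: "cmod (W t n x - W t n y) \<le> \<bar>t\<bar> * \<bar>x - y\<bar>"
proof -
  have "cmod (cis (t * S n (x + real j)) - cis (t * S n (y + real j))) \<le> \<bar>t\<bar> * \<bar>x - y\<bar>" for j
  proof -
    have "cmod (cis (t * S n (x + real j)) - cis (t * S n (y + real j))) \<le> \<bar>t\<bar> * \<bar>S n (x + real j) - S n (y + real j)\<bar>"
      using cmod_cis_diff_le[of "t * S n (x + real j)" "t * S n (y + real j)"]
      by (simp add: abs_mult flip: right_diff_distrib)
    also have "\<dots> \<le> \<bar>t\<bar> * \<bar>x - y\<bar>"
      using S_lipschitz[of n "x + real j" "y + real j"] by (intro mult_left_mono) auto
    finally show ?thesis .
  qed
  then have "cmod (\<Sum>j<2^n. cis (t * S n (x + real j)) - cis (t * S n (y + real j)))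
      \<le> of_nat (card {..<2^n::nat}) * (\<bar>t\<bar> * \<bar>x - y\<bar>)"
    by (intro sum_norm_bound)
  then show ?thesis
    by (simp add: W_def norm_divide divide_le_eq mult.commute norm_power flip: diff_divide_distrib sum_subtractf)
qed

lemma comp_br_cont:
  assumes "continuous_on UNIV h"
  shows "continuous_on A (\<lambda>x. h (br k (x + c)))"
proof (rule continuous_on_compose2[OF assms])
  show "continuous_on A (\<lambda>x. br k (x + c))"
    by (rule continuous_on_compose2[OF br_cont[of UNIV]]) (auto intro: continuous_intros)
qed simp

lemma avg_cont: "continuous_on UNIV h \<Longrightarrow> continuous_on A (avg k h)"
  unfolding avg_def by (intro continuous_intros comp_br_cont) auto

lemma avg_nonneg: "(\<And>x. 0 \<le> h x) \<Longrightarrow> 0 \<le> avg k h x"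
  unfolding avg_def by (intro divide_nonneg_pos sum_nonneg) auto

lemma comp_Psi_cont: "continuous_on UNIV h \<Longrightarrow> continuous_on A (\<lambda>s. h (Psi s))"
  by (rule continuous_on_compose2[OF _ Psi_cont]) auto

lemma comp_Psi_integrable:
  fixes h :: "real \<Rightarrow> real"
  shows "continuous_on UNIV h \<Longrightarrow> (\<lambda>s. h (Psi s)) integrable_on {a..b}"
  by (intro integrable_continuous_real comp_Psi_cont)

lemma avg_integral:
  assumes "continuous_on UNIV h"
  shows "integral {0..1} (\<lambda>s. avg k h (Psi s)) = integral {0..1} (\<lambda>s. h (Psi s))"
  using integral_average[OF comp_Psi_cont[OF assms], of "2^k"]
  by (simp add: avg_def br_Psi_add divide_inverse mult.commute)

end

section \<open>Local Lipschitz bounds and the energy lost over one block\<close>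

context doubling_lift_C2
begin

text \<open>
  A bound \<open>v\<close> for the Lipschitz constant of \<open>u\<close> on balls of radius \<open>1 / (4 \<bar>t\<bar>)\<close>, relative
  to the natural scale \<open>\<bar>t\<bar>\<close>.
\<close>

definition local_lip :: "real \<Rightarrow> (real \<Rightarrow> complex) \<Rightarrow> (real \<Rightarrow> real) \<Rightarrow> bool" where
  "local_lip t u v \<longleftrightarrow> (\<forall>x y y'. \<bar>y - x\<bar> \<le> 1 / (4 * \<bar>t\<bar>) \<longrightarrow> \<bar>y' - x\<bar> \<le> 1 / (4 * \<bar>t\<bar>) \<longrightarrow>
     cmod (u y - u y') \<le> \<bar>t\<bar> * v x * \<bar>y - y'\<bar>)"

text \<open>The variation of the phase is multiplied by \<open>u\<close> on the ball, at most
  \<open>cmod (u X) + v X / 4\<close>; the variation of \<open>u\<close> itself gains the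
  contraction 1/4 and adds another \<open>v X / 4\<close>. Evaluating \<open>v\<close> at the centre
  of the ball lets the new bound be an average at a single point, so its mean square can be
  followed.\<close>

lemma local_lip_step:
  assumes lip: "local_lip t u v" and v: "\<And>x. 0 \<le> v x" and k: "(5/9)^k \<le> (1/4::real)" and t: "t \<noteq> 0"
  shows "local_lip t (\<lambda>x. (\<Sum>j<2^k. cis (t * S k (x + real j)) * u (br k (x + real j))) / 2^k)
    (avg k (\<lambda>x. cmod (u x) + v x / 2))"
  unfolding local_lip_def
proof (intro allI impI)
  fix x y y' assume y: "\<bar>y - x\<bar> \<le> 1 / (4 * \<bar>t\<bar>)" and y': "\<bar>y' - x\<bar> \<le> 1 / (4 * \<bar>t\<bar>)"
  have one: "cmod (cis (t * S k (y + real j)) * u (br k (y + real j)) - cis (t * S k (y' + real j)) * u (br k (y' + real j)))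
      \<le> \<bar>t\<bar> * \<bar>y - y'\<bar> * (cmod (u (br k (x + real j))) + v (br k (x + real j)) / 2)" for j
  proof -
    define Y Y' X where "Y = br k (y + real j)" and "Y' = br k (y' + real j)" and "X = br k (x + real j)"
    have d: "\<bar>br k (a + real j) - br k (b + real j)\<bar> \<le> \<bar>a - b\<bar> / 4" for a b
      using br_dist(2)[of k "a + real j" "b + real j"] mult_right_mono[OF k, of "\<bar>a - b\<bar>"] by simp
    have YX: "\<bar>Y - X\<bar> \<le> 1 / (4 * \<bar>t\<bar>)" "\<bar>Y' - X\<bar> \<le> 1 / (4 * \<bar>t\<bar>)"
      unfolding Y_def X_def Y'_def
      using order_trans[OF d[of y x]] order_trans[OF d[of y' x]] order_trans[OF _ y] order_trans[OF _ y']
      by simp_all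
    have tX: "\<bar>t\<bar> * \<bar>Y - X\<bar> \<le> 1/4"
      using YX(1) t by (simp add: field_simps)
    have XX: "\<bar>X - X\<bar> \<le> 1 / (4 * \<bar>t\<bar>)" by simp
    have "cmod (u Y - u X) \<le> \<bar>t\<bar> * v X * \<bar>Y - X\<bar>"
      using lip YX(1) XX unfolding local_lip_def by blast
    also have "\<dots> = (\<bar>t\<bar> * \<bar>Y - X\<bar>) * v X" by simp
    also have "\<dots> \<le> 1/4 * v X" using tX v by (intro mult_right_mono) auto
    finally have uY: "cmod (u Y) \<le> cmod (u X) + v X / 4"
      using norm_triangle_ineq2[of "u Y" "u X"] by simp
    have "cmod (u Y - u Y') \<le> \<bar>t\<bar> * v X * \<bar>Y - Y'\<bar>"
      using lip YX unfolding local_lip_def by blast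
    also have "\<dots> \<le> \<bar>t\<bar> * v X * (\<bar>y - y'\<bar> / 4)"
      using d[of y y'] v by (intro mult_left_mono) (auto simp: Y_def Y'_def)
    finally have uu: "cmod (u Y - u Y') \<le> \<bar>t\<bar> * \<bar>y - y'\<bar> * (v X / 4)" by (simp add: ac_simps)
    define \<alpha> \<alpha>' where "\<alpha> = t * S k (y + real j)" and "\<alpha>' = t * S k (y' + real j)"
    have "cmod (cis \<alpha> - cis \<alpha>') \<le> \<bar>t\<bar> * \<bar>S k (y + real j) - S k (y' + real j)\<bar>"
      using cmod_cis_diff_le[of \<alpha> \<alpha>'] by (simp add: \<alpha>_def \<alpha>'_def abs_mult flip: right_diff_distrib)
    also have "\<dots> \<le> \<bar>t\<bar> * \<bar>y - y'\<bar>"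
      using S_lipschitz[of k "y + real j" "y' + real j"] by (intro mult_left_mono) auto
    finally have cc: "cmod (cis \<alpha> - cis \<alpha>') \<le> \<bar>t\<bar> * \<bar>y - y'\<bar>" .
    have "cis \<alpha> * u Y - cis \<alpha>' * u Y' = (cis \<alpha> - cis \<alpha>') * u Y + cis \<alpha>' * (u Y - u Y')"
      by (simp add: algebra_simps)
    then have "cmod (cis \<alpha> * u Y - cis \<alpha>' * u Y') \<le> cmod (cis \<alpha> - cis \<alpha>') * cmod (u Y) + cmod (u Y - u Y')"
      by (metis norm_triangle_ineq norm_mult norm_cis mult_1)
    also have "\<dots> \<le> \<bar>t\<bar> * \<bar>y - y'\<bar> * (cmod (u X) + v X / 4) + \<bar>t\<bar> * \<bar>y - y'\<bar> * (v X / 4)"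
      using uY uu cc by (intro add_mono mult_mono) auto
    also have "\<dots> = \<bar>t\<bar> * \<bar>y - y'\<bar> * (cmod (u X) + v X / 2)"
      by (simp add: algebra_simps)
    finally show ?thesis by (simp add: \<alpha>_def \<alpha>'_def Y_def Y'_def X_def)
  qed
  have "cmod ((\<Sum>j<2^k. cis (t * S k (y + real j)) * u (br k (y + real j)))
      - (\<Sum>j<2^k. cis (t * S k (y' + real j)) * u (br k (y' + real j))))
     \<le> (\<Sum>j<2^k. \<bar>t\<bar> * \<bar>y - y'\<bar> * (cmod (u (br k (x + real j))) + v (br k (x + real j)) / 2))"
    unfolding sum_subtractf[symmetric] by (rule sum_norm_le) (rule one)
  then show "cmod ((\<Sum>j<2^k. cis (t * S k (y + real j)) * u (br k (y + real j))) / 2^k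
      - (\<Sum>j<2^k. cis (t * S k (y' + real j)) * u (br k (y' + real j))) / 2^k)
     \<le> \<bar>t\<bar> * avg k (\<lambda>x. cmod (u x) + v x / 2) x * \<bar>y - y'\<bar>"
    unfolding diff_divide_distrib[symmetric] norm_divide avg_def
    by (simp add: norm_power divide_right_mono mult.commute mult.left_commute flip: sum_distrib_left)
qed

text \<open>The bound of \<open>local_lip_step\<close> iterated from 0, as \<open>W t 0\<close> is
  constant.\<close>

primrec lip_bound :: "real \<Rightarrow> nat \<Rightarrow> nat \<Rightarrow> real \<Rightarrow> real" where
  "lip_bound t k 0 = (\<lambda>_. 0)"
| "lip_bound t k (Suc n) = avg k (\<lambda>x. cmod (W t (k * n) x) + lip_bound t k n x / 2)"

lemma lip_bound_cont: "continuous_on UNIV (lip_bound t k n)"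
  by (induction n) (auto intro!: continuous_intros avg_cont W_cont)

lemma lip_bound_nonneg: "0 \<le> lip_bound t k n x"
proof (induction n arbitrary: x)
  case (Suc n)
  then show ?case by (simp add: avg_nonneg)
qed simp

lemma W_local_lip:
  assumes "(5/9)^k \<le> (1/4::real)" "t \<noteq> 0"
  shows "local_lip t (W t (k * n)) (lip_bound t k n)"
proof (induction n)
  case 0
  then show ?case by (simp add: local_lip_def)
next
  case (Suc n)
  have "W t (k * Suc n) = (\<lambda>x. (\<Sum>j<2^k. cis (t * S k (x + real j)) * W t (k * n) (br k (x + real j))) / 2^k)"
    using W_add[of t "k * n" k] by (simp add: add.commute fun_eq_iff)
  then show ?case
    using local_lip_step[OF Suc lip_bound_nonneg assms] by simp
qed

definition twisted_term :: "real \<Rightarrow> nat \<Rightarrow> (real \<Rightarrow> complex) \<Rightarrow> nat \<Rightarrow> real \<Rightarrow> complex" where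
  "twisted_term t k u j x = cis (t * S k (x + real j)) * u (br k (x + real j))"

text \<open>
  Nonnegativity of the integral of \<open>Phi\<close> bounds the mean square of \<open>u\<close> by the variance over the
  inverse branches, which is the energy lost in one step, up to the error term \<open>v\<close>.
\<close>

definition Phi :: "real \<Rightarrow> nat \<Rightarrow> real \<Rightarrow> (real \<Rightarrow> complex) \<Rightarrow> (real \<Rightarrow> real) \<Rightarrow> real \<Rightarrow> real" where
  "Phi t k \<omega> u v x = 8 * (\<Sum>j<2^k. \<Sum>i<2^k. (cmod (twisted_term t k u j x - twisted_term t k u i x))\<^sup>2)
     + (25/81)^k * 2^k * (\<Sum>j<2^k. (v (br k (x + real j)))\<^sup>2)
     - \<omega>\<^sup>2 / 4 * (\<Sum>j<2^k. (cmod (u (br k (x + real j))))\<^sup>2)"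

lemma twisted_term_cont: "continuous_on UNIV u \<Longrightarrow> continuous_on A (twisted_term t k u j)"
  unfolding twisted_term_def
  by (intro continuous_intros comp_br_cont continuous_on_compose2[OF S_cont[of UNIV]]) auto

lemma Phi_cont:
  assumes "continuous_on UNIV u" "continuous_on UNIV v"
  shows "continuous_on A (Phi t k \<omega> u v)"
  unfolding Phi_def
  by (intro continuous_intros twisted_term_cont comp_br_cont assms)

abbreviation phase_gap :: "nat \<Rightarrow> nat \<Rightarrow> nat \<Rightarrow> real \<Rightarrow> real \<Rightarrow> real" where
  "phase_gap k j i x x' \<equiv>
     (S k (x' + real j) - S k (x' + real i)) - (S k (x + real j) - S k (x + real i))"

text \<open>\<open>Phi\<close> may be negative at a single point, where \<open>j\<close> and its
  partner \<open>i\<close> may be in phase; they cannot be in phase at both points, so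
  \<open>pair_bound\<close> applies. Its errors are (5/9)^k * v / 4, squared and summed over
  \<open>j\<close>. Bounding the partner's \<open>v\<close> by the sum over all branches produces
  the factor \<open>2^k\<close> in \<open>Phi\<close>.\<close>

lemma Phi_pair:
  assumes lip: "local_lip t u v" and t: "t \<noteq> 0" and v: "\<And>x. 0 \<le> v x" and "0 \<le> \<omega>"
    and x: "x \<le> x'" "x' - x \<le> 1 / (4 * \<bar>t\<bar>)"
    and partner: "\<And>j. j < 2^k \<Longrightarrow> \<exists>i<2^k.
      \<omega> \<le> \<bar>t * phase_gap k j i x x'\<bar> \<and>
      \<bar>t * phase_gap k j i x x'\<bar> \<le> 1"
  shows "0 \<le> Phi t k \<omega> u v x + Phi t k \<omega> u v x'"
proof -
  let ?N = "2^k :: nat"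
  let ?p = "\<lambda>x j. u (br k (x + real j))"
  let ?v = "\<lambda>j. v (br k (x + real j))"
  let ?D = "\<lambda>x j i. (cmod (twisted_term t k u j x - twisted_term t k u i x))\<^sup>2"
  have pp: "cmod (?p x j - ?p x' j) \<le> (5/9)^k * ?v j / 4" for j
  proof -
    have d: "\<bar>br k (x' + real j) - br k (x + real j)\<bar> \<le> (5/9)^k * (x' - x)"
      using br_dist(2)[of k "x' + real j" "x + real j"] x by simp
    have "\<bar>br k (x' + real j) - br k (x + real j)\<bar> \<le> x' - x"
      using br_dist_le[of k "x' + real j" "x + real j"] x by simp
    then have "\<bar>br k (x' + real j) - br k (x + real j)\<bar> \<le> 1 / (4 * \<bar>t\<bar>)"
      using x by linarith
    then have "cmod (?p x j - ?p x' j) \<le> \<bar>t\<bar> * ?v j * \<bar>br k (x + real j) - br k (x' + real j)\<bar>"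
      using lip unfolding local_lip_def by simp
    also have "\<dots> \<le> \<bar>t\<bar> * ?v j * ((5/9)^k * (x' - x))"
      using d v by (intro mult_left_mono) (auto simp: abs_minus_commute)
    also have "\<dots> = (5/9)^k * ?v j * (\<bar>t\<bar> * (x' - x))" by simp
    also have "\<dots> \<le> (5/9)^k * ?v j * (1/4)"
      using x t v by (intro mult_left_mono) (auto simp: field_simps)
    finally show ?thesis by simp
  qed
  have q: "((5/9)^k * a / 4)\<^sup>2 = (25/81)^k * a\<^sup>2 / 16" for a :: real
  proof -
    have "((5/9::real)^k)\<^sup>2 = (25/81)^k"
      unfolding power2_eq_square power_mult_distrib[symmetric] by simp
    moreover have "((5/9)^k * a / 4)\<^sup>2 = ((5/9::real)^k)\<^sup>2 * a\<^sup>2 / 4\<^sup>2"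
      by (simp only: power_mult_distrib power_divide)
    ultimately show ?thesis by simp
  qed
  have one: "\<omega>\<^sup>2 / 4 * ((cmod (?p x j))\<^sup>2 + (cmod (?p x' j))\<^sup>2)
     \<le> 8 * ((\<Sum>i<?N. ?D x j i) + (\<Sum>i<?N. ?D x' j i)) + (25/81)^k / 2 * ((?v j)\<^sup>2 + (\<Sum>i<?N. (?v i)\<^sup>2))"
    if j: "j < ?N" for j
  proof -
    from partner[OF j] obtain i where i: "i < ?N"
      "\<omega> \<le> \<bar>(t * S k (x' + real j) - t * S k (x' + real i)) - (t * S k (x + real j) - t * S k (x + real i))\<bar>"
      "\<bar>(t * S k (x' + real j) - t * S k (x' + real i)) - (t * S k (x + real j) - t * S k (x + real i))\<bar> \<le> 1"
      by (auto simp: right_diff_distrib)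
    from pair_bound[OF i(2,3) \<open>0 \<le> \<omega>\<close> refl refl pp[of j] pp[of i]]
    have "\<omega>\<^sup>2 / 4 * ((cmod (?p x j))\<^sup>2 + (cmod (?p x' j))\<^sup>2)
       \<le> 8 * (?D x j i + ?D x' j i + (25/81)^k * (?v j)\<^sup>2 / 16 + (25/81)^k * (?v i)\<^sup>2 / 16)"
      unfolding q twisted_term_def .
    also have "\<dots> = 8 * (?D x j i + ?D x' j i) + (25/81)^k / 2 * ((?v j)\<^sup>2 + (?v i)\<^sup>2)"
      by (simp add: algebra_simps)
    also have "\<dots> \<le> 8 * ((\<Sum>i<?N. ?D x j i) + (\<Sum>i<?N. ?D x' j i)) + (25/81)^k / 2 * ((?v j)\<^sup>2 + (\<Sum>i<?N. (?v i)\<^sup>2))"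
      using i(1) by (intro add_mono mult_left_mono order_refl member_le_sum) auto
    finally show ?thesis .
  qed
  define V where "V = (\<Sum>i<?N. (?v i)\<^sup>2)"
  have "V \<ge> 0" by (simp add: V_def sum_nonneg)
  have "(\<Sum>j<?N. \<omega>\<^sup>2 / 4 * ((cmod (?p x j))\<^sup>2 + (cmod (?p x' j))\<^sup>2))
     \<le> (\<Sum>j<?N. 8 * ((\<Sum>i<?N. ?D x j i) + (\<Sum>i<?N. ?D x' j i)) + (25/81)^k / 2 * ((?v j)\<^sup>2 + V))"
    unfolding V_def by (rule sum_mono) (use one in simp)
  also have "\<dots> = 8 * ((\<Sum>j<?N. \<Sum>i<?N. ?D x j i) + (\<Sum>j<?N. \<Sum>i<?N. ?D x' j i)) + (25/81)^k / 2 * (V + 2^k * V)"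
    unfolding sum.distrib sum_distrib_left[symmetric] by (simp add: V_def)
  also have "(25/81)^k / 2 * (V + 2^k * V) \<le> (25/81)^k / 2 * (2 * (2^k * V))"
    using \<open>V \<ge> 0\<close> mult_right_mono[of 1 "2^k" V] by (intro mult_left_mono) (auto simp: mult.commute)
  finally have "\<omega>\<^sup>2 / 4 * (\<Sum>j<?N. (cmod (?p x j))\<^sup>2) + \<omega>\<^sup>2 / 4 * (\<Sum>j<?N. (cmod (?p x' j))\<^sup>2)
     \<le> 8 * (\<Sum>j<?N. \<Sum>i<?N. ?D x j i) + 8 * (\<Sum>j<?N. \<Sum>i<?N. ?D x' j i) + (25/81)^k * 2^k * V"
    unfolding distrib_left sum.distrib sum_distrib_left[symmetric] by (simp add: mult.assoc)
  \<comment> \<open>All Lipschitz errors are charged to the base point \<open>x\<close>; the error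
    term of \<open>Phi\<close> at \<open>x'\<close> is nonnegative and is dropped.\<close>
  moreover have "0 \<le> (25/81)^k * 2^k * (\<Sum>j<?N. (v (br k (x' + real j)))\<^sup>2)"
    by (intro mult_nonneg_nonneg sum_nonneg) auto
  ultimately show ?thesis unfolding Phi_def V_def by linarith
qed

text \<open>\<open>H k\<close> has period \<open>2^k\<close>, so compactness of one period, enlarged
  by 1 at both ends to contain the nearby point, suffices.\<close>

lemma H_uniform_cont:
  assumes "e > 0"
  obtains d where "d > 0" "\<And>x y. \<bar>x - y\<bar> \<le> d \<Longrightarrow> \<bar>H k x - H k y\<bar> \<le> e"
proof -
  have "uniformly_continuous_on {-1..2^k + 1} (H k)"
    by (intro compact_uniformly_continuous H_cont compact_Icc)
  then obtain d where d: "d > 0"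
    "\<And>x y. x \<in> {-1..2^k + 1} \<Longrightarrow> y \<in> {-1..2^k + 1} \<Longrightarrow> dist y x < d \<Longrightarrow> dist (H k y) (H k x) < e"
    unfolding uniformly_continuous_on_def using assms by metis
  show ?thesis
  proof (rule that[of "min (d / 2) 1"])
    show "min (d / 2) 1 > 0" using d by simp
    fix x y :: real assume xy: "\<bar>x - y\<bar> \<le> min (d / 2) 1"
    define z where "z = - \<lfloor>x / 2^k\<rfloor>"
    have "0 \<le> x + 2^k * of_int z" "x + 2^k * of_int z \<le> 2^k"
      using floor_divide_lower[of "2^k" x] floor_divide_upper[of "2^k" x]
      by (auto simp: z_def algebra_simps)
    moreover have "\<bar>y - x\<bar> < d" "\<bar>y - x\<bar> \<le> 1"
      using xy d(1) by (simp_all add: abs_minus_commute)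
    ultimately have "dist (H k (y + 2^k * of_int z)) (H k (x + 2^k * of_int z)) < e"
      by (intro d(2)) (auto simp: dist_real_def)
    then show "\<bar>H k x - H k y\<bar> \<le> e"
      by (simp add: H_add_int dist_real_def abs_minus_commute)
  qed
qed

text \<open>Of two branches whose \<open>H\<close> differ by \<open>c\<close>, at least one differs
  from branch \<open>j\<close> by \<open>c / 2\<close>. Uniform continuity keeps
  \<open>c / 4\<close> over a length \<open>r0\<close>, so one partner serves for all pairs of
  points in that interval.\<close>

lemma phase_partner:
  assumes sep: "\<And>x. \<exists>i<2^k. \<exists>i'<2^k. c \<le> \<bar>H k (x + real i) - H k (x + real i')\<bar>" and "c > 0"
  obtains r0 where "r0 > 0"
    "\<And>x0 j. \<exists>i<2^k. \<forall>x x'. x0 \<le> x \<longrightarrow> x < x' \<longrightarrow> x' \<le> x0 + r0 \<longrightarrow>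
       c / 4 * (x' - x) \<le> \<bar>phase_gap k j i x x'\<bar>"
proof -
  obtain d where d: "d > 0" "\<And>x y. \<bar>x - y\<bar> \<le> d \<Longrightarrow> \<bar>H k x - H k y\<bar> \<le> c / 8"
    using H_uniform_cont[of "c / 8"] \<open>c > 0\<close> by auto
  show ?thesis
  proof (rule that[OF d(1)])
    fix x0 :: real and j :: nat
    obtain i1 i2 where i12: "i1 < 2^k" "i2 < 2^k" "c \<le> \<bar>H k (x0 + real i1) - H k (x0 + real i2)\<bar>"
      using sep by blast
    then have "c / 2 \<le> \<bar>H k (x0 + real j) - H k (x0 + real i1)\<bar> \<or> c / 2 \<le> \<bar>H k (x0 + real j) - H k (x0 + real i2)\<bar>"
      by linarith
    then obtain i where i: "i < 2^k" "c / 2 \<le> \<bar>H k (x0 + real j) - H k (x0 + real i)\<bar>"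
      using i12 by blast
    have "c / 4 * (x' - x) \<le> \<bar>phase_gap k j i x x'\<bar>"
      if x: "x0 \<le> x" "x < x'" "x' \<le> x0 + d" for x x'
    proof -
      from S_mvt2[OF x(2), of k "real j" "real i"] obtain z where z: "x < z" "z < x'"
        "phase_gap k j i x x'
          = (x' - x) * (H k (z + real j) - H k (z + real i))" by blast
      have "\<bar>H k (x0 + real l) - H k (z + real l)\<bar> \<le> c / 8" for l
        using z x by (intro d(2)) auto
      from this[of j] this[of i] i(2) have "c / 4 \<le> \<bar>H k (z + real j) - H k (z + real i)\<bar>"
        by linarith
      then have "(x' - x) * (c / 4) \<le> (x' - x) * \<bar>H k (z + real j) - H k (z + real i)\<bar>"
        using x by (intro mult_left_mono) auto
      then show ?thesis unfolding z(3) abs_mult using x by (simp add: mult.commute)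
    qed
    then show "\<exists>i<2^k. \<forall>x x'. x0 \<le> x \<longrightarrow> x < x' \<longrightarrow> x' \<le> x0 + d \<longrightarrow>
       c / 4 * (x' - x) \<le> \<bar>phase_gap k j i x x'\<bar>"
      using i(1) by blast
  qed
qed

text \<open>The unit interval is cut into dyadic intervals whose images under \<open>Psi\<close>
  have length comparable to \<open>1 / (4 * \<bar>t\<bar>)\<close>, and inside each one the points
  of the left half are matched with those of the right half. Matching by translation in
  \<open>s\<close> preserves the measure, which is why doubling of \<open>Psi\<close> is needed to
  keep matched points apart in \<open>x\<close>.\<close>

lemma Phi_integral_nonneg:
  assumes partner: "\<And>x0 j. \<exists>i<2^k. \<forall>x x'. x0 \<le> x \<longrightarrow> x < x' \<longrightarrow> x' \<le> x0 + r0 \<longrightarrow>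
       c / 4 * (x' - x) \<le> \<bar>phase_gap k j i x x'\<bar>"
    and "c > 0" and t: "1 \<le> \<bar>t\<bar>" "1 / (4 * \<bar>t\<bar>) \<le> r0"
    and lip: "local_lip t u v" and v: "\<And>x. 0 \<le> v x"
    and cont: "continuous_on UNIV u" "continuous_on UNIV v"
  shows "0 \<le> integral {0..1} (\<lambda>s. Phi t k (c * c1\<^sup>2 / 16) u v (Psi s))"
proof -
  define r where "r = 1 / (4 * \<bar>t\<bar>)"
  \<comment> \<open>The phase speed \<open>c / 4\<close> times the smallest gap
    \<open>c1\<^sup>2 * r\<close> of matched points, multiplied by |t|, where |t| r = 1/4.\<close>
  define \<omega> where "\<omega> = c * c1\<^sup>2 / 16"
  have r: "r > 0" "\<bar>t\<bar> * r = 1/4" "r \<le> r0" using t by (auto simp: r_def)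
  let ?f = "\<lambda>s. Phi t k \<omega> u v (Psi s)"
  have fc: "continuous_on A ?f" for A by (intro comp_Psi_cont Phi_cont cont)
  have fi: "?f integrable_on {a..b}" for a b by (intro integrable_continuous_real fc)
  have split: "integral {a..a + l} ?f = integral {a..a + l / 2} ?f + integral {a + l / 2..a + l / 2 + l / 2} ?f"
    if "0 \<le> l" for a l
  proof -
    have "integral {a..a + l / 2} ?f + integral {a + l / 2..a + l} ?f = integral {a..a + l} ?f"
      using that by (intro Henstock_Kurzweil_Integration.integral_combine fi) auto
    moreover have "a + l / 2 + l / 2 = a + l" by simp
    ultimately show ?thesis by metis
  qed
  have base: "0 \<le> integral {s0..s0 + 1 / 2^N} ?f"
    if lower: "c1 * r \<le> Psi (s0 + 1 / 2^N) - Psi s0" and upper: "Psi (s0 + 1 / 2^N) - Psi s0 \<le> r" for s0 N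
  proof -
    define l where "l = (1 / 2^N :: real)"
    have l: "l > 0" by (simp add: l_def)
    \<comment> \<open>\<open>Psi_doubling\<close> compares the increment from \<open>s\<close> to
      \<open>s + l / 2\<close> with that of the whole interval, and the latter is at least
      \<open>c1 * r\<close>; this is where the second factor \<open>c1\<close> arises.\<close>
    have pair: "0 \<le> ?f s + ?f (s + l / 2)" if s: "s \<in> {s0..s0 + l / 2}" for s
    proof (rule Phi_pair[OF lip _ v])
      let ?x = "Psi s" and ?x' = "Psi (s + l / 2)" and ?o = "Psi s0"
      show "t \<noteq> 0" using t by auto
      show "0 \<le> \<omega>" using \<open>c > 0\<close> by (simp add: \<omega>_def)
      show "?x \<le> ?x'" using l by (intro Psi_mono) auto
      have x0: "?o \<le> ?x" "?x' \<le> Psi (s0 + l)"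
        using s by (auto intro!: Psi_mono simp: field_simps)
      then show "?x' - ?x \<le> 1 / (4 * \<bar>t\<bar>)"
        using upper unfolding l_def r_def by linarith
      have "?x < ?x'" using l by (intro Psi_strict) auto
      have "c1 * (Psi (s0 + l) - ?o) \<le> ?x' - ?x"
        using Psi_doubling[of s s0 N] s l unfolding l_def by auto
      moreover have "c1 * (c1 * r) \<le> c1 * (Psi (s0 + l) - ?o)"
        using lower c1_pos unfolding l_def by (intro mult_left_mono) auto
      ultimately have gap: "c1\<^sup>2 * r \<le> ?x' - ?x" by (simp add: power2_eq_square)
      have gap': "?x' - ?x \<le> r" using x0 upper unfolding l_def by linarith
      show "\<exists>i<2^k. \<omega> \<le> \<bar>t * phase_gap k j i ?x ?x'\<bar> \<and>
        \<bar>t * phase_gap k j i ?x ?x'\<bar> \<le> 1" for j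
      proof -
        let ?\<Delta> = "\<lambda>i. phase_gap k j i ?x ?x'"
        have "?x' \<le> ?o + r0" using x0 upper r(3) unfolding l_def by linarith
        then obtain i where i: "i < 2^k" "c / 4 * (?x' - ?x) \<le> \<bar>?\<Delta> i\<bar>"
          using partner[of ?o j] x0 \<open>?x < ?x'\<close> by blast
        have "c / 4 * (c1\<^sup>2 * r) \<le> \<bar>?\<Delta> i\<bar>"
          using i(2) mult_left_mono[OF gap, of "c / 4"] \<open>c > 0\<close> by linarith
        then have "\<bar>t\<bar> * (c / 4 * (c1\<^sup>2 * r)) \<le> \<bar>t\<bar> * \<bar>?\<Delta> i\<bar>"
          by (intro mult_left_mono) auto
        moreover have "\<bar>t\<bar> * (c / 4 * (c1\<^sup>2 * r)) = c / 4 * c1\<^sup>2 * (\<bar>t\<bar> * r)"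
          by (simp only: mult_ac)
        moreover have "\<dots> = \<omega>" unfolding r(2) \<omega>_def by simp
        ultimately have 1: "\<omega> \<le> \<bar>t * ?\<Delta> i\<bar>"
          unfolding abs_mult by linarith
        have "\<bar>?\<Delta> i\<bar> \<le> 2 * r"
          using S_lipschitz[of k "?x' + real j" "?x + real j"] S_lipschitz[of k "?x' + real i" "?x + real i"]
            gap' \<open>?x < ?x'\<close> by linarith
        then have "\<bar>t\<bar> * \<bar>?\<Delta> i\<bar> \<le> \<bar>t\<bar> * (2 * r)" by (intro mult_left_mono) auto
        then have "\<bar>t * ?\<Delta> i\<bar> \<le> 1"
          using r(2) unfolding abs_mult by linarith
        with 1 i(1) show ?thesis by blast
      qed
    qed
    have "integral {s0..s0 + l} ?f = integral {s0..s0 + l / 2} ?f + integral {s0 + l / 2..s0 + l / 2 + l / 2} ?f"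
      using l by (intro split) auto
    also have "integral {s0 + l / 2..s0 + l / 2 + l / 2} ?f = integral {s0..s0 + l / 2} (?f \<circ> (\<lambda>x. x + l / 2))"
      by (rule integral_shift[symmetric]) (rule fc)
    also have "integral {s0..s0 + l / 2} ?f + integral {s0..s0 + l / 2} (?f \<circ> (\<lambda>x. x + l / 2))
        = integral {s0..s0 + l / 2} (\<lambda>s. ?f s + ?f (s + l / 2))"
      unfolding comp_def
      by (rule Henstock_Kurzweil_Integration.integral_add[symmetric])
        (intro integrable_continuous_real fc continuous_on_compose2[OF fc[of UNIV]] continuous_intros; simp)+
    also have "\<dots> \<ge> 0"
      by (intro Henstock_Kurzweil_Integration.integral_nonneg integrable_continuous_real
            continuous_intros fc continuous_on_compose2[OF fc[of UNIV]]) (use pair in auto)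
    finally show ?thesis by (simp add: l_def)
  qed
  obtain M where M: "(5/9)^M < r" using real_arch_pow_inv[of r "5/9"] r by auto
  \<comment> \<open>A stopping-time subdivision: an interval with increment above \<open>r\<close>
    is halved, and doubling keeps both halves above \<open>c1 * r\<close>. At depth \<open>M\<close>
    every increment is below \<open>r\<close>, so \<open>m\<close> counts the halvings still
    available.\<close>
  have "0 \<le> integral {s..s + 1 / 2^N} ?f" if "N + m = M" "c1 * r \<le> Psi (s + 1 / 2^N) - Psi s" for N m s
    using that
  proof (induction m arbitrary: N s)
    case 0
    have "Psi (s + 1 / 2^N) - Psi s \<le> (5/9)^N * (Psi (2^N * (s + 1 / 2^N)) - Psi (2^N * s))"
      by (rule Psi_scaled) simp
    also have "2^N * (s + 1 / 2^N) = 2^N * s + 1" by (simp add: distrib_left)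
    finally have "Psi (s + 1 / 2^N) - Psi s \<le> r"
      using M 0 Psi_add_1[of "2^N * s"] by simp
    then show ?case using base 0 by blast
  next
    case (Suc m)
    show ?case
    proof (cases "Psi (s + 1 / 2^N) - Psi s \<le> r")
      case True
      then show ?thesis using base Suc by blast
    next
      case False
      define l where "l = (1 / 2^N :: real)"
      have l: "l > 0" "1 / 2^Suc N = l / 2" by (auto simp: l_def)
      have big: "r < Psi (s + l) - Psi s" using False by (simp add: l_def)
      then have "c1 * r \<le> c1 * (Psi (s + l) - Psi s)" using c1_pos by (intro mult_left_mono) auto
      moreover have "c1 * (Psi (s + l) - Psi s) \<le> Psi (s + l / 2) - Psi s"
        using Psi_doubling[of s s N] by (simp add: l_def)
      moreover have "c1 * (Psi (s + l) - Psi s) \<le> Psi (s + l / 2 + l / 2) - Psi (s + l / 2)"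
        using Psi_doubling[of "s + l / 2" s N] l(1) unfolding l_def[symmetric] by simp
      ultimately have "c1 * r \<le> Psi (s + 1 / 2^Suc N) - Psi s"
        "c1 * r \<le> Psi (s + l / 2 + 1 / 2^Suc N) - Psi (s + l / 2)"
        unfolding l(2) by linarith+
      then have "0 \<le> integral {s..s + 1 / 2^Suc N} ?f" "0 \<le> integral {s + l / 2..s + l / 2 + 1 / 2^Suc N} ?f"
        using Suc.IH[of "Suc N"] Suc.prems(1) by auto
      then show ?thesis
        using split[of l s] l unfolding l(2) by (simp add: l_def)
    qed
  qed
  from this[of 0 M 0] have "c1 * r \<le> 1 \<Longrightarrow> 0 \<le> integral {0..1} ?f"
    using Psi_add_1[of 0] by simp
  moreover have "c1 * r \<le> 1 * 1"
    using c1_pos c1_le_1 r t by (intro mult_mono) (auto simp: r_def)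
  ultimately show ?thesis by (simp add: \<omega>_def)
qed

end

section \<open>Decay of the energy and passage to pointwise bounds\<close>

lemma integral_square_le:
  fixes f :: "real \<Rightarrow> real"
  assumes "continuous_on {0..1} f"
  shows "(integral {0..1} f)\<^sup>2 \<le> integral {0..1} (\<lambda>x. (f x)\<^sup>2)"
proof -
  define m where "m = integral {0..1} f"
  have f: "(f has_integral m) {0..1}"
    unfolding m_def by (intro integrable_integral integrable_continuous_real assms)
  have f2: "((\<lambda>x. (f x)\<^sup>2) has_integral integral {0..1} (\<lambda>x. (f x)\<^sup>2)) {0..1}"
    by (intro integrable_integral integrable_continuous_real continuous_intros assms)
  have "((\<lambda>x. (f x)\<^sup>2 - 2 * m * f x + m\<^sup>2) has_integral
      integral {0..1} (\<lambda>x. (f x)\<^sup>2) - 2 * m * m + m\<^sup>2) {0..1}"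
    using has_integral_add[OF has_integral_diff[OF f2 has_integral_mult_right[OF f, of "2 * m"]]
        has_integral_const_real[of "m\<^sup>2" 0 1]] by simp
  moreover have "(f x)\<^sup>2 - 2 * m * f x + m\<^sup>2 = (f x - m)\<^sup>2" for x
    by (simp add: power2_eq_square algebra_simps)
  ultimately have "((\<lambda>x. (f x - m)\<^sup>2) has_integral
      integral {0..1} (\<lambda>x. (f x)\<^sup>2) - 2 * m * m + m\<^sup>2) {0..1}"
    by (simp only:)
  from has_integral_nonneg[OF this] have "0 \<le> integral {0..1} (\<lambda>x. (f x)\<^sup>2) - 2 * m * m + m\<^sup>2"
    by simp
  then show ?thesis by (simp add: m_def power2_eq_square)
qed

context doubling_lift_C2
begin

lemma avg_square_le: "(avg k h x)\<^sup>2 \<le> avg k (\<lambda>x. (h x)\<^sup>2) x"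
proof -
  have "(\<Sum>j<2^k. h (br k (x + real j)))\<^sup>2 \<le> (\<Sum>j<2^k. (h (br k (x + real j)))\<^sup>2) * real (card {..<2^k::nat})"
    by (rule sum_squared_le_sum_of_squares)
  then have "(\<Sum>j<2^k. h (br k (x + real j)))\<^sup>2 / (2^k)\<^sup>2 \<le> (\<Sum>j<2^k. (h (br k (x + real j)))\<^sup>2) * 2^k / (2^k)\<^sup>2"
    by (intro divide_right_mono) auto
  then show ?thesis by (simp add: avg_def power_divide power2_eq_square)
qed

text \<open>\<open>Phi\<close> is arranged so that the squared modulus of \<open>u'\<close> is
  pointwise an exact combination of the averages of the squares of \<open>u\<close> and
  \<open>v\<close>, minus a positive multiple of \<open>Phi\<close>. Averages preserve integrals
  along \<open>Psi\<close>, so the sign of the integral of \<open>Phi\<close> is all that is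
  needed.\<close>

lemma energy_step:
  assumes cont: "continuous_on UNIV u" "continuous_on UNIV v"
    and Phi: "0 \<le> integral {0..1} (\<lambda>s. Phi t k \<omega> u v (Psi s))"
  defines "u' \<equiv> (\<lambda>x. (\<Sum>j<2^k. cis (t * S k (x + real j)) * u (br k (x + real j))) / 2^k)"
  shows "integral {0..1} (\<lambda>s. (cmod (u' (Psi s)))\<^sup>2)
    \<le> (1 - \<omega>\<^sup>2 / (64 * 2^k)) * integral {0..1} (\<lambda>s. (cmod (u (Psi s)))\<^sup>2)
      + (25/81)^k / 16 * integral {0..1} (\<lambda>s. (v (Psi s))\<^sup>2)"
proof -
  let ?A = "\<lambda>x. avg k (\<lambda>x. (cmod (u x))\<^sup>2) x" and ?B = "\<lambda>x. avg k (\<lambda>x. (v x)\<^sup>2) x"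
  define X Y Z where "X = integral {0..1} (\<lambda>s. (cmod (u (Psi s)))\<^sup>2)"
    and "Y = integral {0..1} (\<lambda>s. (v (Psi s))\<^sup>2)"
    and "Z = integral {0..1} (\<lambda>s. Phi t k \<omega> u v (Psi s))"
  have point: "(cmod (u' x))\<^sup>2 = (1 - \<omega>\<^sup>2 / (64 * 2^k)) * ?A x + (25/81)^k / 16 * ?B x
      - 1 / (16 * (2^k)\<^sup>2) * Phi t k \<omega> u v x" for x
  proof -
    define N U V D T where "N = (2^k :: real)" and "U = (\<Sum>j<2^k. (cmod (u (br k (x + real j))))\<^sup>2)"
      and "V = (\<Sum>j<2^k. (v (br k (x + real j)))\<^sup>2)"
      and "D = (\<Sum>j<2^k. \<Sum>i<2^k. (cmod (twisted_term t k u j x - twisted_term t k u i x))\<^sup>2)"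
      and "T = (cmod (\<Sum>j<2^k. twisted_term t k u j x))\<^sup>2"
    have "N > 0" by (simp add: N_def)
    have "(\<Sum>j<2^k. (cmod (twisted_term t k u j x))\<^sup>2) = U"
      by (simp add: U_def twisted_term_def norm_mult)
    then have D: "D = 2 * N * U - 2 * T"
      unfolding D_def T_def by (subst sum_sum_cmod_diff) (simp add: N_def)
    have "(cmod (u' x))\<^sup>2 = T / N\<^sup>2"
      by (simp add: u'_def T_def twisted_term_def norm_divide norm_power power_divide N_def)
    moreover have "?A x = U / N" "?B x = V / N" by (simp_all add: avg_def U_def V_def N_def)
    moreover have "Phi t k \<omega> u v x = 8 * D + (25/81)^k * N * V - \<omega>\<^sup>2 / 4 * U"
      by (simp add: Phi_def D_def V_def U_def N_def)
    moreover have "T / N\<^sup>2 = (1 - \<omega>\<^sup>2 / (64 * N)) * (U / N) + (25/81)^k / 16 * (V / N)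
        - 1 / (16 * N\<^sup>2) * (8 * D + (25/81)^k * N * V - \<omega>\<^sup>2 / 4 * U)"
      unfolding D using \<open>N > 0\<close> by (simp add: field_simps power2_eq_square)
    ultimately show ?thesis by (simp add: N_def)
  qed
  have cA: "continuous_on UNIV (\<lambda>x. (cmod (u x))\<^sup>2)" and cB: "continuous_on UNIV (\<lambda>x. (v x)\<^sup>2)"
    by (intro continuous_intros cont)+
  have A: "((\<lambda>s. ?A (Psi s)) has_integral X) {0..1}"
    unfolding X_def avg_integral[OF cA, of k, symmetric]
    by (intro integrable_integral comp_Psi_integrable avg_cont cA)
  have B: "((\<lambda>s. ?B (Psi s)) has_integral Y) {0..1}"
    unfolding Y_def avg_integral[OF cB, of k, symmetric]
    by (intro integrable_integral comp_Psi_integrable avg_cont cB)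
  have C: "((\<lambda>s. Phi t k \<omega> u v (Psi s)) has_integral Z) {0..1}"
    unfolding Z_def by (intro integrable_integral comp_Psi_integrable Phi_cont cont)
  have "((\<lambda>s. (cmod (u' (Psi s)))\<^sup>2) has_integral
     (1 - \<omega>\<^sup>2 / (64 * 2^k)) * X + (25/81)^k / 16 * Y - 1 / (16 * (2^k)\<^sup>2) * Z) {0..1}"
    unfolding point by (intro has_integral_diff has_integral_add has_integral_mult_right A B C)
  from integral_unique[OF this] show ?thesis
    using Phi by (simp add: X_def Y_def Z_def)
qed

text \<open>The energy \<open>X\<close> and the mean square \<open>Y\<close> of the Lipschitz bound
  satisfy X' <= (1 - \<epsilon>) X + (25/81)^k / 16 * Y and Y' <= 2 X + Y / 2. The weight
  \<epsilon>/4 on \<open>Y\<close> gives back only half of the gain \<epsilon> in \<open>X\<close>,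
  and multiplies the \<open>Y\<close> part by at most 3/4, which is at most 1 -
  \<epsilon>/2.\<close>

lemma W_energy:
  assumes nonneg: "\<And>n. 0 \<le> integral {0..1} (\<lambda>s. Phi t k \<omega> (W t (k * n)) (lip_bound t k n) (Psi s))"
    and \<epsilon>: "\<epsilon> = \<omega>\<^sup>2 / (64 * 2^k)" "(25/81)^k \<le> \<epsilon>" "\<epsilon> \<le> 1/2"
  shows "integral {0..1} (\<lambda>s. (cmod (W t (k * n) (Psi s)))\<^sup>2) \<le> (1 - \<epsilon> / 2)^n"
proof -
  define X Y where "X n = integral {0..1} (\<lambda>s. (cmod (W t (k * n) (Psi s)))\<^sup>2)"
    and "Y n = integral {0..1} (\<lambda>s. (lip_bound t k n (Psi s))\<^sup>2)" for n
  have "\<epsilon> > 0" using \<epsilon>(2) by (meson less_le_trans zero_less_power zero_less_divide_iff zero_less_numeral)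
  have X0: "0 \<le> X n" and Y0: "0 \<le> Y n" for n
    unfolding X_def Y_def
    by (intro Henstock_Kurzweil_Integration.integral_nonneg comp_Psi_integrable continuous_intros W_cont lip_bound_cont; simp)+
  have W: "W t (k * Suc n) = (\<lambda>x. (\<Sum>j<2^k. cis (t * S k (x + real j)) * W t (k * n) (br k (x + real j))) / 2^k)" for n
    using W_add[of t "k * n" k] by (simp add: add.commute fun_eq_iff)
  have XS: "X (Suc n) \<le> (1 - \<epsilon>) * X n + (25/81)^k / 16 * Y n" for n
    unfolding X_def Y_def W \<epsilon>(1) by (rule energy_step[OF W_cont lip_bound_cont nonneg])
  have YS: "Y (Suc n) \<le> 2 * X n + Y n / 2" for n
  proof -
    let ?h = "\<lambda>x. cmod (W t (k * n) x) + lip_bound t k n x / 2"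
    have ch: "continuous_on UNIV (\<lambda>x. (?h x)\<^sup>2)" by (auto intro!: continuous_intros W_cont lip_bound_cont)
    have "Y (Suc n) \<le> integral {0..1} (\<lambda>s. avg k (\<lambda>x. (?h x)\<^sup>2) (Psi s))"
      unfolding Y_def lip_bound.simps using avg_square_le
      by (intro integral_le comp_Psi_integrable continuous_intros avg_cont W_cont lip_bound_cont) auto
    also have "\<dots> = integral {0..1} (\<lambda>s. (?h (Psi s))\<^sup>2)"
      by (rule avg_integral[OF ch])
    also have "\<dots> \<le> integral {0..1} (\<lambda>s. 2 * (cmod (W t (k * n) (Psi s)))\<^sup>2 + (lip_bound t k n (Psi s))\<^sup>2 / 2)"
    proof (intro integral_le comp_Psi_integrable[of "\<lambda>x. (?h x)\<^sup>2"] ch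
        comp_Psi_integrable[of "\<lambda>x. 2 * (cmod (W t (k * n) x))\<^sup>2 + (lip_bound t k n x)\<^sup>2 / 2"])
      show "(a + b / 2)\<^sup>2 \<le> 2 * a\<^sup>2 + b\<^sup>2 / 2" for a b :: real
        using zero_le_power2[of "a - b / 2"] by (simp add: power2_eq_square algebra_simps)
    qed (auto intro!: continuous_intros W_cont lip_bound_cont)
    also have "\<dots> = 2 * X n + Y n / 2"
      unfolding X_def Y_def
      by (subst Henstock_Kurzweil_Integration.integral_add)
        (auto intro!: comp_Psi_integrable[of "\<lambda>x. (cmod (W t (k * n) x))\<^sup>2"]
           comp_Psi_integrable[of "\<lambda>x. (lip_bound t k n x)\<^sup>2"] continuous_intros W_cont lip_bound_cont)
    finally show ?thesis .
  qed
  have "X n + \<epsilon> / 4 * Y n \<le> (1 - \<epsilon> / 2)^n"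
  proof (induction n)
    case 0
    then show ?case by (simp add: X_def Y_def)
  next
    case (Suc n)
    have "X (Suc n) + \<epsilon> / 4 * Y (Suc n) \<le> ((1 - \<epsilon>) * X n + (25/81)^k / 16 * Y n) + \<epsilon> / 4 * (2 * X n + Y n / 2)"
      using XS[of n] YS[of n] \<open>\<epsilon> > 0\<close> by (intro add_mono mult_left_mono) auto
    also have "\<dots> \<le> ((1 - \<epsilon>) * X n + \<epsilon> / 16 * Y n) + \<epsilon> / 4 * (2 * X n + Y n / 2)"
      using \<epsilon>(2) mult_right_mono[of "(25/81)^k / 16" "\<epsilon> / 16" "Y n"] Y0[of n] by simp
    also have "\<dots> = (1 - \<epsilon> / 2) * X n + 3/4 * (\<epsilon> / 4 * Y n)"
      by (simp add: algebra_simps)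
    also have "\<dots> \<le> (1 - \<epsilon> / 2) * X n + (1 - \<epsilon> / 2) * (\<epsilon> / 4 * Y n)"
      using \<epsilon>(3) \<open>\<epsilon> > 0\<close> Y0[of n] by (intro add_mono mult_right_mono order_refl) auto
    also have "\<dots> = (1 - \<epsilon> / 2) * (X n + \<epsilon> / 4 * Y n)" by (simp add: algebra_simps)
    also have "\<dots> \<le> (1 - \<epsilon> / 2) * (1 - \<epsilon> / 2)^n"
      using Suc \<epsilon>(3) by (intro mult_left_mono) auto
    finally show ?case by simp
  qed
  moreover have "0 \<le> \<epsilon> / 4 * Y n" using \<open>\<epsilon> > 0\<close> Y0[of n] by simp
  ultimately show ?thesis unfolding X_def by linarith
qed

text \<open>After \<open>m\<close> further steps the branches starting at \<open>x\<close> and at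
  any \<open>Psi s\<close> are within \<open>(5/9)^m\<close> of each other, so the average of |W t
  n| at \<open>x\<close> is nearly its mean, which is at most the root mean square. The Lipschitz
  constant |t| prices the difference.\<close>

lemma W_add_bound:
  assumes x: "x \<in> {Psi 0..Psi 1}"
  shows "cmod (W t (n + m) x) \<le> sqrt (integral {0..1} (\<lambda>s. (cmod (W t n (Psi s)))\<^sup>2)) + \<bar>t\<bar> * (5/9)^m"
proof -
  let ?h = "\<lambda>x. cmod (W t n x)"
  have hc: "continuous_on UNIV ?h" by (intro continuous_intros W_cont)
  have "cmod (W t (n + m) x) \<le> avg m ?h x"
    unfolding W_add avg_def norm_divide
    by (auto simp: norm_power norm_mult intro!: divide_right_mono sum_norm_le)
  also have "\<dots> \<le> integral {0..1} (\<lambda>s. avg m ?h (Psi s) + \<bar>t\<bar> * (5/9)^m)"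
  proof -
    have "avg m ?h x \<le> avg m ?h (Psi s) + \<bar>t\<bar> * (5/9)^m" if "s \<in> {0..1}" for s
    proof -
      have "\<bar>x - Psi s\<bar> \<le> 1"
        using that x Psi_mono[of 0 s] Psi_mono[of s 1] Psi_add_1[of 0] by auto
      have "?h (br m (x + real j)) \<le> ?h (br m (Psi s + real j)) + \<bar>t\<bar> * (5/9)^m" for j
      proof -
        have "?h (br m (x + real j)) - ?h (br m (Psi s + real j)) \<le> \<bar>t\<bar> * \<bar>br m (x + real j) - br m (Psi s + real j)\<bar>"
          by (rule order_trans[OF norm_triangle_ineq2 W_lipschitz])
        also have "\<dots> \<le> \<bar>t\<bar> * ((5/9)^m * \<bar>x - Psi s\<bar>)"
          using br_dist(2)[of m "x + real j" "Psi s + real j"] by (intro mult_left_mono) auto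
        also have "\<dots> \<le> \<bar>t\<bar> * ((5/9)^m * 1)"
          using \<open>\<bar>x - Psi s\<bar> \<le> 1\<close> by (intro mult_left_mono) auto
        finally show ?thesis by simp
      qed
      then have "(\<Sum>j<2^m. ?h (br m (x + real j))) \<le> (\<Sum>j<2^m. ?h (br m (Psi s + real j)) + \<bar>t\<bar> * (5/9)^m)"
        by (intro sum_mono)
      also have "\<dots> = (avg m ?h (Psi s) + \<bar>t\<bar> * (5/9)^m) * 2^m"
        unfolding sum.distrib avg_def distrib_right by simp
      finally show ?thesis unfolding avg_def[of m ?h x] by (simp add: pos_divide_le_eq)
    qed
    note le = this
    have "integral {0..1} (\<lambda>s::real. avg m ?h x) \<le> integral {0..1} (\<lambda>s. avg m ?h (Psi s) + \<bar>t\<bar> * (5/9)^m)"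
      by (rule integral_le[OF _ _ le])
        (intro integrable_continuous_real continuous_intros comp_Psi_cont avg_cont hc; assumption)+
    then show ?thesis by simp
  qed
  also have "\<dots> = integral {0..1} (\<lambda>s. avg m ?h (Psi s)) + \<bar>t\<bar> * (5/9)^m"
    using integral_unique[OF has_integral_add[OF integrable_integral[OF comp_Psi_integrable[OF avg_cont[OF hc]]]
          has_integral_const_real[of "\<bar>t\<bar> * (5/9)^m" 0 1]]] by simp
  also have "integral {0..1} (\<lambda>s. avg m ?h (Psi s)) = integral {0..1} (\<lambda>s. ?h (Psi s))"
    by (rule avg_integral[OF hc])
  also have "\<dots> \<le> sqrt (integral {0..1} (\<lambda>s. (?h (Psi s))\<^sup>2))"
    by (intro real_le_rsqrt integral_square_le comp_Psi_cont hc)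
  finally show ?thesis by simp
qed

text \<open>The choices are made in the order \<open>c\<close>, \<open>\<omega>\<close>,
  \<open>k\<close>, \<open>r0\<close>, \<open>t0\<close>: the gap \<open>c\<close> is uniform in
  \<open>k\<close>, the length \<open>r0\<close> depends on \<open>k\<close>, and \<open>t0\<close>
  brings \<open>1 / (4 * \<bar>t\<bar>)\<close> below \<open>r0\<close>.\<close>

lemma W_decay:
  assumes UNI
  obtains k \<theta> t0 where "k > 0" "0 < \<theta>" "\<theta> < 1" "1 \<le> t0"
    "\<And>t p x. t0 \<le> \<bar>t\<bar> \<Longrightarrow> x \<in> {Psi 0..Psi 1} \<Longrightarrow> cmod (W t (k * p) x) \<le> 2 * \<bar>t\<bar> * \<theta>^p"
proof -
  obtain c k0 where c: "c > 0"
    "\<And>k x. k0 \<le> k \<Longrightarrow> \<exists>i<2^k. \<exists>i'<2^k. c \<le> \<bar>H k (x + real i) - H k (x + real i')\<bar>"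
    using assms unfolding UNI_def by blast
  define \<omega> where "\<omega> = c * c1\<^sup>2 / 16"
  have "\<omega> > 0" using c(1) c1_pos by (simp add: \<omega>_def)
  have "c \<le> 2"
  proof -
    obtain i i' where "c \<le> \<bar>H k0 (0 + real i) - H k0 (0 + real i')\<bar>" using c(2)[of k0 0] by auto
    then show ?thesis using H_bound[of k0 "0 + real i"] H_bound[of k0 "0 + real i'"] by linarith
  qed
  then have "c * c1\<^sup>2 \<le> 2 * 1" using c(1) c1_pos c1_le_1 by (intro mult_mono power_le_one) auto
  then have "\<omega> \<le> 1" by (simp add: \<omega>_def)
  then have "\<omega>\<^sup>2 \<le> 1" using \<open>\<omega> > 0\<close> by (intro power_le_one) auto
  \<comment> \<open>The Lipschitz error \<open>(25/81)^k\<close> must be below the gain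
    \<open>\<omega>\<^sup>2 / (64 * 2^k)\<close>, that is, \<open>(50/81)^k\<close> must be below a
    constant.\<close>
  obtain k1 where k1: "(50/81::real)^k1 < \<omega>\<^sup>2 / 64"
    using real_arch_pow_inv[of "\<omega>\<^sup>2 / 64" "50/81"] \<open>\<omega> > 0\<close> by auto
  define k where "k = Suc (k0 + k1 + 3)"
  have "(5/9::real)^k \<le> (5/9)^3" by (intro power_decreasing) (auto simp: k_def)
  then have k4: "(5/9::real)^k \<le> 1/4" by (simp add: power3_eq_cube)
  have "(50/81::real)^k \<le> (50/81)^k1" by (intro power_decreasing) (auto simp: k_def)
  then have k5: "(50/81::real)^k \<le> \<omega>\<^sup>2 / 64" using k1 by linarith
  define \<epsilon> where "\<epsilon> = \<omega>\<^sup>2 / (64 * 2^k)"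
  have "(50/81::real)^k = (25/81)^k * 2^k" by (simp flip: power_mult_distrib)
  then have \<epsilon>1: "(25/81)^k \<le> \<epsilon>" using k5 by (simp add: \<epsilon>_def field_simps)
  have "\<epsilon> > 0" using \<open>\<omega> > 0\<close> by (simp add: \<epsilon>_def)
  have "\<omega>\<^sup>2 / (64 * 2^k) \<le> 1 / (64 * 1)" using \<open>\<omega>\<^sup>2 \<le> 1\<close> by (intro frac_le) auto
  then have \<epsilon>2: "\<epsilon> \<le> 1/2" unfolding \<epsilon>_def by linarith
  have "k0 \<le> k" by (simp add: k_def)
  obtain r0 where r0: "r0 > 0"
    "\<And>x0 j. \<exists>i<2^k. \<forall>x x'. x0 \<le> x \<longrightarrow> x < x' \<longrightarrow> x' \<le> x0 + r0 \<longrightarrow>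
       c / 4 * (x' - x) \<le> \<bar>phase_gap k j i x x'\<bar>"
    using phase_partner[OF c(2)[OF \<open>k0 \<le> k\<close>] c(1)] by blast
  define t0 where "t0 = max 1 (1 / (4 * r0))"
  define \<theta> where "\<theta> = max (sqrt (1 - \<epsilon> / 2)) ((5/9)^k)"
  show ?thesis
  \<comment> \<open>Half of the steps reduces the energy, the other half turns the mean square into
    a pointwise bound.\<close>
  proof (rule that[of "2 * k" \<theta> t0])
    show "2 * k > 0" by (simp add: k_def)
    show "0 < \<theta>" by (simp add: \<theta>_def less_max_iff_disj)
    show "\<theta> < 1" using k4 \<open>\<epsilon> > 0\<close> by (simp add: \<theta>_def)
    show "1 \<le> t0" by (simp add: t0_def)
    fix t p x assume t: "t0 \<le> \<bar>t\<bar>" and x: "x \<in> {Psi 0..Psi 1}"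
    have t1: "1 \<le> \<bar>t\<bar>" using t by (simp add: t0_def)
    have "1 / (4 * r0) \<le> \<bar>t\<bar>" using t by (simp add: t0_def)
    then have t2: "1 / (4 * \<bar>t\<bar>) \<le> r0" using r0(1) t1 by (simp add: field_simps)
    have "t \<noteq> 0" using t1 by auto
    have "0 \<le> integral {0..1} (\<lambda>s. Phi t k \<omega> (W t (k * n)) (lip_bound t k n) (Psi s))" for n
      unfolding \<omega>_def
      by (rule Phi_integral_nonneg[OF r0(2) c(1) t1 t2 W_local_lip[OF k4 \<open>t \<noteq> 0\<close>] lip_bound_nonneg W_cont lip_bound_cont])
    from W_energy[OF this \<epsilon>_def \<epsilon>1 \<epsilon>2, of p]
    have "sqrt (integral {0..1} (\<lambda>s. (cmod (W t (k * p) (Psi s)))\<^sup>2)) \<le> sqrt ((1 - \<epsilon> / 2)^p)"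
      by simp
    also have "\<dots> = sqrt (1 - \<epsilon> / 2)^p" by (simp add: real_sqrt_power)
    also have "\<dots> \<le> \<theta>^p" using \<epsilon>2 by (intro power_mono) (auto simp: \<theta>_def)
    finally have 1: "sqrt (integral {0..1} (\<lambda>s. (cmod (W t (k * p) (Psi s)))\<^sup>2)) \<le> \<theta>^p" .
    have "(5/9)^(k * p) \<le> \<theta>^p"
      unfolding power_mult by (intro power_mono) (auto simp: \<theta>_def)
    then have 2: "\<bar>t\<bar> * (5/9)^(k * p) \<le> \<bar>t\<bar> * \<theta>^p" by (intro mult_left_mono) auto
    have "1 * \<theta>^p \<le> \<bar>t\<bar> * \<theta>^p" using t1 \<open>0 < \<theta>\<close> by (intro mult_right_mono) auto
    moreover have e: "2 * k * p = k * p + k * p" by simp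
    ultimately show "cmod (W t (2 * k * p) x) \<le> 2 * \<bar>t\<bar> * \<theta>^p"
      using W_add_bound[OF x, of t "k * p" "k * p"] 1 2 unfolding e by linarith
  qed
qed

end

section \<open>Mean squares of oscillatory integrals\<close>

lemma norm_integral_bound_unit:
  fixes f :: "real \<Rightarrow> complex"
  assumes "\<And>x. x \<in> {0..1} \<Longrightarrow> cmod (f x) \<le> B" "0 \<le> B"
  shows "cmod (integral {0..1} f) \<le> B"
proof (cases "f integrable_on {0..1}")
  case True
  from has_integral_bound_real[OF assms(2) finite.emptyI integrable_integral[OF True]] assms(1)
  show ?thesis by simp
next
  case False
  then show ?thesis using assms(2) by (simp add: not_integrable_integral)
qed

lemma cmod_integral_square:
  fixes f :: "real \<Rightarrow> complex"
  assumes "continuous_on {0..1} f"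
  shows "of_real ((cmod (integral {0..1} f))\<^sup>2) = integral {0..1} (\<lambda>v. integral {0..1} (\<lambda>v'. f v * cnj (f v')))"
proof -
  define z where "z = integral {0..1} f"
  have f: "(f has_integral z) {0..1}"
    unfolding z_def by (intro integrable_integral integrable_continuous_real assms)
  then have "((\<lambda>v'. cnj (f v')) has_integral cnj z) {0..1}"
    using has_integral_cnj[of f z "{0..1}"] by (simp add: comp_def)
  then have inner: "integral {0..1} (\<lambda>v'. f v * cnj (f v')) = f v * cnj z" for v
    by (intro integral_unique has_integral_mult_right)
  have outer: "integral {0..1} (\<lambda>v. f v * cnj z) = z * cnj z"
    by (intro integral_unique has_integral_mult_left f)
  show ?thesis unfolding inner outer z_def[symmetric] by (rule complex_norm_square)
qed

text \<open>For each \<open>v\<close> the \<open>v'\<close> within \<rho> of it form a set of length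
  at most 2 \<rho>, where only the trivial bound \<open>B\<close> is used.\<close>

lemma double_integral_bound:
  fixes g :: "real \<Rightarrow> real \<Rightarrow> complex"
  assumes cont: "\<And>v. v \<in> {0..1} \<Longrightarrow> continuous_on {0..1} (g v)"
    and B: "\<And>v v'. v \<in> {0..1} \<Longrightarrow> v' \<in> {0..1} \<Longrightarrow> cmod (g v v') \<le> B" "0 \<le> B"
    and D: "\<And>v v'. v \<in> {0..1} \<Longrightarrow> v' \<in> {0..1} \<Longrightarrow> \<rho> \<le> \<bar>v - v'\<bar> \<Longrightarrow> cmod (g v v') \<le> D" "0 \<le> D"
    and "0 \<le> \<rho>"
  shows "cmod (integral {0..1} (\<lambda>v. integral {0..1} (g v))) \<le> 2 * \<rho> * B + D"
proof (rule norm_integral_bound_unit)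
  fix v :: real assume v: "v \<in> {0..1}"
  let ?I = "{v - \<rho>..v + \<rho>}"
  have int: "{0..1} \<inter> ?I = {max 0 (v - \<rho>)..min 1 (v + \<rho>)}" by auto
  have i1: "(\<lambda>v'. if v' \<in> ?I then B else 0) integrable_on {0..1}"
    unfolding integrable_restrict_Int[of "?I"] using int by (simp add: Int_commute integrable_const_ivl)
  have "integral {0..1} (\<lambda>v'. if v' \<in> ?I then B else 0) = integral {max 0 (v - \<rho>)..min 1 (v + \<rho>)} (\<lambda>_. B)"
    unfolding integral_restrict_Int by (simp only: int Int_commute)
  also have "\<dots> = (min 1 (v + \<rho>) - max 0 (v - \<rho>)) * B"
    using v \<open>0 \<le> \<rho>\<close> unfolding integral_const_real by (subst content_real) auto
  also have "\<dots> \<le> 2 * \<rho> * B"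
    using \<open>0 \<le> B\<close> by (intro mult_right_mono) auto
  finally have i2: "integral {0..1} (\<lambda>v'. if v' \<in> ?I then B else 0) \<le> 2 * \<rho> * B" .
  have "cmod (integral {0..1} (g v)) \<le> integral {0..1} (\<lambda>v'. (if v' \<in> ?I then B else 0) + D)"
  proof (rule Henstock_Kurzweil_Integration.integral_norm_bound_integral)
    show "g v integrable_on {0..1}" by (intro integrable_continuous_real cont v)
    show "(\<lambda>v'. (if v' \<in> ?I then B else 0) + D) integrable_on {0..1}"
      by (intro integrable_add i1 integrable_const_ivl)
    fix v' :: real assume v': "v' \<in> {0..1}"
    show "cmod (g v v') \<le> (if v' \<in> ?I then B else 0) + D"
    proof (cases "v' \<in> ?I")
      case True
      then show ?thesis using B(1)[OF v v'] \<open>0 \<le> D\<close> by simp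
    next
      case False
      then have "\<rho> \<le> \<bar>v - v'\<bar>" by auto
      then have "cmod (g v v') \<le> D" by (rule D(1)[OF v v'])
      then show ?thesis unfolding if_not_P[OF False] by simp
    qed
  qed
  also have "\<dots> = integral {0..1} (\<lambda>v'. if v' \<in> ?I then B else 0) + D"
    using integral_unique[OF has_integral_add[OF integrable_integral[OF i1] has_integral_const_real[of D 0 1]]] by simp
  finally show "cmod (integral {0..1} (g v)) \<le> 2 * \<rho> * B + D" using i2 by linarith
qed (use assms in auto)

lemma cos_ge_half:
  assumes "\<bar>x\<bar> \<le> (1::real)"
  shows "1/2 \<le> cos x"
proof -
  have "cos x = 1 - 2 * (sin (x / 2))\<^sup>2"
    using cos_double_sin[of "x / 2"] by simp
  moreover have "\<bar>sin (x / 2)\<bar>\<^sup>2 \<le> (1/2)\<^sup>2"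
    using abs_sin_x_le_abs_x[of "x / 2"] assms by (intro power_mono) auto
  ultimately show ?thesis by (simp add: power2_eq_square)
qed

text \<open>
  The Fejer kernel \<open>\<bar>\<integral>\<^sub>0\<^sup>1 cis (v y) dv\<bar>\<^sup>2\<close> is nonnegative, bounded below for \<open>\<bar>y\<bar> \<le> 1\<close>, and a
  superposition of characters of bounded frequency.
\<close>

lemma small_ball_bound:
  fixes y :: "nat \<Rightarrow> real"
  assumes "0 < w" "0 \<le> t0" "0 \<le> D"
    and D: "\<And>t. t0 \<le> \<bar>t\<bar> \<Longrightarrow> \<bar>t\<bar> \<le> 1 / w \<Longrightarrow> cmod (\<Sum>j<N. cis (t * y j)) \<le> D * real N"
  shows "real (card {j \<in> {..<N}. a \<le> y j \<and> y j \<le> a + w}) \<le> 4 * (2 * t0 * w + D) * real N"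
proof -
  let ?J = "{j \<in> {..<N}. a \<le> y j \<and> y j \<le> a + w}"
  \<comment> \<open>The window becomes the unit interval. Each counted point then has kernel at
    least (1/2)^2, which is the origin of the factor 4.\<close>
  define b where "b j = (y j - a) / w" for j
  define K where "K j = (cmod (integral {0..1} (\<lambda>v. cis (v * b j))))\<^sup>2" for j
  have ci: "continuous_on A (\<lambda>v. cis (v * c))" for A c by (intro continuous_intros)
  have K: "1/4 \<le> K j" if "j \<in> ?J" for j
  proof -
    have bj: "0 \<le> b j" "b j \<le> 1" using that \<open>0 < w\<close> by (auto simp: b_def field_simps)
    have "((\<lambda>v. cis (v * b j)) has_integral integral {0..1} (\<lambda>v. cis (v * b j))) {0..1}"
      by (intro integrable_integral integrable_continuous_real ci)
    from has_integral_Re[OF this]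
    have re: "((\<lambda>v. cos (v * b j)) has_integral Re (integral {0..1} (\<lambda>v. cis (v * b j)))) {0..1}"
      by simp
    have "1/2 \<le> Re (integral {0..1} (\<lambda>v. cis (v * b j)))"
    proof (rule has_integral_le[OF _ re])
      show "((\<lambda>_. 1/2 :: real) has_integral 1/2) {0..1::real}"
        using has_integral_const_real[of "1/2::real" 0 1] by simp
      show "1/2 \<le> cos (v * b j)" if "v \<in> {0..1}" for v
        using that bj mult_mono[of v 1 "b j" 1] by (intro cos_ge_half) auto
    qed
    then have "1/2 \<le> cmod (integral {0..1} (\<lambda>v. cis (v * b j)))"
      using complex_Re_le_cmod order_trans by blast
    then have "(1/2)\<^sup>2 \<le> K j" unfolding K_def by (intro power_mono) auto
    then show ?thesis by (simp add: power2_eq_square)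
  qed
  define g where "g v v' = (\<Sum>j<N. cis ((v - v') * b j))" for v v'
  have gc: "continuous_on A (g v)" for A v unfolding g_def by (intro continuous_intros)
  have "of_real (K j) = integral {0..1} (\<lambda>v. integral {0..1} (\<lambda>v'. cis ((v - v') * b j)))" for j
    unfolding K_def cmod_integral_square[OF ci] cis_cnj cis_mult by (simp add: left_diff_distrib)
  then have "of_real (\<Sum>j<N. K j) = (\<Sum>j<N. integral {0..1} (\<lambda>v. integral {0..1} (\<lambda>v'. cis ((v - v') * b j))))"
    by simp
  also have "\<dots> = integral {0..1} (\<lambda>v. \<Sum>j<N. integral {0..1} (\<lambda>v'. cis ((v - v') * b j)))"
  proof (rule integral_sum[symmetric])
    fix j
    have "integral {0..1} (\<lambda>v'. cis ((v - v') * b j)) = cis (v * b j) * integral {0..1} (\<lambda>v'. cis (- (v' * b j)))" for v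
    proof -
      have "((\<lambda>v'. cis (- (v' * b j))) has_integral integral {0..1} (\<lambda>v'. cis (- (v' * b j)))) {0..1}"
        by (intro integrable_integral integrable_continuous_real continuous_intros)
      from integral_unique[OF has_integral_mult_right[OF this, of "cis (v * b j)"]]
      show ?thesis by (simp add: cis_mult left_diff_distrib)
    qed
    then show "(\<lambda>v. integral {0..1} (\<lambda>v'. cis ((v - v') * b j))) integrable_on {0..1}"
      by (auto intro!: integrable_continuous_real continuous_intros)
  qed simp
  also have "\<dots> = integral {0..1} (\<lambda>v. integral {0..1} (g v))"
    unfolding g_def
    by (subst integral_sum) (auto intro!: integrable_continuous_real continuous_intros)
  finally have sumK: "of_real (\<Sum>j<N. K j) = integral {0..1} (\<lambda>v. integral {0..1} (g v))" .
  have "cmod (integral {0..1} (\<lambda>v. integral {0..1} (g v))) \<le> 2 * (t0 * w) * real N + D * real N"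
  proof (rule double_integral_bound)
    show "cmod (g v v') \<le> real N" for v v'
      unfolding g_def by (rule order_trans[OF norm_sum]) simp
    \<comment> \<open>The pair \<open>v\<close>, \<open>v'\<close> probes the frequency
      \<open>(v - v') / w\<close>, never above \<open>1 / w\<close>; frequencies below
      \<open>t0\<close> occur only in the diagonal strip of half-width
      \<open>t0 * w\<close>.\<close>
    show "cmod (g v v') \<le> D * real N" if v: "v \<in> {0..1}" "v' \<in> {0..1}" "t0 * w \<le> \<bar>v - v'\<bar>" for v v'
    proof -
      define t where "t = (v - v') / w"
      have "g v v' = cis (- t * a) * (\<Sum>j<N. cis (t * y j))"
        unfolding g_def sum_distrib_left cis_mult
        by (intro sum.cong refl arg_cong[of _ _ cis]) (simp add: t_def b_def diff_divide_distrib right_diff_distrib left_diff_distrib)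
      then have "cmod (g v v') = cmod (\<Sum>j<N. cis (t * y j))" by (simp add: norm_mult)
      also have "\<dots> \<le> D * real N"
        using v \<open>0 < w\<close> by (intro D) (auto simp: t_def abs_divide field_simps abs_le_iff)
      finally show ?thesis .
    qed
  qed (use assms gc in auto)
  moreover have "(\<Sum>j<N. K j) = cmod (of_real (\<Sum>j<N. K j))"
    by (simp only: norm_of_real) (simp add: K_def sum_nonneg)
  ultimately have "(\<Sum>j<N. K j) \<le> 2 * (t0 * w) * real N + D * real N" unfolding sumK by simp
  moreover have "(\<Sum>j\<in>?J. 1/4) \<le> (\<Sum>j\<in>?J. K j)" using K by (intro sum_mono)
  moreover have "(\<Sum>j\<in>?J. K j) \<le> (\<Sum>j<N. K j)" by (intro sum_mono2) (auto simp: K_def)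
  ultimately show ?thesis by (simp add: algebra_simps)
qed

lemma cis_exp_integral:
  assumes "\<alpha> \<le> \<beta>" "c \<noteq> 0"
  shows "cmod (integral {\<alpha>..\<beta>} (\<lambda>z. cis (c * exp z))) \<le> (2 + (\<beta> - \<alpha>)) * exp (- \<alpha>) / \<bar>c\<bar>"
proof -
  define e where "e = exp (- \<alpha>) / \<bar>c\<bar>"
  have "cmod (integral {\<alpha>..\<beta>} (\<lambda>z. cis (c * exp z)))
     \<le> \<bar>exp (- \<alpha>) / c\<bar> + \<bar>exp (- \<beta>) / c\<bar> + e * (\<beta> - \<alpha>)"
    unfolding e_def
  proof (rule oscillatory_bound[OF assms(1)])
    show "((\<lambda>z. c * exp z) has_real_derivative c * exp z) (at z)" for z
      by (auto intro!: derivative_eq_intros)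
    show "((\<lambda>z. exp (- z) / c) has_real_derivative - exp (- z) / c) (at z)" for z
      using assms(2) by (auto intro!: derivative_eq_intros)
    show "exp (- z) / c * (c * exp z) = 1" for z
      using assms(2) by (simp flip: exp_add)
    show "\<bar>- exp (- z) / c\<bar> \<le> exp (- \<alpha>) / \<bar>c\<bar>" if "z \<in> {\<alpha>..\<beta>}" for z
      using that by (auto simp: abs_divide intro!: divide_right_mono)
  qed
  also have "\<bar>exp (- \<beta>) / c\<bar> \<le> e"
    using assms(1) by (auto simp: e_def abs_divide intro!: divide_right_mono)
  also have "\<bar>exp (- \<alpha>) / c\<bar> = e" by (simp add: e_def abs_divide)
  also have "e + e + e * (\<beta> - \<alpha>) = (2 + (\<beta> - \<alpha>)) * e" by (simp add: algebra_simps)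
  finally show ?thesis by (simp add: e_def)
qed

text \<open>Expanding the square and integrating over \<open>z\<close> first leaves an oscillatory
  integral with phase \<open>\<xi> * (d v - d v') * exp z\<close>, which has no stationary point.
  Separation of \<open>d v\<close> and \<open>d v'\<close> makes it small off the diagonal, and near
  the diagonal it is at most the length of the interval.\<close>

lemma mean_square_exp:
  fixes d :: "real \<Rightarrow> real"
  assumes d: "continuous_on {0..1} d" and "\<alpha> \<le> \<beta>" "0 \<le> \<rho>" "0 < \<kappa>"
    and sep: "\<And>v v'. v \<in> {0..1} \<Longrightarrow> v' \<in> {0..1} \<Longrightarrow> \<rho> \<le> \<bar>v - v'\<bar> \<Longrightarrow> \<kappa> \<le> \<bar>\<xi> * (d v - d v')\<bar>"
  shows "integral {\<alpha>..\<beta>} (\<lambda>z. (cmod (integral {0..1} (\<lambda>v. cis (\<xi> * exp z * d v))))\<^sup>2)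
     \<le> 2 * \<rho> * (\<beta> - \<alpha>) + (2 + (\<beta> - \<alpha>)) * exp (- \<alpha>) / \<kappa>"
proof -
  define A where "A z = integral {0..1} (\<lambda>v. cis (\<xi> * exp z * d v))" for z
  define B where "B z v = integral {0..1} (\<lambda>v'. cis (\<xi> * (d v - d v') * exp z))" for z v
  define g where "g v v' = integral {\<alpha>..\<beta>} (\<lambda>z. cis (\<xi> * (d v - d v') * exp z))" for v v'
  have dc: "continuous_on {0..1} (\<lambda>v. cis (\<xi> * exp z * d v))" for z
    by (intro continuous_intros d)
  have d2: "continuous_on ({\<alpha>..\<beta>} \<times> {0..1}) (\<lambda>p. d (snd p))"
    by (rule continuous_on_compose2[OF d]) (auto intro: continuous_intros)
  have "continuous_on {\<alpha>..\<beta>} (\<lambda>z. integral (cbox 0 1) (\<lambda>v. cis (\<xi> * exp z * d v)))"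
    by (rule integral_continuous_on_param)
      (auto simp: case_prod_unfold intro!: continuous_intros d2)
  then have Ac: "continuous_on {\<alpha>..\<beta>} A" by (simp add: A_def)
  have Bv: "B z v = cis (\<xi> * exp z * d v) * cnj (A z)" for z v
  proof -
    have "((\<lambda>v'. cis (\<xi> * exp z * d v')) has_integral A z) {0..1}"
      unfolding A_def by (intro integrable_integral integrable_continuous_real dc)
    then have "((\<lambda>v'. cnj (cis (\<xi> * exp z * d v'))) has_integral cnj (A z)) {0..1}"
      using has_integral_cnj[of "\<lambda>v'. cis (\<xi> * exp z * d v')" "A z" "{0..1}"] by (simp add: comp_def)
    from integral_unique[OF has_integral_mult_right[OF this, of "cis (\<xi> * exp z * d v)"]]
    show ?thesis by (simp add: B_def cis_cnj cis_mult algebra_simps)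
  qed
  have sq: "of_real ((cmod (A z))\<^sup>2) = integral {0..1} (B z)" for z
    unfolding A_def cmod_integral_square[OF dc] B_def[abs_def] cis_cnj cis_mult
    by (simp add: algebra_simps)
  have A2i: "(\<lambda>z. (cmod (A z))\<^sup>2) integrable_on {\<alpha>..\<beta>}"
    by (intro integrable_continuous_real continuous_intros Ac)
  have "of_real (integral {\<alpha>..\<beta>} (\<lambda>z. (cmod (A z))\<^sup>2)) = integral {\<alpha>..\<beta>} (\<lambda>z. complex_of_real ((cmod (A z))\<^sup>2))"
    using has_integral_of_real[OF integrable_integral[OF A2i]]
    by (rule integral_unique[symmetric])
  also have "\<dots> = integral (cbox \<alpha> \<beta>) (\<lambda>z. integral (cbox 0 1) (B z))"
    unfolding sq by simp
  also have "\<dots> = integral (cbox 0 1) (\<lambda>v. integral (cbox \<alpha> \<beta>) (\<lambda>z. B z v))"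
  proof (rule integral_swap_continuous)
    have "continuous_on ({\<alpha>..\<beta>} \<times> {0..1}) (\<lambda>p. A (fst p))"
      by (rule continuous_on_compose2[OF Ac]) (auto intro: continuous_intros)
    then show "continuous_on (cbox (\<alpha>, 0) (\<beta>, 1)) (\<lambda>(z, v). B z v)"
      unfolding Bv case_prod_unfold cbox_Pair_eq
      by (auto intro!: continuous_intros d2)
  qed
  also have "\<dots> = integral {0..1} (\<lambda>v. integral {0..1} (g v))"
  proof -
    have "integral (cbox \<alpha> \<beta>) (\<lambda>z. B z v) = integral (cbox 0 1) (\<lambda>v'. integral (cbox \<alpha> \<beta>) (\<lambda>z. cis (\<xi> * (d v - d v') * exp z)))" for v
      unfolding B_def box_real(2)[symmetric]
      by (rule integral_swap_continuous)
        (auto simp: case_prod_unfold cbox_Pair_eq intro!: continuous_intros d2)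
    then show ?thesis unfolding box_real(2) g_def by simp
  qed
  finally have eq: "complex_of_real (integral {\<alpha>..\<beta>} (\<lambda>z. (cmod (A z))\<^sup>2)) = integral {0..1} (\<lambda>v. integral {0..1} (g v))" .
  have "cmod (integral {0..1} (\<lambda>v. integral {0..1} (g v))) \<le> 2 * \<rho> * (\<beta> - \<alpha>) + (2 + (\<beta> - \<alpha>)) * exp (- \<alpha>) / \<kappa>"
  proof (rule double_integral_bound)
    show "continuous_on {0..1} (g v)" if "v \<in> {0..1}" for v
    proof -
      have "continuous_on ({0..1} \<times> {\<alpha>..\<beta>}) (\<lambda>p. d (fst p))"
        by (rule continuous_on_compose2[OF d]) (auto intro: continuous_intros)
      then have "continuous_on {0..1} (\<lambda>v'. integral (cbox \<alpha> \<beta>) (\<lambda>z. cis (\<xi> * (d v - d v') * exp z)))"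
        by (intro integral_continuous_on_param) (auto simp: case_prod_unfold intro!: continuous_intros)
      then show ?thesis by (simp add: g_def[abs_def])
    qed
    show "cmod (g v v') \<le> \<beta> - \<alpha>" for v v'
    proof -
      have "cmod (g v v') \<le> 1 * (\<beta> - \<alpha>)"
        unfolding g_def by (rule integral_bound) (use assms(2) in \<open>auto intro!: continuous_intros\<close>)
      then show ?thesis by simp
    qed
    show "cmod (g v v') \<le> (2 + (\<beta> - \<alpha>)) * exp (- \<alpha>) / \<kappa>"
      if "v \<in> {0..1}" "v' \<in> {0..1}" "\<rho> \<le> \<bar>v - v'\<bar>" for v v'
    proof -
      have k: "\<kappa> \<le> \<bar>\<xi> * (d v - d v')\<bar>" by (rule sep[OF that])
      then have "\<xi> * (d v - d v') \<noteq> 0" using \<open>0 < \<kappa>\<close> by auto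
      from cis_exp_integral[OF assms(2) this]
      have "cmod (g v v') \<le> (2 + (\<beta> - \<alpha>)) * exp (- \<alpha>) / \<bar>\<xi> * (d v - d v')\<bar>" by (simp add: g_def)
      also have "\<dots> \<le> (2 + (\<beta> - \<alpha>)) * exp (- \<alpha>) / \<kappa>"
        using k \<open>0 < \<kappa>\<close> assms(2) by (intro divide_left_mono mult_pos_pos) auto
      finally show ?thesis .
    qed
  qed (use assms in auto)
  moreover have "integral {\<alpha>..\<beta>} (\<lambda>z. (cmod (A z))\<^sup>2) \<le> cmod (complex_of_real (integral {\<alpha>..\<beta>} (\<lambda>z. (cmod (A z))\<^sup>2)))"
    by (simp only: norm_of_real abs_ge_self)
  ultimately show ?thesis unfolding eq unfolding A_def by linarith
qed

context doubling_lift_C2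
begin

section \<open>Large deviations\<close>

lemma exp_quadratic:
  assumes "\<bar>y\<bar> \<le> (1::real)"
  shows "exp y \<le> 1 + y + y\<^sup>2"
proof (cases "0 \<le> y")
  case True
  then show ?thesis using exp_bound[of y] assms by simp
next
  case False
  have "1 - y \<le> exp (- y)" using exp_ge_add_one_self[of "- y"] by simp
  then have "1 \<le> (1 - y) * (1 + y + y\<^sup>2) \<Longrightarrow> 1 \<le> exp (- y) * (1 + y + y\<^sup>2)"
    using mult_right_mono[of "1 - y" "exp (- y)" "1 + y + y\<^sup>2"] assms by (auto simp: abs_le_iff)
  moreover have "(1 - y) * (1 + y + y\<^sup>2) = 1 + (- y) * y\<^sup>2"
    by (simp add: algebra_simps power2_eq_square)
  moreover have "0 \<le> (- y) * y\<^sup>2" using False by (intro mult_nonneg_nonneg) auto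
  ultimately have "1 \<le> exp (- y) * (1 + y + y\<^sup>2)" by linarith
  then show ?thesis by (simp add: exp_minus field_simps)
qed

lemma S_range: "- real q \<le> S q y" "S q y \<le> 0"
proof -
  have "(21/10::real) \<le> exp 1" using exp_lower_Taylor_quadratic[of "1::real"] by simp
  then have "exp (- 1 :: real) \<le> 10/21" by (simp add: exp_minus field_simps)
  then have "exp (- 1 :: real)^q \<le> (10/21)^q" by (intro power_mono) auto
  moreover have "exp (- 1 :: real)^q = exp (- real q)" by (simp flip: exp_of_nat_mult)
  ultimately have "exp (- real q) \<le> exp (S q y)"
    using exp_S_bounds(1)[of q y] by linarith
  then show "- real q \<le> S q y" by simp
  have "exp (S q y) \<le> 1" by (rule order_trans[OF exp_S_bounds(2) power_le_one]) auto
  then show "S q y \<le> 0" by simp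
qed

text \<open>The sum over all branches has period 1 in \<open>x\<close>, so \<open>x\<close> may be
  taken in the unit interval, where \<open>S q\<close> varies by at most 1. The mean over one block
  thus depends on the base point only up to 1, whatever \<open>q\<close> is.\<close>

lemma S_mean_dist: "\<bar>(\<Sum>j<2^q. S q (x + real j)) - (\<Sum>j<2^q. S q (real j))\<bar> \<le> 2^q"
proof -
  define T where "T x = (\<Sum>j<2^q. S q (x + real j))" for x
  have T1: "T (x + 1) = T x" for x
  proof -
    have "T x + S q (x + 2^q * real 1) = (\<Sum>j<Suc (2^q). S q (x + real j))" by (simp add: T_def)
    also have "\<dots> = S q x + T (x + 1)"
      by (subst sum.lessThan_Suc_shift) (simp add: T_def algebra_simps)
    finally show ?thesis by (simp only: S_add_nat)
  qed
  have Tn: "T (x + real n) = T x" for x n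
    by (induction n) (use T1 in \<open>simp_all add: add.assoc[symmetric] add.commute[of 1]\<close>)
  have "T x = T (frac x)"
  proof (cases "\<lfloor>x\<rfloor> \<ge> 0")
    case True
    then show ?thesis using Tn[of "frac x" "nat \<lfloor>x\<rfloor>"] by (simp add: frac_def)
  next
    case False
    then show ?thesis using Tn[of x "nat (- \<lfloor>x\<rfloor>)"] by (simp add: frac_def)
  qed
  moreover have "\<bar>T (frac x) - T 0\<bar> \<le> (\<Sum>j<2^q. \<bar>S q (frac x + real j) - S q (0 + real j)\<bar>)"
    unfolding T_def sum_subtractf[symmetric] by (rule sum_abs)
  moreover have "\<dots> \<le> (\<Sum>j<2^q::nat. 1)"
  proof (rule sum_mono)
    fix j show "\<bar>S q (frac x + real j) - S q (0 + real j)\<bar> \<le> 1"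
      using S_lipschitz[of q "frac x + real j" "0 + real j"] frac_lt_1[of x] frac_ge_0[of x] by simp
  qed
  ultimately show ?thesis by (simp add: T_def)
qed

text \<open>An exponential moment computed block by block. Given the earlier blocks, a block of
  length \<open>q\<close> has mean \<open>a\<close> up to 1 by \<open>S_mean_dist\<close>, costing
  |z|, and fluctuations at most \<open>q\<close>, costing z^2 q^2. Uniformity in \<open>x\<close>
  lets the induction restart at the image of the first block.\<close>

lemma S_moment:
  assumes z: "\<bar>z\<bar> * real q \<le> 1"
  defines "a \<equiv> (\<Sum>j<2^q. S q (real j)) / 2^q"
  shows "(\<Sum>j<2^(q * p). exp (z * (S (q * p) (x + real j) - a * real p)))
    \<le> 2^(q * p) * exp (\<bar>z\<bar> + z\<^sup>2 * (real q)\<^sup>2)^p"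
proof (induction p arbitrary: x)
  case 0
  then show ?case by simp
next
  case (Suc p)
  let ?K = "\<bar>z\<bar> + z\<^sup>2 * (real q)\<^sup>2"
  let ?f = "\<lambda>y. exp (z * (S (q * p + q) y - a * real (Suc p)))"
  have "- real q * 2^q \<le> (\<Sum>j<2^q. S q (real j))"
    using sum_mono[of "{..<2^q}" "\<lambda>_. - real q" "\<lambda>j. S q (real j)"] S_range(1) by (simp add: mult.commute)
  then have a1: "- real q \<le> a" by (simp add: a_def pos_le_divide_eq)
  have a2: "a \<le> 0" unfolding a_def by (intro divide_nonpos_pos sum_nonpos S_range(2)) auto
  have block: "(\<Sum>j<2^q. exp (z * (S q (x + real j) - a))) \<le> 2^q * exp ?K"
  proof -
    have le: "exp (z * (S q (x + real j) - a)) \<le> 1 + z * (S q (x + real j) - a) + z\<^sup>2 * (real q)\<^sup>2" for j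
    proof -
      have d: "\<bar>S q (x + real j) - a\<bar> \<le> real q"
        using S_range[of q "x + real j"] a1 a2 by linarith
      then have "\<bar>z\<bar> * \<bar>S q (x + real j) - a\<bar> \<le> \<bar>z\<bar> * real q" by (intro mult_left_mono) auto
      then have "exp (z * (S q (x + real j) - a)) \<le> 1 + z * (S q (x + real j) - a) + (z * (S q (x + real j) - a))\<^sup>2"
        using z by (intro exp_quadratic) (simp add: abs_mult)
      moreover have "\<bar>S q (x + real j) - a\<bar>\<^sup>2 \<le> (real q)\<^sup>2" using d by (intro power_mono) auto
      then have "(z * (S q (x + real j) - a))\<^sup>2 \<le> z\<^sup>2 * (real q)\<^sup>2"
        by (simp add: power_mult_distrib mult_left_mono)
      ultimately show ?thesis by linarith
    qed
    have "(\<Sum>j<2^q. exp (z * (S q (x + real j) - a))) \<le> (\<Sum>j<2^q. (1 - z * a + z\<^sup>2 * (real q)\<^sup>2) + z * S q (x + real j))"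
      by (rule sum_mono) (use le in \<open>simp add: algebra_simps\<close>)
    also have "\<dots> = 2^q * (1 + z\<^sup>2 * (real q)\<^sup>2) + z * ((\<Sum>j<2^q. S q (x + real j)) - 2^q * a)"
      unfolding sum.distrib sum_distrib_left[symmetric] by (simp add: algebra_simps)
    also have "2^q * a = (\<Sum>j<2^q. S q (real j))" by (simp add: a_def)
    also have "z * ((\<Sum>j<2^q. S q (x + real j)) - (\<Sum>j<2^q. S q (real j))) \<le> \<bar>z\<bar> * 2^q"
      using mult_left_mono[OF S_mean_dist[of q x], of "\<bar>z\<bar>"] unfolding abs_mult[symmetric]
      by linarith
    finally have "(\<Sum>j<2^q. exp (z * (S q (x + real j) - a))) \<le> 2^q * (1 + ?K)"
      by (simp add: algebra_simps)
    also have "\<dots> \<le> 2^q * exp ?K" by (intro mult_left_mono exp_ge_add_one_self) auto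
    finally show ?thesis .
  qed
  have fac: "?f (x + real j + 2^q * real i)
      = exp (z * (S q (x + real j) - a)) * exp (z * (S (q * p) (br q (x + real j) + real i) - a * real p))" for i j
    unfolding exp_add[symmetric] S_add br_add_nat S_add_nat by (simp add: algebra_simps)
  have "(\<Sum>l<2^(q * p + q). ?f (x + real l))
      = (\<Sum>j<2^q. exp (z * (S q (x + real j) - a)) * (\<Sum>i<2^(q * p). exp (z * (S (q * p) (br q (x + real j) + real i) - a * real p))))"
    unfolding sum_split_blocks[where f = ?f] fac sum_distrib_left ..
  also have "\<dots> \<le> (\<Sum>j<2^q. exp (z * (S q (x + real j) - a)) * (2^(q * p) * exp ?K^p))"
    by (intro sum_mono mult_left_mono Suc.IH) auto
  also have "\<dots> = (\<Sum>j<2^q. exp (z * (S q (x + real j) - a))) * (2^(q * p) * exp ?K^p)"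
    by (rule sum_distrib_right[symmetric])
  also have "\<dots> \<le> (2^q * exp ?K) * (2^(q * p) * exp ?K^p)"
    by (intro mult_right_mono block) auto
  finally show ?case by (simp add: power_add mult_ac add.commute)
qed

lemma S_large_deviation:
  assumes \<eta>: "0 < \<eta>" "\<eta> \<le> 1" and q: "4 / \<eta> \<le> real q"
  defines "a \<equiv> (\<Sum>j<2^q. S q (real j)) / 2^q"
  shows "real (card {j \<in> {..<2^(q * p)}. \<eta> * real (q * p) < \<bar>S (q * p) (x + real j) - a * real p\<bar>})
    \<le> 2 * 2^(q * p) * exp (- \<eta>\<^sup>2 / 8)^p"
proof -
  have "0 < 4 / \<eta>" using \<eta> by simp
  then have q0: "real q > 0" using q by linarith
  have one: "real (card {j \<in> {..<2^(q * p)}. \<eta> * real (q * p) < \<sigma> * (S (q * p) (x + real j) - a * real p)})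
    \<le> 2^(q * p) * exp (- \<eta>\<^sup>2 / 8)^p" if \<sigma>: "\<sigma> = 1 \<or> \<sigma> = -1" for \<sigma> :: real
  proof -
    let ?J = "{j \<in> {..<2^(q * p)}. \<eta> * real (q * p) < \<sigma> * (S (q * p) (x + real j) - a * real p)}"
    \<comment> \<open>The Chebyshev exponent per block gains z \<eta> q = \<eta>^2/4. It loses |z|
      <= \<eta>^2/16, by the lower bound on \<open>q\<close>, and z^2 q^2 = \<eta>^2/16, which
      leaves \<eta>^2/8.\<close>
    define z where "z = \<eta> / (4 * real q)"
    have zq: "z * real q = \<eta> / 4" using q0 by (simp add: z_def)
    have z0: "z > 0" using \<eta> q0 by (simp add: z_def)
    have abs: "\<bar>\<sigma> * z\<bar> = z" "(\<sigma> * z)\<^sup>2 = z\<^sup>2" using \<sigma> z0 by auto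
    have "z \<le> \<eta>\<^sup>2 / 16"
      using q \<eta> q0 by (simp add: z_def field_simps power2_eq_square)
    then have K: "\<bar>\<sigma> * z\<bar> + (\<sigma> * z)\<^sup>2 * (real q)\<^sup>2 \<le> \<eta>\<^sup>2 / 8"
      unfolding abs power_mult_distrib[symmetric] zq by (simp add: power2_eq_square)
    have "exp (z * \<eta> * real (q * p)) \<le> exp (\<sigma> * z * (S (q * p) (x + real j) - a * real p))" if "j \<in> ?J" for j
      using that z0 mult_left_mono[of "\<eta> * real (q * p)" "\<sigma> * (S (q * p) (x + real j) - a * real p)" z]
      by (simp add: mult_ac)
    then have "(\<Sum>j\<in>?J. exp (z * \<eta> * real (q * p))) \<le> (\<Sum>j\<in>?J. exp (\<sigma> * z * (S (q * p) (x + real j) - a * real p)))"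
      by (intro sum_mono)
    also have "\<dots> \<le> (\<Sum>j<2^(q * p). exp (\<sigma> * z * (S (q * p) (x + real j) - a * real p)))"
      by (intro sum_mono2) auto
    also have "\<dots> \<le> 2^(q * p) * exp (\<bar>\<sigma> * z\<bar> + (\<sigma> * z)\<^sup>2 * (real q)\<^sup>2)^p"
      unfolding a_def by (rule S_moment) (use zq abs \<eta> in simp)
    also have "\<dots> \<le> 2^(q * p) * exp (\<eta>\<^sup>2 / 8)^p"
      using K by (intro mult_left_mono power_mono) auto
    finally have "real (card ?J) * exp (z * \<eta> * real (q * p)) \<le> 2^(q * p) * exp (\<eta>\<^sup>2 / 8)^p"
      by simp
    moreover have "z * \<eta> * real (q * p) = real p * ((z * real q) * \<eta>)" by simp
    then have "z * \<eta> * real (q * p) = real p * (\<eta>\<^sup>2 / 4)"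
      unfolding zq by (simp add: power2_eq_square)
    then have "exp (z * \<eta> * real (q * p)) = exp (\<eta>\<^sup>2 / 4)^p"
      by (simp only: exp_of_nat_mult)
    ultimately have "real (card ?J) * exp (\<eta>\<^sup>2 / 4)^p \<le> 2^(q * p) * exp (\<eta>\<^sup>2 / 8)^p"
      by (simp only:)
    then have "real (card ?J) * exp (\<eta>\<^sup>2 / 4)^p * exp (- \<eta>\<^sup>2 / 4)^p \<le> 2^(q * p) * exp (\<eta>\<^sup>2 / 8)^p * exp (- \<eta>\<^sup>2 / 4)^p"
      by (intro mult_right_mono) auto
    then show ?thesis
      by (simp add: mult.assoc flip: power_mult_distrib exp_add)
  qed
  have abs_split: "c < \<bar>X\<bar> \<longleftrightarrow> c < 1 * X \<or> c < -1 * X" for c X :: real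
    by (auto simp: abs_if)
  define J where "J \<sigma> = {j \<in> {..<2^(q * p)}. \<eta> * real (q * p) < \<sigma> * (S (q * p) (x + real j) - a * real p)}" for \<sigma>
  have "{j \<in> {..<2^(q * p)}. \<eta> * real (q * p) < \<bar>S (q * p) (x + real j) - a * real p\<bar>} = J 1 \<union> J (-1)"
    unfolding abs_split J_def by blast
  then have "card {j \<in> {..<2^(q * p)}. \<eta> * real (q * p) < \<bar>S (q * p) (x + real j) - a * real p\<bar>} \<le> card (J 1) + card (J (-1))"
    by (simp only: card_Un_le)
  moreover have "real (card (J 1)) \<le> 2^(q * p) * exp (- \<eta>\<^sup>2 / 8)^p" "real (card (J (-1))) \<le> 2^(q * p) * exp (- \<eta>\<^sup>2 / 8)^p"
    unfolding J_def by (rule one; simp)+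
  ultimately show ?thesis by linarith
qed

end

section \<open>Fourier decay\<close>

lemma psi_lipschitz:
  fixes d :: "real \<Rightarrow> real"
  assumes d: "continuous_on {0..1} d" "\<And>s. s \<in> {0..1} \<Longrightarrow> \<bar>d s\<bar> \<le> \<delta>"
  shows "(cmod (integral {0..1} (\<lambda>s. cis (y * d s))))\<^sup>2
    \<le> (cmod (integral {0..1} (\<lambda>s. cis (y' * d s))))\<^sup>2 + 2 * \<bar>y - y'\<bar> * \<delta>"
proof -
  let ?I = "\<lambda>y. integral {0..1} (\<lambda>s. cis (y * d s))"
  have int: "(\<lambda>s. cis (y * d s)) integrable_on {0..1}" for y
    by (intro integrable_continuous_real continuous_intros d)
  have "0 \<le> \<delta>" using d(2)[of 0] by auto
  have I1: "cmod (?I y) \<le> 1" for y by (rule norm_integral_bound_unit) auto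
  have "?I y - ?I y' = integral {0..1} (\<lambda>s. cis (y * d s) - cis (y' * d s))"
    by (intro Henstock_Kurzweil_Integration.integral_diff[symmetric] int)
  also have "cmod \<dots> \<le> \<bar>y - y'\<bar> * \<delta>"
  proof (rule norm_integral_bound_unit)
    fix s :: real assume s: "s \<in> {0..1}"
    have "cmod (cis (y * d s) - cis (y' * d s)) \<le> \<bar>y - y'\<bar> * \<bar>d s\<bar>"
      using cmod_cis_diff_le[of "y * d s" "y' * d s"] by (simp add: abs_mult flip: left_diff_distrib)
    also have "\<dots> \<le> \<bar>y - y'\<bar> * \<delta>" using d(2)[OF s] by (intro mult_left_mono) auto
    finally show "cmod (cis (y * d s) - cis (y' * d s)) \<le> \<bar>y - y'\<bar> * \<delta>" .
  qed (use \<open>0 \<le> \<delta>\<close> in simp)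
  finally have diff: "cmod (?I y) - cmod (?I y') \<le> \<bar>y - y'\<bar> * \<delta>"
    using norm_triangle_ineq2[of "?I y" "?I y'"] by linarith
  have "(cmod (?I y))\<^sup>2 - (cmod (?I y'))\<^sup>2 = (cmod (?I y) + cmod (?I y')) * (cmod (?I y) - cmod (?I y'))"
    by (simp add: power2_eq_square algebra_simps)
  also have "\<dots> \<le> (cmod (?I y) + cmod (?I y')) * (\<bar>y - y'\<bar> * \<delta>)"
    using diff by (intro mult_left_mono) auto
  also have "\<dots> \<le> 2 * (\<bar>y - y'\<bar> * \<delta>)"
    using I1[of y] I1[of y'] \<open>0 \<le> \<delta>\<close> by (intro mult_right_mono) auto
  finally show ?thesis by simp
qed

lemma sum_le_sqrt_sum_squares:
  fixes f :: "'a \<Rightarrow> real"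
  assumes "card G \<le> N" "\<And>j. 0 \<le> f j"
  shows "(\<Sum>j\<in>G. f j) \<le> sqrt (real N * (\<Sum>j\<in>G. (f j)\<^sup>2))"
proof (rule real_le_rsqrt)
  have "(\<Sum>j\<in>G. f j)\<^sup>2 \<le> (\<Sum>j\<in>G. (f j)\<^sup>2) * real (card G)"
    by (rule sum_squared_le_sum_of_squares)
  also have "\<dots> \<le> (\<Sum>j\<in>G. (f j)\<^sup>2) * real N"
    using assms(1) by (intro mult_left_mono sum_nonneg) auto
  finally show "(\<Sum>j\<in>G. f j)\<^sup>2 \<le> real N * (\<Sum>j\<in>G. (f j)\<^sup>2)" by (simp add: mult.commute)
qed

text \<open>Each \<open>h j\<close> is compared with the mean of \<open>f\<close> over the window of
  length \<open>w\<close> starting at \<open>y j\<close>; no point lies in more than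
  \<open>R\<close> of these windows.\<close>

lemma sum_le_integral_density:
  fixes y :: "nat \<Rightarrow> real" and f :: "real \<Rightarrow> real"
  assumes f: "continuous_on {z1..z2} f" "\<And>z. 0 \<le> f z" and "finite G" "0 < w"
    and y: "\<And>j. j \<in> G \<Longrightarrow> z1 \<le> y j \<and> y j + w \<le> z2"
    and dens: "\<And>z. real (card {j \<in> G. y j \<le> z \<and> z \<le> y j + w}) \<le> R"
    and near: "\<And>j z. j \<in> G \<Longrightarrow> y j \<le> z \<Longrightarrow> z \<le> y j + w \<Longrightarrow> h j \<le> f z + E"
  shows "w * (\<Sum>j\<in>G. h j) \<le> R * integral {z1..z2} f + w * (real (card G) * E)"
proof -
  have one: "w * h j \<le> integral {z1..z2} (\<lambda>z. if z \<in> {y j..y j + w} then f z else 0) + w * E" if j: "j \<in> G" for j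
  proof -
    have sub: "{z1..z2} \<inter> {y j..y j + w} = {y j..y j + w}" "{y j..y j + w} \<inter> {z1..z2} = {y j..y j + w}"
      using y[OF j] by auto
    have fj: "f integrable_on {y j..y j + w}"
      using y[OF j] by (intro integrable_continuous_real continuous_on_subset[OF f(1)]) auto
    have "integral {y j..y j + w} (\<lambda>z. h j - E) \<le> integral {y j..y j + w} f"
      by (rule integral_le[OF integrable_const_ivl fj]) (use near[OF j] in \<open>force simp: algebra_simps\<close>)
    moreover have "integral {y j..y j + w} (\<lambda>z. h j - E) = w * (h j - E)" using \<open>0 < w\<close> by simp
    moreover have "integral {z1..z2} (\<lambda>z. if z \<in> {y j..y j + w} then f z else 0) = integral {y j..y j + w} f"
      unfolding integral_restrict_Int sub ..
    ultimately show ?thesis by (simp add: right_diff_distrib)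
  qed
  have int: "(\<lambda>z. if z \<in> {y j..y j + w} then f z else 0) integrable_on {z1..z2}" if j: "j \<in> G" for j
  proof -
    have sub: "{z1..z2} \<inter> {y j..y j + w} = {y j..y j + w}" "{y j..y j + w} \<inter> {z1..z2} = {y j..y j + w}"
      using y[OF j] by auto
    show ?thesis
      unfolding integrable_restrict_Int sub
      using y[OF j] by (intro integrable_continuous_real continuous_on_subset[OF f(1)]) auto
  qed
  have "w * (\<Sum>j\<in>G. h j) \<le> (\<Sum>j\<in>G. integral {z1..z2} (\<lambda>z. if z \<in> {y j..y j + w} then f z else 0) + w * E)"
    unfolding sum_distrib_left by (rule sum_mono) (rule one)
  also have "\<dots> = integral {z1..z2} (\<lambda>z. \<Sum>j\<in>G. if z \<in> {y j..y j + w} then f z else 0) + w * (real (card G) * E)"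
    using int \<open>finite G\<close> by (simp add: sum.distrib integral_sum)
  also have "integral {z1..z2} (\<lambda>z. \<Sum>j\<in>G. if z \<in> {y j..y j + w} then f z else 0) \<le> integral {z1..z2} (\<lambda>z. R * f z)"
  proof (rule integral_le)
    show "(\<lambda>z. \<Sum>j\<in>G. if z \<in> {y j..y j + w} then f z else 0) integrable_on {z1..z2}"
      by (intro integrable_sum int \<open>finite G\<close>)
    show "(\<lambda>z. R * f z) integrable_on {z1..z2}"
      by (intro integrable_continuous_real continuous_intros f)
    fix z
    have "(\<Sum>j\<in>G. if z \<in> {y j..y j + w} then f z else 0) = real (card {j \<in> G. y j \<le> z \<and> z \<le> y j + w}) * f z"
      using \<open>finite G\<close> by (simp add: sum.If_cases Int_def)
    also have "\<dots> \<le> R * f z" by (intro mult_right_mono dens f)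
    finally show "(\<Sum>j\<in>G. if z \<in> {y j..y j + w} then f z else 0) \<le> R * f z" .
  qed
  also have "integral {z1..z2} (\<lambda>z. R * f z) = R * integral {z1..z2} f"
    by (intro integral_unique has_integral_mult_right integrable_integral integrable_continuous_real f)
  finally show ?thesis by simp
qed

text \<open>The outcome of \<open>mean_square_exp\<close> on an interval of length 2 \<eta> + 1 with
  least frequency \<open>Y\<close>, when parameters \<rho> apart give points of a depth
  \<open>m\<close> piece at least \<open>(10/21)^m * \<rho>\<^sup>2 / 4\<close> apart.\<close>

abbreviation square_bound :: "real \<Rightarrow> real \<Rightarrow> real \<Rightarrow> nat \<Rightarrow> real" where
  "square_bound \<rho> \<eta> Y m \<equiv> 2 * \<rho> * (2 * \<eta> + 1) + (2 * \<eta> + 3) * (4 / (Y * (10/21)^m * \<rho>\<^sup>2))"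

context doubling_lift_C2
begin

text \<open>\<open>i\<close> selects a piece of the measure of depth \<open>m\<close>, and
  \<open>j\<close> the branch of \<open>br n\<close> applied to it.\<close>

abbreviation word_integral :: "real \<Rightarrow> nat \<Rightarrow> nat \<Rightarrow> nat \<Rightarrow> nat \<Rightarrow> complex" where
  "word_integral \<xi> m n i j \<equiv>
     integral {0..1} (\<lambda>s. cis (\<xi> * br n (Psi ((s + real i) / 2^m) + real j)))"

text \<open>Branches with \<open>S n\<close> near \<open>A\<close> are linearized at the endpoint
  \<open>x\<close> of a piece of diameter at most \<open>(5/9)^m\<close>, so each gives the
  transform of the same piece at frequency \<open>\<xi> * exp (S n (x + real j))\<close>. By
  Cauchy-Schwarz and the density bound their average is controlled by an integral over all
  frequencies in the range. The remaining branches are counted with modulus 1.\<close>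

lemma core_estimate:
  assumes x: "x = Psi (real i / 2^m)"
    and dens: "\<And>c. real (card {j \<in> {..<2^n}. c \<le> S n (x + real j) \<and> S n (x + real j) \<le> c + w}) \<le> P * w * 2^n"
    and bad: "real (card {j \<in> {..<2^n}. \<eta> < \<bar>S n (x + real j) - A\<bar>}) \<le> b0 * 2^n"
    and w: "0 < w" "w \<le> 1" and "0 < \<xi>" "0 < \<rho>" "0 \<le> \<eta>" "0 \<le> P"
  defines "Y1 \<equiv> \<xi> * exp (A - \<eta>)" and "Y2 \<equiv> \<xi> * exp (A + \<eta>)"
  shows "(\<Sum>j<2^n. cmod (word_integral \<xi> m n i j))
    \<le> 2^n * (sqrt (P * square_bound \<rho> \<eta> Y1 m + 4 * w * Y2)
         + 2 * Y2 * (25/81)^m + b0)"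
proof -
  define d where "d s = Psi ((s + real i) / 2^m) - x" for s
  define y where "y j = S n (x + real j)" for j
  define G where "G = {j \<in> {..<2^n}. \<bar>y j - A\<bar> \<le> \<eta>}"
  define \<delta> where "\<delta> = (5/9 :: real)^m"
  define \<psi> where "\<psi> t = (cmod (integral {0..1} (\<lambda>s. cis (t * d s))))\<^sup>2" for t
  have "\<delta> \<le> 1" "0 < \<delta>" by (auto simp: \<delta>_def power_le_one)
  have Y: "0 < Y1" "0 < Y2" using \<open>0 < \<xi>\<close> by (auto simp: Y1_def Y2_def)
  have dbr: "d s = br m (Psi s + real i) - br m (Psi 0 + real i)" for s
    by (simp add: d_def x br_Psi_add)
  have d_cont: "continuous_on A d" for A
    unfolding d_def by (intro continuous_intros continuous_on_compose2[OF Psi_cont[of UNIV]]) auto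
  have d_bound: "\<bar>d s\<bar> \<le> \<delta>" if "s \<in> {0..1}" for s
  proof -
    have "\<bar>d s\<bar> \<le> \<delta> * \<bar>Psi s - Psi 0\<bar>"
      using br_dist(2)[of m "Psi s + real i" "Psi 0 + real i"] by (simp add: dbr \<delta>_def)
    also have "\<dots> \<le> \<delta> * 1"
      using that Psi_mono[of 0 s] Psi_mono[of s 1] Psi_add_1[of 0] \<open>0 < \<delta>\<close> by (intro mult_left_mono) auto
    finally show ?thesis by simp
  qed
  have yG: "exp (y j) * \<xi> \<le> Y2" "A - \<eta> \<le> y j" "y j \<le> A + \<eta>" if "j \<in> G" for j
    using that \<open>0 < \<xi>\<close> by (auto simp: G_def Y2_def)
  have lin: "cmod (word_integral \<xi> m n i j)
     \<le> cmod (integral {0..1} (\<lambda>s. cis (\<xi> * exp (y j) * d s))) + 2 * Y2 * \<delta>\<^sup>2" if j: "j \<in> G" for j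
  proof -
    let ?b = "\<xi> * br n (x + real j)"
    have c1: "(\<lambda>s. cis (\<xi> * br n (Psi ((s + real i) / 2^m) + real j))) integrable_on {0..1}"
    proof -
      have "continuous_on {0..1} (\<lambda>s. br n (d s + (x + real j)))"
        by (rule continuous_on_compose2[OF br_cont[of UNIV]]) (auto intro!: continuous_intros d_cont)
      then have "continuous_on {0..1} (\<lambda>s. br n (Psi ((s + real i) / 2^m) + real j))"
        by (simp add: d_def)
      then show ?thesis by (intro integrable_continuous_real continuous_intros)
    qed
    have c2: "(\<lambda>s. cis ?b * cis (\<xi> * exp (y j) * d s)) integrable_on {0..1}"
      by (intro integrable_continuous_real continuous_intros d_cont)
    have "cmod (word_integral \<xi> m n i j
        - integral {0..1} (\<lambda>s. cis ?b * cis (\<xi> * exp (y j) * d s))) \<le> 2 * Y2 * \<delta>\<^sup>2"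
      unfolding Henstock_Kurzweil_Integration.integral_diff[OF c1 c2, symmetric]
    proof (rule norm_integral_bound_unit)
      fix s :: real assume s: "s \<in> {0..1}"
      have e: "Psi ((s + real i) / 2^m) + real j = (x + real j) + d s" by (simp add: d_def)
      have "\<bar>br n ((x + real j) + d s) - br n (x + real j) - exp (y j) * d s\<bar> \<le> 2 * exp (y j) * (d s)\<^sup>2"
        unfolding y_def using d_bound[OF s] \<open>\<delta> \<le> 1\<close> by (intro br_linear) auto
      also have "\<dots> \<le> 2 * exp (y j) * \<delta>\<^sup>2"
        using d_bound[OF s] by (intro mult_left_mono power2_le_iff_abs_le[THEN iffD2]) (auto simp: abs_le_square_iff)
      finally have "\<xi> * \<bar>br n ((x + real j) + d s) - br n (x + real j) - exp (y j) * d s\<bar> \<le> \<xi> * (2 * exp (y j) * \<delta>\<^sup>2)"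
        using \<open>0 < \<xi>\<close> by (intro mult_left_mono) auto
      also have "\<dots> = 2 * (exp (y j) * \<xi>) * \<delta>\<^sup>2" by simp
      also have "\<dots> \<le> 2 * Y2 * \<delta>\<^sup>2" using yG(1)[OF j] by (intro mult_right_mono mult_left_mono) auto
      finally have "\<bar>\<xi> * (br n ((x + real j) + d s) - br n (x + real j) - exp (y j) * d s)\<bar> \<le> 2 * Y2 * \<delta>\<^sup>2"
        using \<open>0 < \<xi>\<close> by (simp add: abs_mult)
      moreover have "\<xi> * br n ((x + real j) + d s) - (?b + \<xi> * exp (y j) * d s)
         = \<xi> * (br n ((x + real j) + d s) - br n (x + real j) - exp (y j) * d s)"
        by (simp add: algebra_simps)
      ultimately show "cmod (cis (\<xi> * br n (Psi ((s + real i) / 2^m) + real j)) - cis ?b * cis (\<xi> * exp (y j) * d s)) \<le> 2 * Y2 * \<delta>\<^sup>2"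
        unfolding e cis_mult using cmod_cis_diff_le[of "\<xi> * br n ((x + real j) + d s)" "?b + \<xi> * exp (y j) * d s"]
        by linarith
    qed (use Y in simp)
    moreover have "integral {0..1} (\<lambda>s. cis ?b * cis (\<xi> * exp (y j) * d s)) = cis ?b * integral {0..1} (\<lambda>s. cis (\<xi> * exp (y j) * d s))"
      by (intro integral_unique has_integral_mult_right integrable_integral integrable_continuous_real continuous_intros d_cont)
    then have "cmod (integral {0..1} (\<lambda>s. cis ?b * cis (\<xi> * exp (y j) * d s))) = cmod (integral {0..1} (\<lambda>s. cis (\<xi> * exp (y j) * d s)))"
      by (simp add: norm_mult)
    ultimately show ?thesis
      using norm_triangle_ineq2[of "word_integral \<xi> m n i j"
          "integral {0..1} (\<lambda>s. cis ?b * cis (\<xi> * exp (y j) * d s))"] by linarith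
  qed
  \<comment> \<open>The extra 1 makes room for the windows of length \<open>w <= 1\<close> to the
    right of each \<open>y j\<close>.\<close>
  define z1 z2 where "z1 = A - \<eta>" and "z2 = A + \<eta> + 1"
  have z12: "z2 - z1 = 2 * \<eta> + 1" by (simp add: z1_def z2_def)
  define Q where "Q = integral {z1..z2} (\<lambda>z. \<psi> (\<xi> * exp z))"
  have Q: "Q \<le> square_bound \<rho> \<eta> Y1 m"
  proof -
    define \<kappa> where "\<kappa> = \<xi> * ((10/21)^m * (\<rho>\<^sup>2 / 4))"
    have "\<kappa> > 0" using \<open>0 < \<xi>\<close> \<open>0 < \<rho>\<close> by (simp add: \<kappa>_def)
    have "Q \<le> 2 * \<rho> * (z2 - z1) + (2 + (z2 - z1)) * exp (- z1) / \<kappa>"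
      unfolding Q_def \<psi>_def
    proof (rule mean_square_exp[OF d_cont])
      show "z1 \<le> z2" "0 \<le> \<rho>" "0 < \<kappa>" using z12 \<open>0 \<le> \<eta>\<close> \<open>0 < \<rho>\<close> \<open>\<kappa> > 0\<close> by auto
      fix v v' :: real assume v: "v \<in> {0..1}" "v' \<in> {0..1}" "\<rho> \<le> \<bar>v - v'\<bar>"
      have sq: "\<rho>\<^sup>2 / 4 \<le> \<bar>Psi v - Psi v'\<bar>"
      proof -
        have "\<rho>\<^sup>2 \<le> \<bar>v - v'\<bar>\<^sup>2" using v \<open>0 < \<rho>\<close> by (intro power_mono) auto
        moreover have "(v - v')\<^sup>2 / 4 \<le> \<bar>Psi v - Psi v'\<bar>"
        proof (cases "v \<le> v'")
          case True
          then have "(v' - v)\<^sup>2 / 4 \<le> Psi v' - Psi v" using v by (intro Psi_lower) auto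
          then show ?thesis using power2_commute[of v v'] by linarith
        next
          case False
          then have "(v - v')\<^sup>2 / 4 \<le> Psi v - Psi v'" using v by (intro Psi_lower) auto
          then show ?thesis by linarith
        qed
        ultimately show ?thesis by simp
      qed
      have "(10/21)^m * (\<rho>\<^sup>2 / 4) \<le> (10/21)^m * \<bar>Psi v - Psi v'\<bar>"
        using sq by (intro mult_left_mono) auto
      also have "\<dots> \<le> \<bar>d v - d v'\<bar>"
        using br_dist(1)[of m "Psi v + real i" "Psi v' + real i"] by (simp add: dbr)
      finally have "\<xi> * ((10/21)^m * (\<rho>\<^sup>2 / 4)) \<le> \<xi> * \<bar>d v - d v'\<bar>"
        using \<open>0 < \<xi>\<close> by (intro mult_left_mono) auto
      then show "\<kappa> \<le> \<bar>\<xi> * (d v - d v')\<bar>" using \<open>0 < \<xi>\<close> by (simp add: \<kappa>_def abs_mult)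
    qed
    moreover have "exp (- z1) / \<kappa> = 4 / (Y1 * (10/21)^m * \<rho>\<^sup>2)"
      unfolding z1_def exp_minus \<kappa>_def Y1_def by (simp add: divide_simps)
    ultimately have "Q \<le> 2 * \<rho> * (2 * \<eta> + 1) + (2 + (2 * \<eta> + 1)) * (4 / (Y1 * (10/21)^m * \<rho>\<^sup>2))"
      unfolding z12 by (simp flip: times_divide_eq_right)
    then show ?thesis by (simp add: add.commute)
  qed
  have "w * (\<Sum>j\<in>G. \<psi> (\<xi> * exp (y j))) \<le> (P * w * 2^n) * Q + w * (real (card G) * (4 * w * Y2))"
    unfolding Q_def
  proof (rule sum_le_integral_density[where y = y])
    show "continuous_on {z1..z2} (\<lambda>z. \<psi> (\<xi> * exp z))"
    proof -
      have "continuous_on ({z1..z2} \<times> {0..1}) (\<lambda>p. d (snd p))"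
        by (rule continuous_on_compose2[OF d_cont[of UNIV]]) (auto intro: continuous_intros)
      then have "continuous_on {z1..z2} (\<lambda>z. integral (cbox 0 1) (\<lambda>v. cis (\<xi> * exp z * d v)))"
        by (intro integral_continuous_on_param) (auto simp: case_prod_unfold intro!: continuous_intros)
      then show ?thesis unfolding \<psi>_def box_real(2) by (intro continuous_intros)
    qed
    show "0 \<le> \<psi> (\<xi> * exp z)" for z by (simp add: \<psi>_def)
    show "finite G" by (simp add: G_def)
    show "0 < w" by (rule w)
    show "z1 \<le> y j \<and> y j + w \<le> z2" if "j \<in> G" for j
      using yG[OF that] w by (auto simp: z1_def z2_def)
    show "real (card {j \<in> G. y j \<le> z \<and> z \<le> y j + w}) \<le> P * w * 2^n" for z
    proof -
      have "card {j \<in> G. y j \<le> z \<and> z \<le> y j + w} \<le> card {j \<in> {..<2^n}. z - w \<le> y j \<and> y j \<le> z - w + w}"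
        by (intro card_mono) (auto simp: G_def)
      then show ?thesis using dens[of "z - w"] unfolding y_def by linarith
    qed
    show "\<psi> (\<xi> * exp (y j)) \<le> \<psi> (\<xi> * exp z) + 4 * w * Y2" if j: "j \<in> G" and z: "y j \<le> z" "z \<le> y j + w" for j z
    proof -
      have "\<psi> (\<xi> * exp (y j)) \<le> \<psi> (\<xi> * exp z) + 2 * \<bar>\<xi> * exp (y j) - \<xi> * exp z\<bar> * \<delta>"
        unfolding \<psi>_def by (rule psi_lipschitz[OF d_cont d_bound])
      also have "2 * \<bar>\<xi> * exp (y j) - \<xi> * exp z\<bar> * \<delta> \<le> 2 * (2 * w * Y2) * 1"
      proof (intro mult_mono)
        have "exp (z - y j) \<le> exp w" using z by simp
        also have "\<dots> \<le> 1 + w + w\<^sup>2" using w by (intro exp_bound) auto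
        also have "w\<^sup>2 \<le> w" using w by (simp add: power2_eq_square mult_left_le)
        finally have "exp (z - y j) - 1 \<le> 2 * w" by simp
        then have "(exp (y j) * \<xi>) * (exp (z - y j) - 1) \<le> Y2 * (2 * w)"
          using yG(1)[OF j] z Y by (intro mult_mono) auto
        moreover have "(exp (y j) * \<xi>) * (exp (z - y j) - 1) = \<xi> * exp z - \<xi> * exp (y j)"
          by (simp add: exp_diff right_diff_distrib)
        moreover have "\<xi> * exp (y j) \<le> \<xi> * exp z" using z \<open>0 < \<xi>\<close> by simp
        ultimately show "\<bar>\<xi> * exp (y j) - \<xi> * exp z\<bar> \<le> 2 * w * Y2" by (simp add: mult_ac)
      qed (use \<open>\<delta> \<le> 1\<close> \<open>0 < \<delta>\<close> w Y in auto)
      finally show ?thesis by simp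
    qed
  qed
  also have "\<dots> = w * (2^n * (P * Q) + real (card G) * (4 * w * Y2))" by (simp add: algebra_simps)
  finally have "(\<Sum>j\<in>G. \<psi> (\<xi> * exp (y j))) \<le> 2^n * (P * Q) + real (card G) * (4 * w * Y2)"
    using w by simp
  also have "card G \<le> card {..<2^n::nat}" unfolding G_def by (intro card_mono) auto
  then have cG: "card G \<le> 2^n" by simp
  then have "real (card G) * (4 * w * Y2) \<le> 2^n * (4 * w * Y2)"
    using w Y by (intro mult_right_mono) (auto simp: numeral_power_le_of_nat_cancel_iff of_nat_le_numeral_power_cancel_iff)
  finally have sumpsi: "(\<Sum>j\<in>G. \<psi> (\<xi> * exp (y j))) \<le> 2^n * (P * Q + 4 * w * Y2)"
    by (simp add: distrib_left)
  have good: "(\<Sum>j\<in>G. cmod (integral {0..1} (\<lambda>s. cis (\<xi> * exp (y j) * d s)))) \<le> 2^n * sqrt (P * Q + 4 * w * Y2)"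
  proof -
    have "(\<Sum>j\<in>G. cmod (integral {0..1} (\<lambda>s. cis (\<xi> * exp (y j) * d s)))) \<le> sqrt (real (2^n) * (\<Sum>j\<in>G. \<psi> (\<xi> * exp (y j))))"
      unfolding \<psi>_def by (rule sum_le_sqrt_sum_squares[OF cG]) simp
    also have "\<dots> \<le> sqrt ((2^n)\<^sup>2 * (P * Q + 4 * w * Y2))"
      using sumpsi by (simp add: power2_eq_square mult.assoc)
    finally show ?thesis by (simp add: real_sqrt_mult)
  qed
  let ?I = "\<lambda>j. cmod (word_integral \<xi> m n i j)"
  have \<delta>2: "\<delta>\<^sup>2 = (25/81)^m"
    unfolding \<delta>_def power2_eq_square power_mult_distrib[symmetric] by simp
  define X where "X = P * square_bound \<rho> \<eta> Y1 m + 4 * w * Y2"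
  have "(\<Sum>j<2^n. ?I j) = (\<Sum>j\<in>G. ?I j) + (\<Sum>j\<in>{..<2^n} - G. ?I j)"
    by (intro sum.subset_diff[THEN trans]) (auto simp: G_def add.commute)
  moreover have "(\<Sum>j\<in>G. ?I j) \<le> 2^n * sqrt (P * Q + 4 * w * Y2) + 2^n * (2 * Y2 * \<delta>\<^sup>2)"
  proof -
    have "(\<Sum>j\<in>G. ?I j) \<le> (\<Sum>j\<in>G. cmod (integral {0..1} (\<lambda>s. cis (\<xi> * exp (y j) * d s))) + 2 * Y2 * \<delta>\<^sup>2)"
      by (rule sum_mono) (rule lin)
    also have "\<dots> = (\<Sum>j\<in>G. cmod (integral {0..1} (\<lambda>s. cis (\<xi> * exp (y j) * d s)))) + real (card G) * (2 * Y2 * \<delta>\<^sup>2)"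
      by (simp add: sum.distrib)
    also have "real (card G) * (2 * Y2 * \<delta>\<^sup>2) \<le> 2^n * (2 * Y2 * \<delta>\<^sup>2)"
      using Y cG by (intro mult_right_mono) (auto simp: of_nat_le_numeral_power_cancel_iff)
    finally show ?thesis using good by linarith
  qed
  moreover have "(\<Sum>j\<in>{..<2^n} - G. ?I j) \<le> b0 * 2^n"
  proof -
    have "(\<Sum>j\<in>{..<2^n} - G. ?I j) \<le> (\<Sum>j\<in>{..<2^n} - G. 1)"
      by (intro sum_mono norm_integral_bound_unit) auto
    also have "\<dots> = real (card {j \<in> {..<2^n}. \<eta> < \<bar>S n (x + real j) - A\<bar>})"
      by (simp, rule arg_cong[of _ _ card]) (auto simp: G_def y_def)
    finally show ?thesis using bad by linarith
  qed
  moreover have "2^n * sqrt (P * Q + 4 * w * Y2) \<le> 2^n * sqrt X"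
    unfolding X_def by (intro mult_left_mono real_sqrt_le_mono add_right_mono Q \<open>0 \<le> P\<close>) simp
  ultimately have "(\<Sum>j<2^n. ?I j) \<le> 2^n * sqrt X + 2^n * (2 * Y2 * \<delta>\<^sup>2) + b0 * 2^n"
    by linarith
  also have "\<dots> = 2^n * (sqrt X + 2 * Y2 * (25/81)^m + b0)"
    unfolding \<delta>2 by (simp add: distrib_left mult.commute)
  finally show ?thesis unfolding X_def .
qed

end

text \<open>The budget of exponents of e^u: \<open>(10/21)^m\<close> costs at most 0.88 up to a
  constant and \<open>(25/81)^m\<close> gains at least 1.1. So Y1 (10/21)^m \<rho>^2 grows with
  exponent 0.975 - 0.88 - 0.06 = 0.035, and Y2 (25/81)^m decays with 1.1 - 1.025 = 0.075. The factor
  \<rho> gives 0.03, of which 0.01 absorbs the linear factor in \<open>u\<close>, and the square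
  root halves the remaining 0.02.\<close>

lemma decay_numeric:
  fixes u b t0 Y1 Y2 :: real and m :: nat
  assumes u: "0 \<le> u" and t0: "1 \<le> t0" and m: "11/10 * u \<le> real m" "real m \<le> 11/10 * u + 1"
    and Y1: "exp (39/40 * u) \<le> Y1" and Y2: "0 \<le> Y2" "Y2 \<le> exp b * exp (41/40 * u)"
  defines "\<rho> \<equiv> exp (- (3/100 * u))"
  shows "sqrt (16 * t0 * square_bound \<rho> (u / 40) Y1 m
       + 4 * exp (- (2 * u)) * Y2) + 2 * Y2 * (25/81)^m
     \<le> (sqrt (1792 * t0 + 4 * exp b) + 2 * exp b) * exp (- (u / 100))"
proof -
  have "(21/10::real) \<le> exp (4/5)"
    using exp_lower_Taylor_quadratic[of "4/5::real"] by (simp add: power2_eq_square)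
  then have e1: "exp (- (4/5)) \<le> (10/21::real)" by (simp add: exp_minus field_simps)
  have "exp (1/2) \<le> (9/5::real)"
    using exp_bound[of "1/2::real"] by (simp add: power2_eq_square)
  then have "5/9 \<le> exp (- (1/2) :: real)" by (simp add: exp_minus field_simps)
  then have "(5/9) * (5/9) \<le> exp (- (1/2)) * exp (- (1/2) :: real)" by (intro mult_mono) auto
  then have e2: "25/81 \<le> exp (- 1 :: real)" by (simp flip: exp_add)
  have e3: "exp (4/5) \<le> (3::real)"
    using exp_bound[of "4/5::real"] by (simp add: power2_eq_square)
  have pow1: "exp (- (4/5) * (11/10 * u + 1)) \<le> (10/21)^m"
  proof -
    have "exp (- (4/5) * (11/10 * u + 1)) \<le> exp (real m * - (4/5))" using m by simp
    also have "\<dots> = exp (- (4/5))^m" by (rule exp_of_nat_mult)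
    also have "\<dots> \<le> (10/21)^m" using e1 by (intro power_mono) auto
    finally show ?thesis .
  qed
  have pow2: "(25/81)^m \<le> exp (- (11/10 * u))"
  proof -
    have "(25/81)^m \<le> exp (- 1 :: real)^m" using e2 by (intro power_mono) auto
    also have "\<dots> = exp (real m * - 1)" by (rule exp_of_nat_mult[symmetric])
    also have "\<dots> \<le> exp (- (11/10 * u))" using m by simp
    finally show ?thesis .
  qed
  have "0 < Y1" using Y1 exp_gt_zero[of "39/40 * u"] by linarith
  have den: "4 / (Y1 * (10/21)^m * \<rho>\<^sup>2) \<le> 12 * exp (- (3/100 * u))"
  proof -
    have "exp (39/40 * u) * exp (- (4/5) * (11/10 * u + 1)) * \<rho>\<^sup>2 \<le> Y1 * (10/21)^m * \<rho>\<^sup>2"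
      using Y1 pow1 \<open>0 < Y1\<close> by (intro mult_right_mono mult_mono) auto
    moreover have "exp (39/40 * u) * exp (- (4/5) * (11/10 * u + 1)) * \<rho>\<^sup>2 = exp (7/200 * u) / exp (4/5)"
      by (simp add: \<rho>_def power2_eq_square algebra_simps flip: exp_add exp_diff)
    ultimately have "exp (7/200 * u) / exp (4/5) \<le> Y1 * (10/21)^m * \<rho>\<^sup>2" by simp
    then have "4 / (Y1 * (10/21)^m * \<rho>\<^sup>2) \<le> 4 / (exp (7/200 * u) / exp (4/5))"
      using \<open>0 < Y1\<close> by (intro divide_left_mono mult_pos_pos) (auto simp: \<rho>_def)
    also have "\<dots> = 4 * exp (4/5) * exp (- (7/200 * u))" by (simp add: exp_minus field_simps)
    also have "\<dots> \<le> 4 * 3 * exp (- (3/100 * u))"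
      using e3 u by (intro mult_mono) auto
    finally show ?thesis by simp
  qed
  have lin: "u / 20 + 3 \<le> 8 * exp (u / 100)"
    using exp_ge_add_one_self[of "u / 100"] one_le_exp_iff[of "u / 100"] u by linarith
  have "square_bound \<rho> (u / 40) Y1 m
     \<le> 2 * \<rho> * (u / 20 + 3) + (u / 20 + 3) * (12 * \<rho>)"
    using den u \<open>0 < Y1\<close> by (intro add_mono mult_mono) (auto simp: \<rho>_def)
  also have "\<dots> = 14 * \<rho> * (u / 20 + 3)" by (simp add: algebra_simps)
  also have "\<dots> \<le> 14 * \<rho> * (8 * exp (u / 100))" using lin by (intro mult_left_mono) (auto simp: \<rho>_def)
  also have "\<dots> = 112 * exp (- (u / 50))" by (simp add: \<rho>_def flip: exp_add)
  finally have "16 * t0 * square_bound \<rho> (u / 40) Y1 m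
     \<le> 16 * t0 * (112 * exp (- (u / 50)))"
    using t0 by (intro mult_left_mono) auto
  moreover have "4 * exp (- (2 * u)) * Y2 \<le> 4 * exp b * exp (- (u / 50))"
  proof -
    have "4 * exp (- (2 * u)) * Y2 \<le> 4 * exp (- (2 * u)) * (exp b * exp (41/40 * u))"
      using Y2 by (intro mult_left_mono) auto
    also have "\<dots> = 4 * exp b * exp (- (39/40 * u))" by (simp flip: exp_add)
    also have "\<dots> \<le> 4 * exp b * exp (- (u / 50))" using u by (intro mult_left_mono) auto
    finally show ?thesis .
  qed
  ultimately have "sqrt (16 * t0 * square_bound \<rho> (u / 40) Y1 m
       + 4 * exp (- (2 * u)) * Y2) \<le> sqrt ((1792 * t0 + 4 * exp b) * exp (- (u / 50)))"
    by (intro real_sqrt_le_mono) (simp add: algebra_simps)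
  also have "exp (- (u / 50)) = (exp (- (u / 100)))\<^sup>2"
    by (simp add: power2_eq_square flip: exp_add)
  finally have 1: "sqrt (16 * t0 * square_bound \<rho> (u / 40) Y1 m
       + 4 * exp (- (2 * u)) * Y2) \<le> sqrt (1792 * t0 + 4 * exp b) * exp (- (u / 100))"
    by (simp add: real_sqrt_mult)
  have "2 * Y2 * (25/81)^m \<le> 2 * (exp b * exp (41/40 * u)) * exp (- (11/10 * u))"
    using Y2 pow2 by (intro mult_mono) auto
  also have "\<dots> = 2 * exp b * exp (- (3/40 * u))" by (simp flip: exp_add)
  also have "\<dots> \<le> 2 * exp b * exp (- (u / 100))" using u by (intro mult_left_mono) auto
  finally have 2: "2 * Y2 * (25/81)^m \<le> 2 * exp b * exp (- (u / 100))" .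
  from 1 2 show ?thesis by (simp add: distrib_right)
qed

section \<open>Choice of scales and decay under non-integrability\<close>

context doubling_lift_C2
begin

lemma integral_words:
  "cmod (fourier \<xi>)
    \<le> (\<Sum>i<2^m. \<Sum>j<2^n. cmod (word_integral \<xi> m n i j)) / 2^(n + m)"
proof -
  let ?f = "\<lambda>y. cis (\<xi> * Psi (y / 2^(n + m)))"
  let ?g = "\<lambda>i j s. cis (\<xi> * br n (Psi ((s + real i) / 2^m) + real j))"
  have f: "?f (s + real i + 2^m * real j) = ?g i j s" for s i j
  proof -
    have "(s + real i + 2^m * real j) / 2^(n + m) = ((s + real i) / 2^m + real j) / 2^n"
      by (simp add: power_add field_simps)
    then show ?thesis by (simp only: br_Psi_add)
  qed
  have int: "?g i j integrable_on {0..1}" for i j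
    unfolding f[symmetric]
    by (intro integrable_continuous_real continuous_intros continuous_on_compose2[OF Psi_cont[of UNIV]]) auto
  have "fourier \<xi> = integral {0..1} (\<lambda>s. (\<Sum>l<2^(n + m). ?f (s + real l)) /\<^sub>R real (2^(n + m)))"
    using integral_average[of "\<lambda>s. cis (\<xi> * Psi s)" "2^(n + m)", symmetric]
    by (simp add: continuous_intros Psi_cont)
  also have "\<dots> = integral {0..1} (\<lambda>s. (\<Sum>i<2^m. \<Sum>j<2^n. ?g i j s) /\<^sub>R real (2^(n + m)))"
    unfolding sum_split_blocks[where f = ?f] f ..
  also have "\<dots> = integral {0..1} (\<lambda>s. \<Sum>i<2^m. \<Sum>j<2^n. ?g i j s) /\<^sub>R real (2^(n + m))"
    by (rule integral_cmul)
  also have "integral {0..1} (\<lambda>s. \<Sum>i<2^m. \<Sum>j<2^n. ?g i j s) = (\<Sum>i<2^m. \<Sum>j<2^n. integral {0..1} (?g i j))"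
    by (simp add: integral_sum integrable_sum int)
  finally have "cmod (fourier \<xi>)
      = cmod (\<Sum>i<2^m. \<Sum>j<2^n. integral {0..1} (?g i j)) / 2^(n + m)"
    by (simp add: divide_inverse)
  also have "\<dots> \<le> (\<Sum>i<2^m. \<Sum>j<2^n. cmod (integral {0..1} (?g i j))) / 2^(n + m)"
    by (intro divide_right_mono order_trans[OF norm_sum] sum_mono norm_sum) auto
  finally show ?thesis .
qed

text \<open>The frequency determines the number \<open>p\<close> of blocks, and everything is
  measured by \<open>u = \<beta> * real n\<close> with \<open>n = q * p\<close>: the effective
  frequency of a piece is about exp u, the density is used at scale exp (-2 u), and the deviations
  allowed are \<open>u / 40\<close>.\<close>

lemma UNI_decay:
  assumes UNI
  obtains C r where "C > 0" "r > 0"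
    "\<And>\<xi>. \<xi> > 0 \<Longrightarrow> cmod (fourier \<xi>) \<le> C * \<xi> powr (- r)"
proof -
  obtain k \<theta> t0 where k: "k > 0" and \<theta>: "0 < \<theta>" "\<theta> < 1" and t0: "1 \<le> t0"
    and W: "\<And>t p x. t0 \<le> \<bar>t\<bar> \<Longrightarrow> x \<in> {Psi 0..Psi 1} \<Longrightarrow> cmod (W t (k * p) x) \<le> 2 * \<bar>t\<bar> * \<theta>^p"
    using W_decay[OF assms] by metis
  \<comment> \<open>\<open>\<kappa>\<close> is the decay rate of \<open>W\<close> per step. Taking
    \<beta> <= \<kappa>/8 makes exp (-\<kappa> n) smaller than \<open>w * w\<close> at the scale
    \<open>w\<close> used below.\<close>
  define \<kappa> \<beta> \<eta> where "\<kappa> = - ln \<theta> / real k" and "\<beta> = min (\<kappa> / 8) (1/8)" and "\<eta> = \<beta> / 40"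
  have "\<kappa> > 0" using k \<theta> by (simp add: \<kappa>_def divide_neg_pos)
  then have \<beta>: "\<beta> > 0" "8 * \<beta> \<le> \<kappa>" "\<beta> \<le> 1/8" by (auto simp: \<beta>_def min_def)
  then have \<eta>: "0 < \<eta>" "\<eta> \<le> 1" by (auto simp: \<eta>_def)
  define q' where "q' = nat \<lceil>4 / \<eta>\<rceil>"
  \<comment> \<open>A multiple of \<open>k\<close>, as \<open>W_decay\<close> controls only such
    lengths, and large enough for the large deviation bound.\<close>
  define q where "q = k * q'"
  have "4 / \<eta> \<le> real q'" unfolding q'_def using \<eta> by (simp add: real_nat_ceiling_ge)
  moreover have "1 * real q' \<le> real k * real q'" using k by (intro mult_right_mono) auto
  ultimately have q4: "4 / \<eta> \<le> real q" by (simp add: q_def)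
  moreover have "0 < 4 / \<eta>" using \<eta> by simp
  ultimately have q0: "real q > 0" by linarith
  define a where "a = (\<Sum>j<2^q. S q (real j)) / 2^q"
  have a0: "a \<le> 0" unfolding a_def by (intro divide_nonpos_pos sum_nonpos S_range(2)) auto
  \<comment> \<open>\<open>exp (a * real p)\<close> is the typical derivative of
    \<open>br n\<close>. With \<xi> about \<open>exp (b * real p)\<close>, multiplying by that
    derivative leaves exp u up to the factor exp b.\<close>
  define b where "b = \<beta> * real q - a"
  have b0: "b > 0" using mult_pos_pos[OF \<beta>(1) q0] a0 unfolding b_def by linarith
  define K where "K = sqrt (1792 * t0 + 4 * exp b) + 2 * exp b"
  have K0: "K > 0" unfolding K_def using t0 by (intro add_nonneg_pos) auto
  define c where "c = min (\<beta> * real q / 100) (\<eta>\<^sup>2 / 8)"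
  have c0: "c > 0" using \<beta> q0 \<eta> by (simp add: c_def)
  have main: "cmod (fourier \<xi>) \<le> (K + 2) * exp (- c * real p)"
    if \<xi>: "\<xi> > 0" "exp (b * real p) \<le> \<xi>" "\<xi> \<le> exp (b * (real p + 1))" for \<xi> p
  proof -
    define n where "n = q * p"
    define u where "u = \<beta> * real n"
    have u0: "0 \<le> u" using \<beta> by (simp add: u_def)
    have \<eta>n: "\<eta> * real n = u / 40" by (simp add: \<eta>_def u_def)
    define m where "m = nat \<lceil>11/10 * u\<rceil>"
    have m: "11/10 * u \<le> real m" "real m \<le> 11/10 * u + 1"
      using u0 by (auto simp: m_def) 
    define w where "w = exp (- (2 * u))"
    have w: "0 < w" "w \<le> 1" using u0 by (auto simp: w_def)
    have bp: "b * real p = u - a * real p" by (simp add: b_def u_def n_def algebra_simps)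
    define A where "A = a * real p"
    have \<xi>A: "exp u \<le> \<xi> * exp A" "\<xi> * exp A \<le> exp b * exp u"
    proof -
      have "exp u = exp (b * real p) * exp A" by (simp add: bp A_def flip: exp_add)
      also have "\<dots> \<le> \<xi> * exp A" using \<xi> by simp
      finally show "exp u \<le> \<xi> * exp A" .
      have "\<xi> * exp A \<le> exp (b * (real p + 1)) * exp A" using \<xi> by simp
      also have "\<dots> = exp b * exp u" using bp by (simp add: A_def distrib_left flip: exp_add)
      finally show "\<xi> * exp A \<le> exp b * exp u" .
    qed
    \<comment> \<open>Width \<open>w\<close> requires frequencies up to \<open>1 / w\<close>. There
      the factor |t| of \<open>W_decay\<close> costs at most \<open>1 / w\<close>, and the decay
      \<open>w * w\<close> leaves \<open>2 * w\<close>, comparable with the width.\<close>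
    have dens: "real (card {j \<in> {..<2^n}. e \<le> S n (x + real j) \<and> S n (x + real j) \<le> e + w}) \<le> 16 * t0 * w * 2^n"
      if x: "x \<in> {Psi 0..Psi 1}" for x e
    proof -
      have "real (card {j \<in> {..<2^n}. e \<le> S n (x + real j) \<and> S n (x + real j) \<le> e + w})
        \<le> 4 * (2 * t0 * w + 2 * w) * real (2^n)"
      proof (rule small_ball_bound)
        fix t assume t: "t0 \<le> \<bar>t\<bar>" "\<bar>t\<bar> \<le> 1 / w"
        have "\<theta>^(q' * p) = exp (- \<kappa> * real n)"
        proof -
          have "\<theta>^(q' * p) = exp (real (q' * p) * ln \<theta>)" using \<theta> by (simp only: exp_of_nat_mult exp_ln)
          also have "real (q' * p) * ln \<theta> = - \<kappa> * real n" using k by (simp add: \<kappa>_def n_def q_def)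
          finally show ?thesis .
        qed
        also have "\<dots> \<le> exp (- (8 * \<beta>) * real n)" using \<beta>(2) by (simp add: mult_right_mono)
        also have "\<dots> \<le> w * w" using u0 by (simp add: w_def u_def flip: exp_add)
        finally have th: "\<theta>^(q' * p) \<le> w * w" .
        have "n = k * (q' * p)" by (simp add: n_def q_def)
        then have "cmod (W t n x) \<le> 2 * \<bar>t\<bar> * \<theta>^(q' * p)" using W[OF t(1) x] by simp
        also have "\<dots> \<le> 2 * (1 / w) * (w * w)" using t th w \<theta> by (intro mult_mono) auto
        also have "\<dots> = 2 * w" using w by simp
        finally have "cmod (W t n x) \<le> 2 * w" .
        then show "cmod (\<Sum>j<2^n. cis (t * S n (x + real j))) \<le> 2 * w * real (2^n)"
          by (simp add: W_def norm_divide norm_power divide_le_eq)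
      qed (use w t0 in auto)
      also have "\<dots> \<le> 16 * t0 * w * 2^n"
      proof -
        have "1 * w \<le> t0 * w" using t0 w by (intro mult_right_mono) auto
        then have "4 * (2 * t0 * w + 2 * w) \<le> 16 * t0 * w" by simp
        then show ?thesis by (simp add: mult_right_mono)
      qed
      finally show ?thesis .
    qed
    define \<rho> where "\<rho> = exp (- (3/100 * u))"
    define Y1 Y2 where "Y1 = \<xi> * exp (A - u / 40)" and "Y2 = \<xi> * exp (A + u / 40)"
    define b1 where "b1 = 2 * exp (- \<eta>\<^sup>2 / 8)^p"
    define R where "R = sqrt (16 * t0 * square_bound \<rho> (u / 40) Y1 m + 4 * w * Y2)
         + 2 * Y2 * (25/81)^m + b1"
    have core: "(\<Sum>j<2^n. cmod (word_integral \<xi> m n i j)) \<le> 2^n * R"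
      if i: "i < 2^m" for i
      unfolding R_def Y1_def Y2_def
    proof (rule core_estimate[where x = "Psi (real i / 2^m)" and \<eta> = "u / 40"])
      have "real i / 2^m \<le> 1" using i by (simp add: of_nat_less_numeral_power_cancel_iff less_imp_le)
      then have x: "Psi (real i / 2^m) \<in> {Psi 0..Psi 1}" by (auto intro!: Psi_mono)
      show "real (card {j \<in> {..<2^n}. e \<le> S n (Psi (real i / 2^m) + real j) \<and> S n (Psi (real i / 2^m) + real j) \<le> e + w}) \<le> 16 * t0 * w * 2^n" for e
        by (rule dens[OF x])
      show "real (card {j \<in> {..<2^n}. u / 40 < \<bar>S n (Psi (real i / 2^m) + real j) - A\<bar>}) \<le> b1 * 2^n"
        using S_large_deviation[OF \<eta> q4, of p "Psi (real i / 2^m)"]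
        unfolding a_def[symmetric] n_def[symmetric] \<eta>n A_def[symmetric] b1_def by (simp add: mult_ac)
    qed (use w \<xi> u0 t0 in \<open>auto simp: \<rho>_def\<close>)
    have "cmod (fourier \<xi>) \<le> (\<Sum>i<2^m::nat. 2^n * R) / 2^(n + m)"
      by (rule order_trans[OF integral_words[of \<xi> n m]]) (intro divide_right_mono sum_mono core; simp)
    also have "\<dots> = R" by (simp add: power_add)
    also have "R \<le> K * exp (- (u / 100)) + b1"
    proof -
      have "exp (39/40 * u) \<le> Y1"
      proof -
        have "exp (39/40 * u) = exp u * exp (- (u / 40))" by (simp flip: exp_add)
        also have "\<dots> \<le> \<xi> * exp A * exp (- (u / 40))" using \<xi>A by simp
        also have "\<dots> = Y1" unfolding Y1_def diff_conv_add_uminus exp_add by (simp only: mult.assoc)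
        finally show ?thesis .
      qed
      moreover have "Y2 \<le> exp b * exp (41/40 * u)"
      proof -
        have "Y2 = \<xi> * exp A * exp (u / 40)" by (simp add: Y2_def exp_add)
        also have "\<dots> \<le> exp b * exp u * exp (u / 40)" using \<xi>A by simp
        also have "\<dots> = exp b * exp (41/40 * u)" by (simp flip: exp_add)
        finally show ?thesis .
      qed
      moreover have "0 \<le> Y2" using \<xi> by (simp add: Y2_def)
      ultimately show ?thesis
        using decay_numeric[OF u0 t0 m, of Y1 Y2 b] unfolding R_def K_def \<rho>_def w_def by simp
    qed
    also have "\<dots> \<le> K * exp (- c * real p) + 2 * exp (- c * real p)"
    proof (intro add_mono)
      have "c * real p \<le> \<beta> * real q / 100 * real p" by (intro mult_right_mono) (auto simp: c_def)
      then have "- (u / 100) \<le> - c * real p" by (simp add: u_def n_def)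
      then show "K * exp (- (u / 100)) \<le> K * exp (- c * real p)" using K0 by simp
      have "b1 = 2 * exp (real p * (- \<eta>\<^sup>2 / 8))" by (simp only: b1_def exp_of_nat_mult)
      moreover have "c * real p \<le> \<eta>\<^sup>2 / 8 * real p" by (intro mult_right_mono) (auto simp: c_def)
      then have "real p * (- \<eta>\<^sup>2 / 8) \<le> - c * real p" by (simp add: mult.commute)
      ultimately show "b1 \<le> 2 * exp (- c * real p)" by simp
    qed
    finally show ?thesis by (simp add: distrib_right)
  qed
  show ?thesis
  proof (rule that[of "max 1 ((K + 2) * exp c)" "c / b"])
    show "max 1 ((K + 2) * exp c) > 0" "c / b > 0" using c0 b0 by auto
    fix \<xi> :: real assume \<xi>: "\<xi> > 0"
    show "cmod (fourier \<xi>) \<le> max 1 ((K + 2) * exp c) * \<xi> powr (- (c / b))"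
    proof (cases "\<xi> < 1")
      case True
      have "1 \<le> \<xi> powr (- (c / b))"
        using True \<xi> c0 b0 powr_mono'[of "- (c / b)" 0 \<xi>] by simp
      then have "1 * 1 \<le> max 1 ((K + 2) * exp c) * \<xi> powr (- (c / b))" by (intro mult_mono) auto
      moreover have "cmod (fourier \<xi>) \<le> 1"
        by (rule norm_integral_bound_unit) auto
      ultimately show ?thesis by simp
    next
      case False
      define L where "L = ln \<xi>"
      have L: "0 \<le> L" "\<xi> = exp L" using False \<xi> by (auto simp: L_def)
      define p where "p = nat \<lfloor>L / b\<rfloor>"
      have p: "real p \<le> L / b" "L / b \<le> real p + 1"
        using L b0 by (auto simp: p_def) 
      have "b * real p \<le> L" "L \<le> b * (real p + 1)"
        using p b0 by (simp_all add: pos_le_divide_eq pos_divide_le_eq mult.commute)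
      then have "cmod (fourier \<xi>) \<le> (K + 2) * exp (- c * real p)"
        using L \<xi> by (intro main) auto
      also have "\<dots> \<le> (K + 2) * (exp c * exp (- (c / b) * L))"
      proof -
        have "c * (L / b) \<le> c * (real p + 1)" using p c0 by (intro mult_left_mono) auto
        then have "- c * real p \<le> c + - (c / b) * L" by (simp add: algebra_simps)
        then show ?thesis using K0 by (simp flip: exp_add)
      qed
      also have "exp (- (c / b) * L) = \<xi> powr (- (c / b))" using \<xi> by (simp add: powr_def L_def)
      also have "(K + 2) * (exp c * \<xi> powr (- (c / b))) \<le> max 1 ((K + 2) * exp c) * \<xi> powr (- (c / b))"
        unfolding mult.assoc[symmetric] by (intro mult_right_mono) auto
      finally show ?thesis .
    qed
  qed
qed

theorem Psi_fourier_decay: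
  obtains C r where "C > 0" "r > 0"
    "\<And>\<xi>. \<xi> \<noteq> 0 \<Longrightarrow> cmod (fourier \<xi>) \<le> C * \<bar>\<xi>\<bar> powr (- r)"
proof (cases UNI)
  case True
  obtain C r where C: "C > 0" "r > 0"
    "\<And>\<xi>. \<xi> > 0 \<Longrightarrow> cmod (fourier \<xi>) \<le> C * \<xi> powr (- r)"
    using UNI_decay[OF True] by metis
  show ?thesis
  proof (rule that[OF C(1,2)])
    fix \<xi> :: real assume "\<xi> \<noteq> 0"
    have "cnj (fourier \<xi>) = fourier (- \<xi>)"
      unfolding integral_cnj cis_cnj by simp
    then have "cmod (fourier \<xi>) = cmod (fourier (- \<xi>))"
      by (metis complex_mod_cnj)
    then have "cmod (fourier \<xi>) = cmod (fourier \<bar>\<xi>\<bar>)"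
      by (cases "\<xi> > 0") (auto simp: abs_if)
    then show "cmod (fourier \<xi>) \<le> C * \<bar>\<xi>\<bar> powr (- r)"
      using C(3)[of "\<bar>\<xi>\<bar>"] \<open>\<xi> \<noteq> 0\<close> by simp
  qed
next
  case False
  then have "\<And>x. Hlim (x + 1) = Hlim x" using UNI_or_periodic by blast
  then obtain C where C: "\<And>\<xi>::real. \<xi> \<noteq> 0 \<Longrightarrow> cmod (fourier \<xi>) \<le> C / \<bar>\<xi>\<bar>"
    by (rule periodic_decay) blast
  show ?thesis
  proof (rule that[of "max C 1" 1])
    fix \<xi> :: real assume "\<xi> \<noteq> 0"
    then have "C / \<bar>\<xi>\<bar> \<le> max C 1 * \<bar>\<xi>\<bar> powr (- 1)"
      by (simp add: powr_minus divide_inverse)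
    then show "cmod (fourier \<xi>) \<le> max C 1 * \<bar>\<xi>\<bar> powr (- 1)"
      using C[OF \<open>\<xi> \<noteq> 0\<close>] by linarith
  qed auto
qed

end

section \<open>From the line to the circle\<close>

lemma to_circle_eq_iff: "to_circle s = to_circle t \<longleftrightarrow> s - t \<in> \<int>"
  by (rule circle.abs_eq_iff)

lemma to_circle_add: "to_circle (s + t) = to_circle s + to_circle t"
  by (simp add: plus_circle.abs_eq)

lemma to_circle_double: "doubling (to_circle t) = to_circle (2 * t)"
  by (simp add: doubling_def flip: to_circle_add)

lemma to_circle_add_int: "to_circle (t + of_int z) = to_circle t"
  by (simp add: to_circle_eq_iff)

lemma circle_cases: obtains t where "c = to_circle t"
  by (metis Quotient_abs_rep Quotient_circle)

lemma dist_to_circle: "dist (to_circle s) (to_circle t) = infdist (s - t) \<int>"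
  by (rule dist_circle.abs_eq)

lemma dist_to_circle_le: "dist (to_circle s) (to_circle t) \<le> \<bar>s - t\<bar>"
  using infdist_Ints_le[of 0 "s - t"] by (simp add: dist_to_circle)

lemma circle_representatives:
  obtains s t where "x = to_circle s" "y = to_circle t" "dist x y = \<bar>s - t\<bar>" "\<bar>s - t\<bar> \<le> 1"
proof -
  obtain s t where st: "x = to_circle s" "y = to_circle t"
    using circle_cases by metis
  obtain n where n: "n \<in> \<int>" "infdist (s - t) \<int> = \<bar>s - t - n\<bar>" by (rule infdist_Ints_attained)
  have "infdist (s - t) \<int> \<le> \<bar>s - t - of_int \<lfloor>s - t\<rfloor>\<bar>" by (rule infdist_Ints_le) simp
  also have "\<dots> \<le> 1" by linarith
  finally have "\<bar>s - (t + n)\<bar> \<le> 1" using n by (simp add: algebra_simps)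
  moreover have "dist x y = \<bar>s - (t + n)\<bar>" using n st by (simp add: dist_to_circle algebra_simps)
  moreover have "y = to_circle (t + n)" using n st by (simp add: to_circle_eq_iff)
  ultimately show ?thesis using st that by blast
qed

lemma sqrt_hoelder_continuous:
  fixes h :: "'a::metric_space \<Rightarrow> 'b::metric_space"
  assumes "\<And>x y. dist x y \<le> 1 \<Longrightarrow> dist (h x) (h y) \<le> 2 * dist x y powr (1/2)"
  shows "continuous_on A h"
proof -
  have "\<exists>d>0. \<forall>y. dist y x < d \<longrightarrow> dist (h y) (h x) < e" if e: "0 < e" for x e
  proof (intro exI[of _ "min 1 ((e / 2)\<^sup>2)"] conjI allI impI)
    show "0 < min 1 ((e / 2)\<^sup>2)" using e by simp
    fix y assume d: "dist y x < min 1 ((e / 2)\<^sup>2)"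
    have "dist (h y) (h x) \<le> 2 * sqrt (dist y x)"
      using assms[of y x] d by (simp add: powr_half_sqrt)
    also have "sqrt (dist y x) < sqrt ((e / 2)\<^sup>2)" using d by (intro real_sqrt_less_mono) simp
    also have "sqrt ((e / 2)\<^sup>2) = e / 2" using e by simp
    finally show "dist (h y) (h x) < e" by simp
  qed
  then show ?thesis
    by (intro continuous_at_imp_continuous_on ballI) (simp add: continuous_at_eps_delta)
qed

lemma continuous_Ints_constant:
  fixes h :: "real \<Rightarrow> real"
  assumes "continuous_on {a..b} h" "\<And>t. t \<in> {a..b} \<Longrightarrow> h t \<in> \<int>" "s \<in> {a..b}" "t \<in> {a..b}"
  shows "h s = h t"
proof -
  have "h constant_on {a..b}"
  proof (rule continuous_discrete_range_constant[OF connected_Icc assms(1)])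
    fix x assume x: "x \<in> {a..b}"
    have "1 \<le> norm (h y - h x)" if y: "y \<in> {a..b}" "h y \<noteq> h x" for y
      using Ints_nonzero_abs_ge1[of "h y - h x"] assms(2)[OF x] assms(2)[OF y(1)] y(2) by simp
    then show "\<exists>e>0. \<forall>y. y \<in> {a..b} \<and> h y \<noteq> h x \<longrightarrow> e \<le> norm (h y - h x)"
      by (intro exI[of _ 1]) auto
  qed
  then show ?thesis using assms(3,4) unfolding constant_on_def by auto
qed

section \<open>Existence and uniqueness of the conjugacy on the circle\<close>

context doubling_lift
begin

definition Psi_inv :: "real \<Rightarrow> real" where "Psi_inv = inv Psi"

lemma Psi_Psi_inv [simp]: "Psi (Psi_inv y) = y"
  unfolding Psi_inv_def using Psi_bij by (simp add: bij_is_surj surj_f_inv_f)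

lemma Psi_inv_Psi [simp]: "Psi_inv (Psi s) = s"
  unfolding Psi_inv_def using Psi_bij by (simp add: bij_is_inj)

lemma Psi_eq_iff: "Psi s = Psi t \<longleftrightarrow> s = t"
  by (metis Psi_inv_Psi)

lemma Psi_inv_add_int: "Psi_inv (y + of_int z) = Psi_inv y + of_int z"
  by (metis Psi_Psi_inv Psi_add_int Psi_inv_Psi)

lemma Psi_hoelder:
  assumes "\<bar>s - t\<bar> \<le> 1"
  shows "\<bar>Psi s - Psi t\<bar> \<le> 2 * \<bar>s - t\<bar> powr (1/2)"
proof (cases "s \<le> t")
  case True
  then have "\<bar>s - t\<bar> = t - s" "\<bar>Psi s - Psi t\<bar> = Psi t - Psi s" using Psi_mono[of s t] by auto
  then show ?thesis using Psi_upper[of s t] True assms by simp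
next
  case False
  then have "\<bar>s - t\<bar> = s - t" "\<bar>Psi s - Psi t\<bar> = Psi s - Psi t" using Psi_mono[of t s] by auto
  then show ?thesis using Psi_upper[of t s] False assms by simp
qed

lemma Psi_inv_hoelder:
  assumes "\<bar>a - b\<bar> \<le> 1"
  shows "\<bar>Psi_inv a - Psi_inv b\<bar> \<le> 2 * \<bar>a - b\<bar> powr (1/2)"
proof -
  have le: "\<bar>Psi_inv a - Psi_inv b\<bar> \<le> 2 * \<bar>a - b\<bar> powr (1/2)" if "Psi_inv a \<le> Psi_inv b" "\<bar>a - b\<bar> \<le> 1" for a b
  proof -
    define s t where "s = Psi_inv a" and "t = Psi_inv b"
    have ab: "a = Psi s" "b = Psi t" by (simp_all add: s_def t_def)
    have st: "s \<le> t" using that by (simp add: s_def t_def)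
    have "t \<le> s + 1"
      using Psi_strict[of "s + 1" t] that(2) Psi_add_1[of s] Psi_mono[OF st] unfolding ab by linarith
    then have "(t - s)\<^sup>2 / 4 \<le> Psi t - Psi s" using Psi_lower st by blast
    then have "((t - s) / 2)\<^sup>2 \<le> \<bar>a - b\<bar>" using Psi_mono[OF st] by (simp add: ab power_divide)
    then have "(t - s) / 2 \<le> sqrt \<bar>a - b\<bar>" by (rule real_le_rsqrt)
    then show ?thesis using st by (simp add: powr_half_sqrt s_def t_def)
  qed
  show ?thesis
    using le[of a b] le[of b a] assms by (cases "Psi_inv a \<le> Psi_inv b") (auto simp: abs_minus_commute)
qed

lemma Psi_inv_cont: "continuous_on A Psi_inv"
  by (rule sqrt_hoelder_continuous) (use Psi_inv_hoelder in \<open>simp add: dist_real_def\<close>)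

definition circle_map :: "(real \<Rightarrow> real) \<Rightarrow> circle \<Rightarrow> circle" where
  "circle_map h c = to_circle (h (rep_circle c))"

lemma circle_map:
  assumes "\<And>t z. h (t + of_int z) = h t + of_int z"
  shows "circle_map h (to_circle t) = to_circle (h t)"
proof -
  have "to_circle (rep_circle (to_circle t)) = to_circle t"
    by (metis Quotient_abs_rep Quotient_circle)
  then have "rep_circle (to_circle t) - t \<in> \<int>" by (simp only: to_circle_eq_iff)
  then obtain z where "rep_circle (to_circle t) = t + of_int z"
    by (metis Ints_cases add.commute diff_add_cancel)
  then show ?thesis by (simp add: circle_map_def assms to_circle_add_int)
qed

lemma circle_map_hoelder:
  assumes add: "\<And>t z. h (t + of_int z) = h t + of_int z"
    and h: "\<And>s t. \<bar>s - t\<bar> \<le> 1 \<Longrightarrow> \<bar>h s - h t\<bar> \<le> 2 * \<bar>s - t\<bar> powr (1/2)"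
  shows "dist (circle_map h x) (circle_map h y) \<le> 2 * dist x y powr (1/2)"
proof -
  obtain s t where st: "x = to_circle s" "y = to_circle t" "dist x y = \<bar>s - t\<bar>" "\<bar>s - t\<bar> \<le> 1"
    by (rule circle_representatives)
  have "dist (circle_map h x) (circle_map h y) \<le> \<bar>h s - h t\<bar>"
    unfolding st(1,2) circle_map[OF add] by (rule dist_to_circle_le)
  then show ?thesis using h[OF st(4)] st(3) by simp
qed

lemma hoelder_conjugacy_exists:
  assumes f: "\<And>t. to_circle (F t) = f (to_circle t)"
  shows "\<exists>\<psi>. hoelder_conjugacy doubling f \<psi>"
proof -
  define \<psi> \<phi> where "\<psi> = circle_map Psi" and "\<phi> = circle_map Psi_inv"
  have \<psi>: "\<psi> (to_circle t) = to_circle (Psi t)" for t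
    unfolding \<psi>_def by (rule circle_map[OF Psi_add_int])
  have \<phi>: "\<phi> (to_circle t) = to_circle (Psi_inv t)" for t
    unfolding \<phi>_def by (rule circle_map[OF Psi_inv_add_int])
  have \<phi>\<psi>: "\<phi> (\<psi> c) = c" "\<psi> (\<phi> c) = c" for c
    by (rule circle_cases[of c]; simp add: \<psi> \<phi>)+
  have h\<psi>: "dist (\<psi> x) (\<psi> y) \<le> 2 * dist x y powr (1/2)" for x y
    unfolding \<psi>_def by (rule circle_map_hoelder[OF Psi_add_int Psi_hoelder])
  have h\<phi>: "dist (\<phi> x) (\<phi> y) \<le> 2 * dist x y powr (1/2)" for x y
    unfolding \<phi>_def by (rule circle_map_hoelder[OF Psi_inv_add_int Psi_inv_hoelder])
  have "range \<psi> = UNIV" "range \<phi> = UNIV"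
    by (rule surjI[of \<psi> \<phi>], rule \<phi>\<psi>) (rule surjI[of \<phi> \<psi>], rule \<phi>\<psi>)
  then have "homeomorphism UNIV UNIV \<psi> \<phi>"
    unfolding homeomorphism_def
    using sqrt_hoelder_continuous[OF h\<psi>] sqrt_hoelder_continuous[OF h\<phi>] \<phi>\<psi> by blast
  moreover have "hoelder_map \<psi>" "hoelder_map \<phi>"
    unfolding hoelder_map_def using h\<psi> h\<phi>
    by (intro exI[of _ "1/2"] exI[of _ 2]; simp)+
  moreover have "\<psi> (doubling c) = f (\<psi> c)" for c
    by (rule circle_cases[of c]) (simp add: to_circle_double \<psi> f F_Psi flip: f)
  ultimately show ?thesis
    unfolding hoelder_conjugacy_def by (intro exI[of _ \<psi>]) (auto simp: fun_eq_iff)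
qed

text \<open>\<open>X\<close>, the lift read through \<open>Psi_inv\<close>, commutes with doubling
  modulo integers. By continuity the integers are constant on each half of the interval, so the
  deviation of \<open>X\<close> from an affine function doubles exactly and must vanish. Injectivity
  restricts the slope to 1 or -1.\<close>

lemma conjugacy_lift_unique:
  assumes f: "\<And>t. to_circle (F t) = f (to_circle t)"
    and conjugacy: "hoelder_conjugacy doubling f \<psi>" and lift: "is_lift \<psi> \<Psi>"
  obtains p :: int and D :: int where "D = 1 \<or> D = -1"
    "\<And>t. t \<in> {0..1} \<Longrightarrow> \<Psi> t = Psi (of_int D * t) + of_int p"
proof -
  have inj: "inj \<psi>"
    using conjugacy unfolding hoelder_conjugacy_def homeomorphism_def by (auto intro: inj_on_inverseI)
  have conj: "\<psi> (doubling c) = f (\<psi> c)" for c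
    using conjugacy unfolding hoelder_conjugacy_def by (auto simp: fun_eq_iff)
  have \<Psi>: "to_circle (\<Psi> t) = \<psi> (to_circle t)" if "t \<in> {0..1}" for t
    using lift that unfolding is_lift_def by blast
  define X where "X t = Psi_inv (\<Psi> t)" for t
  have PX: "Psi (X t) = \<Psi> t" for t by (simp add: X_def)
  have Xc: "continuous_on {0..1} X"
    unfolding X_def using lift
    by (intro continuous_on_compose2[OF Psi_inv_cont[of UNIV]]) (auto simp: is_lift_def)
  have step: "2 * X t - X t' \<in> \<int>" if t: "t \<in> {0..1}" "t' \<in> {0..1}" "2 * t - t' \<in> \<int>" for t t'
  proof -
    have "to_circle (\<Psi> t') = \<psi> (doubling (to_circle t))"
      using \<Psi>[OF t(2)] t(3) by (simp add: to_circle_double to_circle_eq_iff[THEN iffD2])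
    also have "\<dots> = to_circle (F (\<Psi> t))"
      unfolding conj f \<Psi>[OF t(1)] ..
    also have "F (\<Psi> t) = Psi (2 * X t)"
      unfolding PX[symmetric] by (rule F_Psi)
    finally have "Psi (2 * X t) - \<Psi> t' \<in> \<int>"
      by (metis to_circle_eq_iff)
    then obtain z where "Psi (2 * X t) - \<Psi> t' = of_int z" by (metis Ints_cases)
    then have "Psi (2 * X t) = \<Psi> t' + of_int z" by simp
    also have "\<dots> = Psi (X t' + of_int z)" unfolding Psi_add_int PX ..
    finally have "Psi (2 * X t) = Psi (X t' + of_int z)" .
    then show ?thesis by (simp add: Psi_eq_iff)
  qed
  have c1: "continuous_on {0..1/2} (\<lambda>t. 2 * X t - X (2 * t))"
    by (intro continuous_intros continuous_on_subset[OF Xc] continuous_on_compose2[OF Xc]) auto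
  have c2: "continuous_on {1/2..1} (\<lambda>t. 2 * X t - X (2 * t - 1))"
    by (intro continuous_intros continuous_on_subset[OF Xc] continuous_on_compose2[OF Xc]) auto
  \<comment> \<open>The constant is read off at a fixed point of the doubling formula, 0 on the left
    half and 1 on the right half.\<close>
  have left: "2 * X t - X (2 * t) = X 0" if "t \<in> {0..1/2}" for t
    using continuous_Ints_constant[OF c1 _ that, of 0] step by force
  have right: "2 * X t - X (2 * t - 1) = X 1" if "t \<in> {1/2..1}" for t
    using continuous_Ints_constant[OF c2 _ that, of 1] step by force
  have "X 0 \<in> \<int>" "X 1 \<in> \<int>" using step[of 0 0] step[of 1 1] by auto
  then obtain p p' where p: "X 0 = of_int p" "X 1 = of_int p'" by (metis Ints_cases)
  define D where "D = p' - p"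
  define E where "E t = X t - of_int p - of_int D * t" for t
  have Ec: "continuous_on {0..1} E" unfolding E_def by (intro continuous_intros Xc)
  have E1: "E (2 * t) = 2 * E t" if "t \<in> {0..1/2}" for t
    using left[OF that] by (simp add: E_def p algebra_simps)
  have E2: "E (2 * t - 1) = 2 * E t" if "t \<in> {1/2..1}" for t
    using right[OF that] by (simp add: E_def p D_def algebra_simps)
  have "continuous_on {0..1} (\<lambda>t. \<bar>E t\<bar>)" by (intro continuous_intros Ec)
  then obtain t0 where t0: "t0 \<in> {0..1}" "\<And>t. t \<in> {0..1} \<Longrightarrow> \<bar>E t\<bar> \<le> \<bar>E t0\<bar>"
    using continuous_attains_sup[of "{0..1::real}" "\<lambda>t. \<bar>E t\<bar>"] by auto
  \<comment> \<open>Whichever half contains the maximum point of |E|, doubling it stays in the unit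
    interval and doubles \<open>E\<close>.\<close>
  have "2 * \<bar>E t0\<bar> \<le> \<bar>E t0\<bar>"
  proof (cases "t0 \<le> 1/2")
    case True
    then show ?thesis using E1[of t0] t0(2)[of "2 * t0"] t0(1) by auto
  next
    case False
    then show ?thesis using E2[of t0] t0(2)[of "2 * t0 - 1"] t0(1) by auto
  qed
  then have E0: "E t = 0" if "t \<in> {0..1}" for t using t0(2)[OF that] by simp
  have X: "X t = of_int D * t + of_int p" if "t \<in> {0..1}" for t
    using E0[OF that] unfolding E_def by linarith
  have form: "\<Psi> t = Psi (of_int D * t) + of_int p" if "t \<in> {0..1}" for t
    using PX[of t] unfolding X[OF that] Psi_add_int ..
  \<comment> \<open>Such a \<open>t\<close> would have the same image under \<open>\<psi>\<close> as
    0. Slope 0 is excluded by \<open>t = 1/2\<close>, and slopes of modulus at least 2 by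
    \<open>t = 1 / |D|\<close>.\<close>
  have noInt: "of_int D * t \<notin> \<int>" if t: "0 < t" "t < 1" for t :: real
  proof
    assume "of_int D * t \<in> \<int>"
    then obtain z where z: "of_int D * t = of_int z" by (metis Ints_cases)
    then have "\<Psi> t = \<Psi> 0 + of_int z"
      using form[of t] form[of 0] t Psi_add_int[of 0 z] by simp
    then have "to_circle (\<Psi> t) = to_circle (\<Psi> 0)" by (simp only: to_circle_add_int)
    then have "\<psi> (to_circle t) = \<psi> (to_circle 0)" using \<Psi>[of t] \<Psi>[of 0] t by simp
    then have "t \<in> \<int>" using inj by (simp add: inj_eq to_circle_eq_iff)
    then show False using t by (auto elim!: Ints_cases)
  qed
  have "D = 1 \<or> D = -1"
  proof (rule ccontr)
    assume "\<not> (D = 1 \<or> D = -1)"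
    then consider "D = 0" | "\<bar>D\<bar> \<ge> 2" by linarith
    then show False
    proof cases
      case 1
      then show False using noInt[of "1/2"] by simp
    next
      case 2
      then have "of_int D * (1 / \<bar>real_of_int D\<bar>) \<in> \<int>" by (auto simp: abs_if)
      moreover have "1 / \<bar>real_of_int D\<bar> < 1" "0 < 1 / \<bar>real_of_int D\<bar>" using 2 by auto
      ultimately show False using noInt by blast
    qed
  qed
  then show ?thesis using form that by blast
qed

text \<open>The integer translation contributes a unimodular factor. Reflection moves the integral
  to the interval from -1 to 0, and translating back by 1 costs another unimodular factor since
  \<open>Psi\<close> commutes with it.\<close>

lemma lift_fourier:
  assumes D: "D = 1 \<or> D = (-1 :: int)"
    and form: "\<And>t. t \<in> {0..1} \<Longrightarrow> \<Psi> t = Psi (of_int D * t) + of_int p"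
  shows "cmod (integral {0..1} (\<lambda>t. exp (\<i> * of_real (\<xi> * \<Psi> t)))) = cmod (fourier \<xi>)"
proof -
  define h where "h s = cis (\<xi> * Psi s)" for s
  have hc: "continuous_on A h" for A unfolding h_def by (intro continuous_intros Psi_cont)
  have const: "cmod (integral {0..1} (\<lambda>t. cis c * g t)) = cmod (integral {0..1} g)"
    if "continuous_on {0..1} g" for c and g :: "real \<Rightarrow> complex"
  proof -
    have "integral {0..1} (\<lambda>t. cis c * g t) = cis c * integral {0..1} g"
      by (intro integral_unique has_integral_mult_right integrable_integral integrable_continuous_real that)
    then show ?thesis by (simp add: norm_mult)
  qed
  have "integral {0..1} (\<lambda>t. exp (\<i> * of_real (\<xi> * \<Psi> t))) = integral {0..1} (\<lambda>t. cis (\<xi> * of_int p) * h (of_int D * t))"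
    by (rule integral_cong) (simp add: form h_def cis_mult distrib_left add.commute del: of_real_mult of_real_add flip: cis_conv_exp)
  also have "cmod \<dots> = cmod (integral {0..1} (\<lambda>t. h (of_int D * t)))"
    by (intro const continuous_on_compose2[OF hc[of UNIV]] continuous_intros) auto
  also have "\<dots> = cmod (integral {0..1} h)"
    using D
  proof
    assume "D = -1"
    then have "integral {0..1} (\<lambda>t. h (of_int D * t)) = integral {-0..-(-1)} (\<lambda>t. h (- t))" by simp
    also have "\<dots> = integral {-1..0} h"
      by (rule Henstock_Kurzweil_Integration.integral_reflect_real)
    also have "\<dots> = integral {0 + (-1)..1 + (-1)} h" by simp
    also have "\<dots> = integral {0..1} (h \<circ> (\<lambda>x. x + (-1)))"
      by (rule integral_shift[symmetric]) (rule hc)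
    also have "h \<circ> (\<lambda>x. x + (-1)) = (\<lambda>x. cis (- \<xi>) * h x)"
      using Psi_add_int[of _ "-1"] by (simp add: h_def cis_mult fun_eq_iff right_diff_distrib)
    also have "cmod (integral {0..1} \<dots>) = cmod (integral {0..1} h)" by (rule const[OF hc])
    finally show ?thesis .
  qed simp
  finally show ?thesis by (simp only: h_def[abs_def])
qed

end

lemma abs_le_C_norm:
  assumes "j \<le> k"
  shows "ereal \<bar>circle_deriv j g t\<bar> \<le> C_norm k \<alpha> g"
proof -
  have sup: "ereal \<bar>h t\<bar> \<le> sup_norm h" for h t
    unfolding sup_norm_def by (rule SUP_upper) simp
  have sup0: "0 \<le> sup_norm h" for h
    by (rule order_trans[OF _ sup[of h 0]]) simp
  have "ereal (\<bar>h 0 - h 1\<bar> / \<bar>0 - 1\<bar> powr \<alpha>) \<le> hoelder_seminorm \<alpha> h" for h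
    unfolding hoelder_seminorm_def by (rule SUP_upper2[of "(0, 1)"]) auto
  then have hoelder0: "0 \<le> hoelder_seminorm \<alpha> h" for h
    by (rule order_trans[rotated]) simp
  have "sup_norm (circle_deriv j g) \<le> (\<Sum>j\<le>k. sup_norm (circle_deriv j g))"
    using sum_mono2[of "{..k}" "{j}" "\<lambda>j. sup_norm (circle_deriv j g)"] assms sup0 by simp
  also have "\<dots> \<le> C_norm k \<alpha> g"
    unfolding C_norm_def using hoelder0 by (rule add_increasing2) simp
  finally show ?thesis using sup order_trans by blast
qed

text \<open>Norm below 1/10 bounds the derivative of the perturbation by 1/10, placing
  \<open>F1\<close> between 19/10 and 21/10; the same bound on \<open>g\<close> itself gives
  \<open>F_near\<close>.\<close>

lemma doubling_perturbation_lift: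
  assumes "doubling_perturbation k \<alpha> (1/10) f" "1 \<le> k"
  obtains g where "doubling_lift (\<lambda>t. 2 * t + g (to_circle t)) (\<lambda>t. 2 + circle_deriv 1 g t)"
    "\<And>t. to_circle (2 * t + g (to_circle t)) = f (to_circle t)" "C_class k \<alpha> g"
    "\<And>j t. j \<le> k \<Longrightarrow> \<bar>circle_deriv j g t\<bar> \<le> 1/10"
proof -
  obtain g where g: "\<And>x. to_circle (g x) = f x - doubling x" "C_class k \<alpha> g" "C_norm k \<alpha> g < ereal (1/10)"
    using assms(1) unfolding doubling_perturbation_def by blast
  have bound: "\<bar>circle_deriv j g t\<bar> \<le> 1/10" if "j \<le> k" for j t
    using less_imp_le[OF order.strict_trans1[OF abs_le_C_norm[OF that] g(3)]]
    by (simp only: ereal_less_eq)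
  have cd: "circle_deriv 0 g = (\<lambda>t. g (to_circle t))" "circle_deriv 1 g = deriv (\<lambda>t. g (to_circle t))"
    by (simp_all add: circle_deriv_def)
  have "circle_deriv 0 g differentiable at t" for t
    using g(2) assms(2) unfolding C_class_def by auto
  then have deriv: "((\<lambda>t. g (to_circle t)) has_real_derivative circle_deriv 1 g t) (at t)" for t
    unfolding cd using DERIV_deriv_iff_real_differentiable by blast
  have "doubling_lift (\<lambda>t. 2 * t + g (to_circle t)) (\<lambda>t. 2 + circle_deriv 1 g t)"
  proof
    fix x
    show "((\<lambda>t. 2 * t + g (to_circle t)) has_real_derivative 2 + circle_deriv 1 g x) (at x)"
      by (auto intro!: derivative_eq_intros deriv)
    show "9/5 \<le> 2 + circle_deriv 1 g x" "2 + circle_deriv 1 g x \<le> 21/10"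
      using bound[OF assms(2), of x] by (auto simp: abs_le_iff)
    show "2 * (x + 1) + g (to_circle (x + 1)) = 2 * x + g (to_circle x) + 2"
      using to_circle_add_int[of x 1] by simp
    show "\<bar>2 * x + g (to_circle x) - 2 * x\<bar> \<le> 1"
      using bound[of 0 x] by (simp add: cd)
  qed
  moreover have "to_circle (2 * t + g (to_circle t)) = f (to_circle t)" for t
    by (simp add: to_circle_add g(1) flip: to_circle_double)
  ultimately show ?thesis using g(2) bound that by blast
qed

lemma doubling_perturbation_decay:
  assumes f: "doubling_perturbation 2 \<alpha> (1/10) f" and \<psi>: "hoelder_conjugacy doubling f \<psi>" and \<Psi>: "is_lift \<psi> \<Psi>"
  shows "\<exists>C>0. \<exists>\<rho>>0. \<forall>\<xi>::real. \<xi> \<noteq> 0 \<longrightarrow>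
    cmod (integral {0..1} (\<lambda>x. exp (\<i> * of_real (\<xi> * \<Psi> x)))) \<le> C * \<bar>\<xi>\<bar> powr (- \<rho>)"
proof -
  obtain g where g: "doubling_lift (\<lambda>t. 2 * t + g (to_circle t)) (\<lambda>t. 2 + circle_deriv 1 g t)"
    "\<And>t. to_circle (2 * t + g (to_circle t)) = f (to_circle t)" "C_class 2 \<alpha> g"
    "\<And>j t. j \<le> 2 \<Longrightarrow> \<bar>circle_deriv j g t\<bar> \<le> 1/10"
    using doubling_perturbation_lift[OF f] by auto
  let ?F = "\<lambda>t. 2 * t + g (to_circle t)" and ?F1 = "\<lambda>t. 2 + circle_deriv 1 g t"
  interpret doubling_lift ?F ?F1 by (rule g(1))
  interpret doubling_lift_C2 ?F ?F1 "circle_deriv 2 g"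
  proof
    fix x
    have "circle_deriv 1 g differentiable at x"
      using g(3) unfolding C_class_def by auto
    then have "(circle_deriv 1 g has_real_derivative deriv (circle_deriv 1 g) x) (at x)"
      using DERIV_deriv_iff_real_differentiable by blast
    then show "(?F1 has_real_derivative circle_deriv 2 g x) (at x)"
      by (auto intro!: derivative_eq_intros simp: circle_deriv_def numeral_2_eq_2)
    show "continuous_on UNIV (circle_deriv 2 g)"
      using g(3) unfolding C_class_def by simp
    show "\<bar>circle_deriv 2 g x\<bar> \<le> 1"
      using g(4)[of 2 x] by simp
  qed
  obtain p D :: int where pD: "D = 1 \<or> D = -1"
    "\<And>t. t \<in> {0..1} \<Longrightarrow> \<Psi> t = Psi (of_int D * t) + of_int p"
    using conjugacy_lift_unique[OF g(2) \<psi> \<Psi>] by metis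
  obtain C r where C: "C > 0" "r > 0"
    "\<And>\<xi>. \<xi> \<noteq> 0 \<Longrightarrow> cmod (fourier \<xi>) \<le> C * \<bar>\<xi>\<bar> powr (- r)"
    using Psi_fourier_decay by metis
  have "cmod (integral {0..1} (\<lambda>x. exp (\<i> * of_real (\<xi> * \<Psi> x)))) \<le> C * \<bar>\<xi>\<bar> powr (- r)" if "\<xi> \<noteq> 0" for \<xi>
    using C(3)[OF that] lift_fourier[OF pD, of \<xi>] by (simp only:)
  then show ?thesis using C(1,2) by blast
qed

theorem theorem1p4:
  fixes \<alpha> :: real
  assumes "0 < \<alpha>" and "\<alpha> < 1"
  shows "\<exists>\<delta>>0.
    (\<forall>f. doubling_perturbation 1 \<alpha> \<delta> f \<longrightarrow> (\<exists>\<psi>. hoelder_conjugacy doubling f \<psi>)) \<and>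
    (\<forall>f \<psi> \<Psi>. doubling_perturbation 2 \<alpha> \<delta> f \<longrightarrow> hoelder_conjugacy doubling f \<psi> \<longrightarrow> is_lift \<psi> \<Psi> \<longrightarrow>
      (\<exists>C>0. \<exists>\<rho>>0. \<forall>\<xi>::real. \<xi> \<noteq> 0 \<longrightarrow>
        cmod (integral {0..1} (\<lambda>x. exp (\<i> * of_real (\<xi> * \<Psi> x)))) \<le> C * \<bar>\<xi>\<bar> powr (- \<rho>)))"
proof (rule exI[of _ "1/10"], intro conjI allI impI)
  fix f assume "doubling_perturbation 1 \<alpha> (1/10) f"
  then obtain g where g: "doubling_lift (\<lambda>t. 2 * t + g (to_circle t)) (\<lambda>t. 2 + circle_deriv 1 g t)"
    "\<And>t. to_circle (2 * t + g (to_circle t)) = f (to_circle t)"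
    using doubling_perturbation_lift by blast
  show "\<exists>\<psi>. hoelder_conjugacy doubling f \<psi>"
    by (rule doubling_lift.hoelder_conjugacy_exists[OF g])
qed (simp, rule doubling_perturbation_decay, assumption+)

end
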